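(* Let $d\ge3$ and $V\in RH_q$ for some $q>d/2$ ($V\ge0$, not identically zero). There exists a constant $C$ such that for all $x_0,y\in\mathbb{R}^d$ and $R>0$ with $R\le|y-x_0|\le\rho(x_0)$, and (almost) all $x\in B(x_0,R/8)$, $$|K_2(x,y)-K_{0,2}(x,y)|\le C\left|R_2\big(V\,\Gamma(y,\cdot)\,\chi_{B(x_0,R/4)}\big)(x)\right|+\frac{C}{R^d}\left(\frac{R}{\rho(x_0)}\right)^{\delta},$$ where $\delta=\min\{1,2-d/q\}$.
   Context: $V\in RH_q$ means there is $C$ with $\left(\frac1{|B|}\int_BV^q\right)^{1/q}\le C\frac1{|B|}\int_BV$ for every ball $B\subset\mathbb{R}^d$. $L=-\Delta+V$, and $$\rho(x)=\sup\left\{r>0:\frac{1}{r^{d-2}}\int_{B(x,r)}V\le1\right\}.$$ $\Gamma(x,y)$ and $\Gamma_0(x,y)$ are the fundamental solutions of $L$ and $-\Delta$ on $\mathbb{R}^d$ respectively. $K_2(x,y)=\nabla_1^2\Gamma(x,y)$ and $K_{0,2}(x,y)=\nabla_1^2\Gamma_0(x,y)$ (matrices of second derivatives in the first variable) are the kernels of the second order Riesz-Schrödinger transform $\mathcal{R}_2=\nabla^2L^{-1}$ and of the classical one $R_2=\nabla^2(-\Delta)^{-1}$. Here $R_2$ acts on compactly supported functions in $L^q$, and $|\cdot|$ is a matrix norm. *)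

theory Defs
  imports "HOL-Analysis.Analysis"
begin

section \<open>Test functions and weak Hessians\<close>

primrec iter_deriv ::
  "'a::real_normed_vector list \<Rightarrow> ('a \<Rightarrow> 'b::real_normed_vector) \<Rightarrow> 'a \<Rightarrow> 'b" where
  "iter_deriv [] f = f"
| "iter_deriv (v # vs) f = (\<lambda>x. frechet_derivative (iter_deriv vs f) (at x) v)"

text \<open>\<open>C\<^sup>\<infinity>\<close>: every iterated directional derivative exists and is again (Frechet) differentiable.\<close>

definition smooth :: "('a::real_normed_vector \<Rightarrow> 'b::real_normed_vector) \<Rightarrow> bool" where
  "smooth f \<longleftrightarrow> (\<forall>vs x. iter_deriv vs f differentiable at x)"

definition test_function :: "'a::real_normed_vector set \<Rightarrow> ('a \<Rightarrow> real) \<Rightarrow> bool" where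
  "test_function S \<phi> \<longleftrightarrow>
     smooth \<phi> \<and> (\<exists>K. compact K \<and> K \<subseteq> S \<and> (\<forall>x. x \<notin> K \<longrightarrow> \<phi> x = 0))"

definition partial2 :: "'n::finite \<Rightarrow> 'n \<Rightarrow> (real ^ 'n \<Rightarrow> real) \<Rightarrow> real ^ 'n \<Rightarrow> real" where
  "partial2 i j \<phi> = iter_deriv [axis i 1, axis j 1] \<phi>"

definition laplacian :: "(real ^ 'n::finite \<Rightarrow> real) \<Rightarrow> real ^ 'n \<Rightarrow> real" where
  "laplacian \<phi> x = (\<Sum>i\<in>UNIV. partial2 i i \<phi> x)"

definition locally_integrable_on ::
  "('a::euclidean_space \<Rightarrow> 'b::euclidean_space) \<Rightarrow> 'a set \<Rightarrow> bool" where
  "locally_integrable_on f S \<longleftrightarrow> (\<forall>K. compact K \<and> K \<subseteq> S \<longrightarrow> f absolutely_integrable_on K)"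

text \<open>\<open>H\<close> is a version of the distributional matrix \<open>\<nabla>\<^sup>2 u\<close> on the open set \<open>S\<close>. For \<open>q\<close> close
  to \<open>d/2\<close> the second derivatives of solutions of \<open>-\<Delta>u + Vu = 0\<close> exist only in this sense, as
  functions determined up to null sets.\<close>

definition weak_hessian ::
  "(real ^ 'n::finite) set \<Rightarrow> (real ^ 'n \<Rightarrow> real) \<Rightarrow> (real ^ 'n \<Rightarrow> real ^ 'n ^ 'n) \<Rightarrow> bool" where
  "weak_hessian S u H \<longleftrightarrow>
     locally_integrable_on u S \<and> locally_integrable_on H S \<and>
     (\<forall>\<phi> i j. test_function S \<phi> \<longrightarrow>
        (LINT x|lebesgue. u x * partial2 i j \<phi> x) = (LINT x|lebesgue. H x $ i $ j * \<phi> x))"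

section \<open>The potential\<close>

definition reverse_Hoelder :: "real \<Rightarrow> ('a::euclidean_space \<Rightarrow> real) \<Rightarrow> bool" where
  "reverse_Hoelder q V \<longleftrightarrow>
     locally_integrable_on V UNIV \<and> locally_integrable_on (\<lambda>x. V x powr q) UNIV \<and>
     (\<exists>C. \<forall>x r. 0 < r \<longrightarrow>
        (1 / measure lebesgue (ball x r) * (LINT z:ball x r|lebesgue. V z powr q)) powr (1 / q)
          \<le> C * (1 / measure lebesgue (ball x r) * (LINT z:ball x r|lebesgue. V z)))"

definition crit_radius :: "(real ^ 'n::finite \<Rightarrow> real) \<Rightarrow> real ^ 'n \<Rightarrow> real" where
  "crit_radius V x =
     Sup {r. 0 < r \<and> 1 / r ^ (CARD('n) - 2) * (LINT z:ball x r|lebesgue. V z) \<le> 1}"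

section \<open>Fundamental solutions and second order Riesz transforms\<close>

text \<open>\<open>(-\<Delta> + V) G(\<cdot>,y) = \<delta>\<^sub>y\<close> in the sense of distributions, for every pole \<open>y\<close>. Among all such
  \<open>G\<close>, decay at infinity selects \<^emph>\<open>the\<close> fundamental solution (in dimension at least 3 and for
  \<open>V \<ge> 0\<close>), and continuity off the pole selects its pointwise values there; the value
  \<open>G y y\<close> is irrelevant. \<open>V = 0\<close> gives the fundamental solution of \<open>-\<Delta>\<close>.\<close>

definition fundamental_solution ::
  "(real ^ 'n::finite \<Rightarrow> real) \<Rightarrow> (real ^ 'n \<Rightarrow> real ^ 'n \<Rightarrow> real) \<Rightarrow> bool" where
  "fundamental_solution V G \<longleftrightarrow>
     (\<forall>y. continuous_on (- {y}) (\<lambda>x. G x y) \<and>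
          ((\<lambda>x. G x y) \<longlongrightarrow> 0) at_infinity \<and>
          locally_integrable_on (\<lambda>x. G x y) UNIV \<and>
          locally_integrable_on (\<lambda>x. V x * G x y) UNIV \<and>
          (\<forall>\<phi>. test_function UNIV \<phi> \<longrightarrow>
             (LINT x|lebesgue. G x y * (- laplacian \<phi> x + V x * \<phi> x)) = \<phi> y))"

definition hessian_kernel ::
  "(real ^ 'n::finite \<Rightarrow> real ^ 'n \<Rightarrow> real) \<Rightarrow> (real ^ 'n \<Rightarrow> real ^ 'n \<Rightarrow> real ^ 'n ^ 'n) \<Rightarrow> bool" where
  "hessian_kernel G K \<longleftrightarrow> (\<forall>y. weak_hessian (- {y}) (\<lambda>x. G x y) (\<lambda>x. K x y))"

definition compactly_supported_Lq :: "real \<Rightarrow> ('a::euclidean_space \<Rightarrow> real) \<Rightarrow> bool" where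
  "compactly_supported_Lq q f \<longleftrightarrow>
     f \<in> borel_measurable lebesgue \<and> integrable lebesgue (\<lambda>x. \<bar>f x\<bar> powr q) \<and>
     (\<exists>K. compact K \<and> (\<forall>x. x \<notin> K \<longrightarrow> f x = 0))"

text \<open>\<open>T = \<nabla>\<^sup>2 (-\<Delta>)\<^sup>-\<^sup>1\<close>, where \<open>(-\<Delta>)\<^sup>-\<^sup>1\<close> is integration against the fundamental solution
  \<open>G0\<close> of \<open>-\<Delta>\<close>. This determines each \<open>T f\<close> almost everywhere.\<close>

definition second_order_Riesz ::
  "real \<Rightarrow> (real ^ 'n::finite \<Rightarrow> real ^ 'n \<Rightarrow> real)
    \<Rightarrow> ((real ^ 'n \<Rightarrow> real) \<Rightarrow> real ^ 'n \<Rightarrow> real ^ 'n ^ 'n) \<Rightarrow> bool" where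
  "second_order_Riesz q G0 T \<longleftrightarrow>
     (\<forall>f. compactly_supported_Lq q f \<longrightarrow>
        weak_hessian UNIV (\<lambda>x. LINT z|lebesgue. G0 x z * f z) (T f))"

end

theory Submission
  imports Defs
begin

text \<open>Write \<open>d\<close> for the dimension and \<open>N x = |x|\<^sup>2\<^sup>-\<^sup>d\<close>. Flattening \<open>N\<close> near its pole at scale \<open>r\<close>, in such a way
  that it stays smooth and superharmonic, gives kernels whose differences at two scales are nonnegative
  test functions, and whose Laplacians are differences of two averaging kernels of equal mass. Testing
  the equation of \<open>\<Gamma>(\<cdot>,y)\<close> with these differences and letting the two scales tend to 0 and to
  infinity gives \<open>c \<Gamma>(x,y) + \<integral> N(x - z) V(z) \<Gamma>(z,y) dz = N(x - y)\<close> as soon as \<open>\<Gamma> \<ge> 0\<close>, which is Kato's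
  inequality. For \<open>V = 0\<close> this identifies \<open>\<Gamma>\<^sub>0\<close>, and Tonelli's theorem gives the symmetry of \<open>\<Gamma>\<close>.

  Hence \<open>K\<^sub>2 - K\<^sub>0\<^sub>2 + R\<^sub>2(V \<Gamma>(y,\<cdot>) \<chi>)\<close> is on \<open>B(x\<^sub>0,R/8)\<close> the weak Hessian of the potential of \<open>V \<Gamma>(\<cdot>,y)\<close>
  outside \<open>B(x\<^sub>0,R/4)\<close>, and is bounded by \<open>R\<^sup>-\<^sup>2\<close> times the integral of \<open>|z - x\<^sub>0|\<^sup>2\<^sup>-\<^sup>d V(z) \<Gamma>(z,y)\<close> over the
  exterior of \<open>B(x\<^sub>0,R/4)\<close>. Inside \<open>B(x\<^sub>0,\<rho>)\<close> one has \<open>c \<Gamma> \<le> N\<close>, and Hoelder's inequality together with a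
  small self-improvement of the reverse Hoelder condition gives the bound. Outside, the integral is
  compared with the integral equation at the point at distance \<open>\<rho>\<close> from \<open>x\<^sub>0\<close> opposite to \<open>y\<close>.\<close>

section \<open>Smooth functions\<close>

text \<open>\<open>fundamental_solution\<close> provides neither a sign nor symmetry, and its
  equation may be tested only with smooth functions of compact support, which the Newtonian kernel
  is not. Hence the smooth substitutes with explicit Laplacians, and hence an inequality of Kato
  type proved with averages instead of pointwise derivatives of the solution. The far estimate is
  shaped by exponents. In the critical ball and away from y the integrand is about |z - x0|^(4-2d)
  V(z), and Hoelder with reverse Hoelder bounds the V-mass of B(x0,t) by a multiple of
  t^(d-2+\<alpha>) \<rho>^(-\<alpha>), where \<alpha> = 2 - d/q. Pulling out |z -
  x0|^(2-d+\<delta>), at most a multiple of R^(2-d+\<delta>) because \<delta> \<le> 1 \<le> d - 2,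
  leaves the weight |z - x0|^(-(d-2+\<delta>)). If q \<le> d then \<delta> = \<alpha>, and the
  bounds for all dyadic shells are equal: their sum diverges. A geometric decay of the mass of V^q
  in shrinking balls restores convergence. Since second derivatives exist only weakly, the pointwise
  bound comes from duality: pairings with test functions are bounded by their L^1 norms.\<close>

definition smooth_on :: "'a::real_normed_vector set \<Rightarrow> ('a \<Rightarrow> 'b::real_normed_vector) \<Rightarrow> bool" where
  "smooth_on U f \<longleftrightarrow> (\<forall>vs. \<forall>x\<in>U. iter_deriv vs f differentiable at x)"

lemma smooth_on_UNIV: "smooth_on UNIV f \<longleftrightarrow> smooth f"
  by (simp add: smooth_on_def smooth_def)

lemma smooth_on_subset: "smooth_on U f \<Longrightarrow> W \<subseteq> U \<Longrightarrow> smooth_on W f"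
  by (auto simp: smooth_on_def)

lemma iter_deriv_append: "iter_deriv (vs @ ws) f = iter_deriv vs (iter_deriv ws f)"
  by (induction vs) auto

lemma frechet_derivative_cong_open:
  assumes "open U" "x \<in> U" "\<And>z. z \<in> U \<Longrightarrow> f z = g z" "g differentiable at x"
  shows "f differentiable at x" "frechet_derivative f (at x) = frechet_derivative g (at x)"
proof -
  have g: "(g has_derivative frechet_derivative g (at x)) (at x)"
    using assms(4) frechet_derivative_works by blast
  have f: "(f has_derivative frechet_derivative g (at x)) (at x)"
    by (rule has_derivative_transform_within_open[OF g assms(1,2)]) (use assms(3) in auto)
  show "f differentiable at x" using f differentiableI by blast
  show "frechet_derivative f (at x) = frechet_derivative g (at x)"
    using f frechet_derivative_at by fastforce
qed

lemma iter_deriv_cong_open: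
  assumes "open U" "\<And>z. z \<in> U \<Longrightarrow> f z = g z" "smooth_on U g"
  shows "\<forall>x\<in>U. iter_deriv vs f x = iter_deriv vs g x"
proof (induction vs)
  case (Cons v vs)
  show ?case
  proof
    fix x assume "x \<in> U"
    have "iter_deriv vs g differentiable at x"
      using assms(3) \<open>x \<in> U\<close> by (auto simp: smooth_on_def)
    then have "frechet_derivative (iter_deriv vs f) (at x) = frechet_derivative (iter_deriv vs g) (at x)"
      using Cons by (intro frechet_derivative_cong_open(2)[OF assms(1) \<open>x \<in> U\<close>]) auto
    then show "iter_deriv (v # vs) f x = iter_deriv (v # vs) g x" by simp
  qed
qed (use assms in auto)

lemma smooth_on_cong_open:
  assumes "open U" "\<And>z. z \<in> U \<Longrightarrow> f z = g z" "smooth_on U g"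
  shows "smooth_on U f"
  unfolding smooth_on_def
proof (intro allI ballI)
  fix vs x assume x: "x \<in> U"
  show "iter_deriv vs f differentiable at x"
    by (rule frechet_derivative_cong_open(1)[OF assms(1) x, of _ "iter_deriv vs g"])
       (use assms(3) iter_deriv_cong_open[OF assms, of vs] x in \<open>auto simp: smooth_on_def\<close>)
qed

lemma smooth_on_Un: "smooth_on U f \<Longrightarrow> smooth_on W f \<Longrightarrow> smooth_on (U \<union> W) f"
  by (auto simp: smooth_on_def)

lemma has_real_derivative_iff_mult:
  "(f has_real_derivative D) F \<longleftrightarrow> (f has_derivative (\<lambda>v. v * D)) F"
proof -
  have "(\<lambda>v. v * D) = (*) D" by (auto simp: fun_eq_iff)
  then show ?thesis by (simp add: has_field_derivative_def)
qed

text \<open>The algebra of functions generated by \<open>G\<close> and the constants. If the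
  directional derivatives of each generator lie in this algebra, the Leibniz rule closes the whole
  algebra under differentiation, so all its members are smooth. Nearly every smoothness proof below
  reduces to finding such a \<open>G\<close>.\<close>

inductive_set alg :: "('a \<Rightarrow> real) set \<Rightarrow> ('a \<Rightarrow> real) set" for G where
  gen: "g \<in> G \<Longrightarrow> g \<in> alg G"
| const: "(\<lambda>_. c) \<in> alg G"
| add: "f \<in> alg G \<Longrightarrow> g \<in> alg G \<Longrightarrow> (\<lambda>x. f x + g x) \<in> alg G"
| mult: "f \<in> alg G \<Longrightarrow> g \<in> alg G \<Longrightarrow> (\<lambda>x. f x * g x) \<in> alg G"

lemma alg_has_derivative:
  assumes G: "\<And>g. g \<in> G \<Longrightarrow> \<exists>D. (\<forall>v. (\<lambda>x. D x v) \<in> alg G) \<and> (\<forall>x\<in>U. (g has_derivative D x) (at x))"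
    and f: "f \<in> alg G"
  shows "\<exists>D. (\<forall>v. (\<lambda>x. D x v) \<in> alg G) \<and> (\<forall>x\<in>U. (f has_derivative D x) (at x))"
  using f
proof induction
  case (gen g)
  then show ?case by (rule G)
next
  case (const c)
  show ?case by (rule exI[of _ "\<lambda>x v. 0"]) (auto intro: alg.const)
next
  case (add f g)
  then obtain D E where D: "\<forall>v. (\<lambda>x. D x v) \<in> alg G" "\<forall>x\<in>U. (f has_derivative D x) (at x)"
    "\<forall>v. (\<lambda>x. E x v) \<in> alg G" "\<forall>x\<in>U. (g has_derivative E x) (at x)" by blast
  show ?case
    by (rule exI[of _ "\<lambda>x v. D x v + E x v"])
       (use D in \<open>auto intro!: alg.add has_derivative_add\<close>)
next
  case (mult f g)
  then obtain D E where D: "\<forall>v. (\<lambda>x. D x v) \<in> alg G" "\<forall>x\<in>U. (f has_derivative D x) (at x)"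
    "\<forall>v. (\<lambda>x. E x v) \<in> alg G" "\<forall>x\<in>U. (g has_derivative E x) (at x)" by blast
  show ?case
    by (rule exI[of _ "\<lambda>x v. f x * E x v + D x v * g x"])
       (use D mult in \<open>auto intro!: alg.add alg.mult has_derivative_mult\<close>)
qed

text \<open>By induction every iterated derivative coincides on \<open>U\<close> with some member of
  the algebra. The agreement is claimed only on \<open>U\<close>, since elsewhere
  \<open>frechet_derivative\<close> may be a junk value; openness of \<open>U\<close> lets it pass
  to derivatives.\<close>

lemma alg_smooth_on:
  assumes U: "open U"
    and G: "\<And>g. g \<in> G \<Longrightarrow> \<exists>D. (\<forall>v. (\<lambda>x. D x v) \<in> alg G) \<and> (\<forall>x\<in>U. (g has_derivative D x) (at x))"
    and f: "f \<in> alg G"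
  shows "smooth_on U f"
proof -
  have "\<exists>h\<in>alg G. \<forall>x\<in>U. iter_deriv vs f x = h x" for vs
  proof (induction vs)
    case (Cons v vs)
    then obtain h where h: "h \<in> alg G" "\<forall>x\<in>U. iter_deriv vs f x = h x" by blast
    obtain D where D: "\<forall>v. (\<lambda>x. D x v) \<in> alg G" "\<forall>x\<in>U. (h has_derivative D x) (at x)"
      using alg_has_derivative[OF G h(1)] by blast
    have "iter_deriv (v # vs) f x = D x v" if "x \<in> U" for x
      using frechet_derivative_cong_open(2)[OF U that, of "iter_deriv vs f" h] h D that
        frechet_derivative_at[of h "D x" x] differentiableI[of h "D x"] by auto
    then show ?case using D(1) by (intro bexI[of _ "\<lambda>x. D x v"]) auto
  qed (use f in auto)
  note * = this
  show ?thesis unfolding smooth_on_def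
  proof (intro allI ballI)
    fix vs x assume x: "x \<in> U"
    obtain h where h: "h \<in> alg G" "\<forall>x\<in>U. iter_deriv vs f x = h x" using * by blast
    obtain D where D: "\<forall>v. (\<lambda>x. D x v) \<in> alg G" "\<forall>x\<in>U. (h has_derivative D x) (at x)"
      using alg_has_derivative[OF G h(1)] by blast
    show "iter_deriv vs f differentiable at x"
      by (rule frechet_derivative_cong_open(1)[OF U x, of _ h])
         (use D h x in \<open>auto intro: differentiableI\<close>)
  qed
qed

section \<open>Closure of smoothness under sums, products and composition\<close>

lemma smooth_on_iter_deriv_has_derivative:
  assumes "smooth_on U f" "x \<in> U"
  shows "(iter_deriv vs f has_derivative (\<lambda>v. iter_deriv (v # vs) f x)) (at x)"
proof -
  have "iter_deriv vs f differentiable at x" using assms by (simp add: smooth_on_def)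
  then show ?thesis by (simp add: frechet_derivative_works)
qed

lemma smooth_on_const [intro]: "smooth_on U (\<lambda>_. c :: real)"
proof -
  have "smooth_on UNIV (\<lambda>_. c :: real)"
    by (rule alg_smooth_on[where G = "{}"]) (auto intro: alg.const)
  then show ?thesis by (rule smooth_on_subset) auto
qed

lemma smooth_on_inner: "smooth_on U (\<lambda>x::'a::real_inner. x \<bullet> v)"
proof -
  have "smooth_on UNIV (\<lambda>x::'a. x \<bullet> v)"
  proof (rule alg_smooth_on[where G = "{\<lambda>x. x \<bullet> v}"])
    fix g :: "'a \<Rightarrow> real" assume "g \<in> {\<lambda>x. x \<bullet> v}"
    then have g: "g = (\<lambda>x. x \<bullet> v)" by simp
    show "\<exists>D. (\<forall>w. (\<lambda>x. D x w) \<in> alg {\<lambda>x. x \<bullet> v}) \<and> (\<forall>x\<in>UNIV. (g has_derivative D x) (at x))"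
      unfolding g
      by (rule exI[of _ "\<lambda>x w. w \<bullet> v"])
         (auto intro!: alg.const derivative_eq_intros)
  qed (auto intro: alg.gen)
  then show ?thesis by (rule smooth_on_subset) auto
qed

lemma
  fixes f g :: "'a::real_normed_vector \<Rightarrow> real"
  assumes U: "open U" and f: "smooth_on U f" and g: "smooth_on U g"
  shows smooth_on_add: "smooth_on U (\<lambda>x. f x + g x)"
    and smooth_on_mult: "smooth_on U (\<lambda>x. f x * g x)"
proof -
  \<comment> \<open>All iterated derivatives of \<open>f\<close> and of \<open>g\<close> together:
    by construction this set of generators is closed under differentiation.\<close>
  let ?G = "range (\<lambda>vs. iter_deriv vs f) \<union> range (\<lambda>vs. iter_deriv vs g)"
  have G: "\<exists>D. (\<forall>v. (\<lambda>x. D x v) \<in> alg ?G) \<and> (\<forall>x\<in>U. (h has_derivative D x) (at x))" if "h \<in> ?G" for h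
  proof -
    have "\<exists>u\<in>{f, g}. \<exists>vs. h = iter_deriv vs u" using that by auto
    then obtain u vs where u: "h = iter_deriv vs u" "u = f \<or> u = g" by auto
    show ?thesis
    proof (rule exI[of _ "\<lambda>x v. iter_deriv (v # vs) u x"], intro conjI allI ballI)
      fix v
      show "(\<lambda>x. iter_deriv (v # vs) u x) \<in> alg ?G" 
        using u(2) by (elim disjE; intro alg.gen) (auto simp del: iter_deriv.simps)
    next
      fix x assume "x \<in> U"
      show "(h has_derivative (\<lambda>v. iter_deriv (v # vs) u x)) (at x)"
        using u f g \<open>x \<in> U\<close> smooth_on_iter_deriv_has_derivative by blast
    qed
  qed
  have "f = iter_deriv [] f" "g = iter_deriv [] g" by simp_all
  then have fg: "f \<in> alg ?G" "g \<in> alg ?G" by (blast intro: alg.gen)+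
  show "smooth_on U (\<lambda>x. f x + g x)" "smooth_on U (\<lambda>x. f x * g x)"
    by (rule alg_smooth_on[OF U, of ?G], erule G, intro alg.add alg.mult fg)+
qed

lemma smooth_on_compose:
  fixes h :: "real \<Rightarrow> real" and g :: "'a::real_normed_vector \<Rightarrow> real"
  assumes U: "open U" and g: "smooth_on U g" and h: "smooth_on W h" and gU: "g ` U \<subseteq> W"
  shows "smooth_on U (\<lambda>x. h (g x))"
proof -
  \<comment> \<open>The chain rule only produces products of derivatives of \<open>g\<close> with
    derivatives of \<open>h\<close> evaluated at \<open>g\<close>, so these generate an algebra
    closed under differentiation.\<close>
  let ?G = "range (\<lambda>vs. iter_deriv vs g) \<union> range (\<lambda>vs x. iter_deriv vs h (g x))"
  have G: "\<exists>D. (\<forall>v. (\<lambda>x. D x v) \<in> alg ?G) \<and> (\<forall>x\<in>U. (k has_derivative D x) (at x))" if "k \<in> ?G" for k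
    using that
  proof
    assume "k \<in> range (\<lambda>vs. iter_deriv vs g)"
    then obtain vs where k: "k = iter_deriv vs g" by blast
    show ?thesis
      by (rule exI[of _ "\<lambda>x v. iter_deriv (v # vs) g x"])
         (use smooth_on_iter_deriv_has_derivative[OF g] k in
           \<open>auto intro!: alg.gen simp del: iter_deriv.simps\<close>)
  next
    assume "k \<in> range (\<lambda>vs x. iter_deriv vs h (g x))"
    then obtain vs where k: "k = (\<lambda>x. iter_deriv vs h (g x))" by blast
    show ?thesis
    proof (rule exI[of _ "\<lambda>x v. iter_deriv [v] g x * iter_deriv (1 # vs) h (g x)"], intro conjI allI ballI)
      fix v
      show "(\<lambda>x. iter_deriv [v] g x * iter_deriv (1 # vs) h (g x)) \<in> alg ?G"
        by (intro alg.mult alg.gen) (auto simp del: iter_deriv.simps)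
    next
      fix x assume x: "x \<in> U"
      have gx: "g x \<in> W" using gU x by auto
      have 1: "(g has_derivative (\<lambda>v. iter_deriv [v] g x)) (at x)"
        using smooth_on_iter_deriv_has_derivative[OF g x, of "[]"] by simp
      have 2: "(iter_deriv vs h has_derivative (\<lambda>v. iter_deriv (v # vs) h (g x))) (at (g x))"
        by (rule smooth_on_iter_deriv_has_derivative[OF h gx])
      have "linear (\<lambda>v. iter_deriv (v # vs) h (g x))"
        using 2 has_derivative_linear by blast
      then have lin: "iter_deriv (c # vs) h (g x) = c * iter_deriv (1 # vs) h (g x)" for c
        using linear_scale[of "\<lambda>v. iter_deriv (v # vs) h (g x)" c 1]
        unfolding real_scaleR_def mult_1_right by blast
      have "(k has_derivative (\<lambda>v. iter_deriv (iter_deriv [v] g x # vs) h (g x))) (at x)"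
        unfolding k by (rule has_derivative_compose[OF 1 2])
      then show "(k has_derivative (\<lambda>v. iter_deriv [v] g x * iter_deriv (1 # vs) h (g x))) (at x)"
        by (subst lin [symmetric])
    qed
  qed
  have "(\<lambda>x. h (g x)) = (\<lambda>x. iter_deriv [] h (g x))" by simp
  then have *: "(\<lambda>x. h (g x)) \<in> alg ?G" by (blast intro: alg.gen)
  show ?thesis by (rule alg_smooth_on[OF U _ *]) (rule G)
qed

lemma smooth_on_powr: "smooth_on {0<..} (\<lambda>t::real. t powr a)"
proof (rule alg_smooth_on[where G = "range (\<lambda>a t. t powr a)"])
  fix g :: "real \<Rightarrow> real" assume "g \<in> range (\<lambda>a t. t powr a)"
  then obtain a where g: "g = (\<lambda>t. t powr a)" by blast
  show "\<exists>D. (\<forall>v. (\<lambda>x. D x v) \<in> alg (range (\<lambda>a t. t powr a))) \<and> (\<forall>x\<in>{0<..}. (g has_derivative D x) (at x))"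
  proof (rule exI[of _ "\<lambda>x v. v * (a * x powr (a - 1))"], intro conjI allI ballI)
    fix v
    show "(\<lambda>x. v * (a * x powr (a - 1))) \<in> alg (range (\<lambda>a t. t powr a))"
      by (intro alg.mult alg.const alg.gen) auto
  next
    fix x :: real assume "x \<in> {0<..}"
    then show "(g has_derivative (\<lambda>v. v * (a * x powr (a - 1)))) (at x)"
      using has_real_derivative_powr[of x a] unfolding g
      by (auto simp: has_real_derivative_iff_mult)
  qed
qed (auto intro: alg.gen)

lemma smooth_on_exp: "smooth_on U (exp :: real \<Rightarrow> real)"
proof -
  have "smooth_on UNIV (exp :: real \<Rightarrow> real)"
  proof (rule alg_smooth_on[where G = "{exp}"])
    fix g :: "real \<Rightarrow> real" assume g: "g \<in> {exp}"
    show "\<exists>D. (\<forall>v. (\<lambda>x. D x v) \<in> alg {exp}) \<and> (\<forall>x\<in>UNIV. (g has_derivative D x) (at x))"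
    proof (rule exI[of _ "\<lambda>x v. v * exp x"], intro conjI allI ballI)
      show "(\<lambda>x. v * exp x) \<in> alg {exp}" for v :: real
        by (intro alg.mult alg.const alg.gen) simp
    qed (use g in \<open>auto intro!: derivative_eq_intros\<close>)
  qed (auto intro: alg.gen)
  then show ?thesis by (rule smooth_on_subset) auto
qed

text \<open>Serves antiderivatives such as \<open>profile\<close>, which are known only through
  their derivative.\<close>

lemma smooth_if_derivative:
  fixes f f' :: "real \<Rightarrow> real"
  assumes "\<And>x. (f has_real_derivative f' x) (at x)" "smooth f'"
  shows "smooth f"
  unfolding smooth_def
proof (intro allI)
  fix vs x
  show "iter_deriv vs f differentiable at x"
  \<comment> \<open>The last entry of the list is the innermost derivative, hence the one that turns
    \<open>f\<close> into a multiple of \<open>f'\<close>.\<close>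
  proof (cases vs rule: rev_cases)
    case Nil
    then show ?thesis using assms(1) by (auto simp: real_differentiable_def)
  next
    case (snoc ws v)
    have "frechet_derivative f (at x) v = v * f' x" for x
    proof -
      have "(f has_derivative (\<lambda>v. v * f' x)) (at x)"
        using assms(1)[of x] by (simp add: has_real_derivative_iff_mult)
      from frechet_derivative_at[OF this] show ?thesis by metis
    qed
    then have *: "iter_deriv vs f = iter_deriv ws (\<lambda>x. v * f' x)"
      by (simp add: snoc iter_deriv_append)
    have "smooth_on UNIV (\<lambda>x. v * f' x)"
      by (intro smooth_on_mult smooth_on_const) (use assms(2) in \<open>auto simp: smooth_on_UNIV\<close>)
    then show ?thesis by (simp add: * smooth_on_def)
  qed
qed

text \<open>With u = 1/t this is u^k exp(-u). Admitting every \<open>k\<close>, and not only the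
  classical \<open>k = 0\<close>, makes the span of the family closed under differentiation.\<close>

definition flat :: "nat \<Rightarrow> real \<Rightarrow> real" where
  "flat k t = (if 0 < t then inverse t ^ k * exp (- inverse t) else 0)"

text \<open>With u = 1/t and n = k + 2, raising u/n \<le> exp(u/n) to the power n gives u^n exp(-u)
  \<le> n^n. The two surplus powers of u become the factor t^2, which forces the derivative at 0 to
  vanish.\<close>

lemma flat_bound: "0 \<le> flat k t" "flat k t \<le> real (k + 2) ^ (k + 2) * t\<^sup>2"
proof -
  show "0 \<le> flat k t" by (simp add: flat_def)
  show "flat k t \<le> real (k + 2) ^ (k + 2) * t\<^sup>2"
  proof (cases "0 < t")
    case True
    let ?n = "k + 2" and ?u = "inverse t"
    have u: "0 < ?u" using True by simp
    have "(?u / real ?n) ^ ?n \<le> exp (?u / real ?n) ^ ?n"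
    proof (rule power_mono)
      show "?u / real ?n \<le> exp (?u / real ?n)"
        using exp_ge_add_one_self[of "?u / real ?n"] by linarith
    qed (use u in auto)
    also have "\<dots> = exp ?u"
      by (subst exp_of_nat_mult [symmetric]) simp
    finally have "?u ^ ?n / real ?n ^ ?n \<le> exp ?u"
      by (simp only: power_divide)
    then have "?u ^ ?n \<le> exp ?u * real ?n ^ ?n"
      by (simp only: pos_divide_le_eq zero_less_power of_nat_0_less_iff zero_less_Suc add_2_eq_Suc')
    then have "?u ^ ?n * exp (- ?u) \<le> exp ?u * real ?n ^ ?n * exp (- ?u)"
      by (intro mult_right_mono) auto
    also have "\<dots> = real ?n ^ ?n" by (simp only: exp_minus) (simp add: field_simps)
    finally have "?u ^ ?n * exp (- ?u) \<le> real ?n ^ ?n" .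
    then have "t\<^sup>2 * (?u ^ ?n * exp (- ?u)) \<le> t\<^sup>2 * real ?n ^ ?n"
      by (intro mult_left_mono) auto
    moreover have "t\<^sup>2 * (?u ^ ?n * exp (- ?u)) = flat k t"
      using True by (simp add: flat_def power_add power2_eq_square field_simps)
    ultimately show ?thesis by (simp add: mult.commute)
  qed (auto simp: flat_def)
qed

lemma DERIV_zero_if_quadratic:
  fixes f :: "real \<Rightarrow> real"
  assumes "\<And>h. \<bar>f h\<bar> \<le> C * h\<^sup>2"
  shows "(f has_real_derivative 0) (at 0)"
proof -
  have f0: "f 0 = 0" using assms[of 0] by simp
  have "((\<lambda>h. f h / h) \<longlongrightarrow> 0) (at 0)"
  proof (rule Lim_null_comparison)
    show "eventually (\<lambda>h. norm (f h / h) \<le> C * \<bar>h\<bar>) (at 0)"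
      using assms by (auto simp: eventually_at_filter divide_simps power2_eq_square abs_mult mult_ac)
    show "((\<lambda>h. C * \<bar>h\<bar>) \<longlongrightarrow> 0) (at 0)"
      by (auto intro!: tendsto_eq_intros)
  qed
  then show ?thesis by (simp add: DERIV_def f0)
qed

lemma flat_has_derivative:
  "(flat k has_real_derivative flat (k + 2) t - real k * flat (k + 1) t) (at t)"
proof -
  consider "t > 0" | "t < 0" | "t = 0" by linarith
  then show ?thesis
  proof cases
    case 1
    have "((\<lambda>t. inverse t ^ k * exp (- inverse t)) has_real_derivative
        flat (k + 2) t - real k * flat (k + 1) t) (at t)"
      using 1
      by (auto intro!: derivative_eq_intros simp: flat_def power2_eq_square field_simps)
         (cases k; simp add: field_simps)
    then show ?thesis
      by (rule has_field_derivative_transform_within_open[of _ _ _ "{0<..}"])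
         (use 1 in \<open>auto simp: flat_def\<close>)
  next
    case 2
    have "((\<lambda>t. 0) has_real_derivative flat (k + 2) t - real k * flat (k + 1) t) (at t)"
      using 2 by (simp add: flat_def)
    then show ?thesis
      by (rule has_field_derivative_transform_within_open[of _ _ _ "{..<0}"])
         (use 2 in \<open>auto simp: flat_def\<close>)
  next
    case 3
    have "(flat k has_real_derivative 0) (at 0)"
      using flat_bound[of k] by (intro DERIV_zero_if_quadratic) (simp add: abs_of_nonneg)
    then show ?thesis using 3 by (simp add: flat_def)
  qed
qed

lemma smooth_on_flat: "smooth_on UNIV (flat k)"
proof (rule alg_smooth_on[where G = "range flat"])
  fix g assume "g \<in> range flat"
  then obtain k where g: "g = flat k" by blast
  show "\<exists>D. (\<forall>v. (\<lambda>x. D x v) \<in> alg (range flat)) \<and> (\<forall>x\<in>UNIV. (g has_derivative D x) (at x))"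
  proof (rule exI[of _ "\<lambda>x v. v * (flat (k + 2) x + (- real k) * flat (k + 1) x)"], intro conjI allI ballI)
    fix v
    show "(\<lambda>x. v * (flat (k + 2) x + (- real k) * flat (k + 1) x)) \<in> alg (range flat)"
      by (intro alg.mult alg.add alg.const alg.gen) auto
  next
    fix x :: real
    show "(g has_derivative (\<lambda>v. v * (flat (k + 2) x + (- real k) * flat (k + 1) x))) (at x)"
      using flat_has_derivative[of k x] unfolding g by (simp add: has_real_derivative_iff_mult)
  qed
qed (auto intro: alg.gen)

section \<open>A smooth monotone step and its derivative\<close>

definition bump :: "real \<Rightarrow> real" where "bump = flat 0"

lemma bump_pos: "0 < t \<Longrightarrow> 0 < bump t" and bump_zero: "t \<le> 0 \<Longrightarrow> bump t = 0"
  and bump_nonneg: "0 \<le> bump t" and bump_mono: "s \<le> t \<Longrightarrow> bump s \<le> bump t"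
  and smooth_on_bump: "smooth_on UNIV bump"
  using smooth_on_flat by (auto simp: bump_def flat_def)

text \<open>The argument will be a squared norm divided by a squared scale, so the transition
  between 1/4 and 1 takes place between half the scale and the full scale.\<close>

definition step :: "real \<Rightarrow> real" where
  "step s = bump (s - 1/4) / (bump (s - 1/4) + bump (1 - s))"

lemma step_denom_pos: "0 < bump (s - 1/4) + bump (1 - s)"
  using bump_pos[of "s - 1/4"] bump_pos[of "1 - s"] bump_nonneg[of "s - 1/4"] bump_nonneg[of "1 - s"]
  by (cases "s < 1") auto

lemma step_nonneg: "0 \<le> step s" and step_le_1: "step s \<le> 1"
  using step_denom_pos[of s] bump_nonneg[of "s - 1/4"] bump_nonneg[of "1 - s"]
  by (auto simp: step_def divide_simps)

lemma step_zero: "s \<le> 1/4 \<Longrightarrow> step s = 0"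
  by (simp add: step_def bump_zero)

lemma step_one: "1 \<le> s \<Longrightarrow> step s = 1"
  using bump_pos[of "s - 1/4"] by (simp add: step_def bump_zero)

lemma step_mono: "s \<le> t \<Longrightarrow> step s \<le> step t"
proof -
  assume "s \<le> t"
  then have *: "bump (s - 1/4) \<le> bump (t - 1/4)" "bump (1 - t) \<le> bump (1 - s)"
    by (intro bump_mono; simp)+
  have "bump (s - 1/4) * bump (1 - t) \<le> bump (t - 1/4) * bump (1 - s)"
    by (intro mult_mono * bump_nonneg)
  then show ?thesis
    using step_denom_pos[of s] step_denom_pos[of t] by (simp add: step_def divide_simps algebra_simps)
qed

lemma smooth_on_linear: "smooth_on UNIV (\<lambda>s::real. c * s + b)"
  using smooth_on_add[OF open_UNIV smooth_on_inner[of UNIV c] smooth_on_const[of UNIV b]]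
  by (simp add: mult.commute)

lemma smooth_on_step: "smooth_on UNIV step"
proof -
  have 1: "smooth_on UNIV (\<lambda>s. bump (s - 1/4))"
    using smooth_on_compose[OF open_UNIV smooth_on_linear[of 1 "-1/4"] smooth_on_bump] by simp
  have 2: "smooth_on UNIV (\<lambda>s. bump (1 - s))"
    using smooth_on_compose[OF open_UNIV smooth_on_linear[of "-1" 1] smooth_on_bump] by simp
  have "smooth_on UNIV (\<lambda>s. (bump (s - 1/4) + bump (1 - s)) powr (-1))"
    by (rule smooth_on_compose[OF open_UNIV _ smooth_on_powr])
       (use 1 2 step_denom_pos in \<open>auto intro: smooth_on_add\<close>)
  from smooth_on_mult[OF open_UNIV 1 this] show ?thesis
    using step_denom_pos by (simp add: step_def[abs_def] powr_minus_divide less_imp_le)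
qed

lemma
  fixes f :: "real \<Rightarrow> real"
  assumes "smooth_on UNIV f"
  shows smooth_on_has_real_derivative: "(f has_real_derivative deriv f x) (at x)"
    and smooth_on_deriv: "smooth_on UNIV (deriv f)"
proof -
  have D: "(f has_real_derivative deriv f x) (at x)" for x
    using assms[unfolded smooth_on_def, rule_format, of x "[]"]
    by (simp add: DERIV_deriv_iff_real_differentiable)
  then show "(f has_real_derivative deriv f x) (at x)" .
  have "iter_deriv [1] f = deriv f"
  proof
    fix x
    have "(f has_derivative (\<lambda>v. v * deriv f x)) (at x)"
      using D by (simp add: has_real_derivative_iff_mult)
    from frechet_derivative_at[OF this] show "iter_deriv [1] f x = deriv f x"
      by (metis iter_deriv.simps mult_1)
  qed
  then have "iter_deriv vs (deriv f) = iter_deriv (vs @ [1]) f" for vs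
    by (simp only: iter_deriv_append)
  then show "smooth_on UNIV (deriv f)" using assms by (simp add: smooth_on_def)
qed

definition dstep :: "real \<Rightarrow> real" where "dstep = deriv step"

lemma step_has_derivative: "(step has_real_derivative dstep s) (at s)"
  using smooth_on_has_real_derivative[OF smooth_on_step] by (simp add: dstep_def)

lemma isCont_dstep: "isCont dstep s"
  using smooth_on_has_real_derivative[OF smooth_on_deriv[OF smooth_on_step]]
  by (auto simp: dstep_def intro: DERIV_isCont)

lemma dstep_nonneg: "0 \<le> dstep s"
  by (rule mono_on_imp_deriv_nonneg[of UNIV step, OF _ step_has_derivative])
     (auto intro: mono_onI step_mono)

text \<open>At these points, the two end points included, \<open>step\<close> attains its global
  minimum 0 or its global maximum 1.\<close>

lemma dstep_zero: "s \<le> 1/4 \<or> 1 \<le> s \<Longrightarrow> dstep s = 0"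
proof (elim disjE)
  assume "s \<le> 1/4"
  then show ?thesis
    using DERIV_local_min[OF step_has_derivative, of 1 s] step_zero[of s] step_nonneg by auto
next
  assume "1 \<le> s"
  then show ?thesis
    using DERIV_local_max[OF step_has_derivative, of 1 s] step_one[of s] step_le_1 by auto
qed

lemma dstep_pos_ex: "\<exists>s. 1/4 < s \<and> s < 1 \<and> 0 < dstep s"
proof -
  obtain z where z: "1/4 < z" "z < 1" "step 1 - step (1/4) = (1 - 1/4) * dstep z"
    using MVT2[of "1/4" 1 step dstep] step_has_derivative by auto
  then show ?thesis by (intro exI[of _ z]) (auto simp: step_one step_zero)
qed

subsection \<open>The radial profile\<close>

text \<open>As a function of \<open>s = |x|\<^sup>2\<close>, and with \<open>a = d/2\<close>, the fundamental solution is a multiple of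
  \<open>s powr (1 - a)\<close>; the cut-off inside the derivative makes it constant near the pole while keeping
  it superharmonic.\<close>

definition profile :: "real \<Rightarrow> real \<Rightarrow> real" where
  "profile a = (SOME F. (\<forall>s. (F has_real_derivative - (a - 1) * s powr (- a) * step s) (at s)) \<and> F 1 = 1)"

text \<open>The singularity of \<open>powr\<close> at 0 is invisible because \<open>step\<close>
  vanishes on all of \<open>{..<1/4}\<close>; this set and \<open>{0<..}\<close> cover the
  line.\<close>

lemma smooth_on_powr_step: "smooth_on UNIV (\<lambda>s. c * s powr b * step s)"
proof -
  have 1: "smooth_on {0<..} (\<lambda>s. c * s powr b * step s)"
    by (intro smooth_on_mult smooth_on_const smooth_on_powr smooth_on_subset[OF smooth_on_step]) auto
  have 2: "smooth_on {..<1/4} (\<lambda>s. c * s powr b * step s)"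
    by (rule smooth_on_cong_open[OF _ _ smooth_on_const[of _ 0]]) (auto simp: step_zero)
  have "{0<..} \<union> {..<1/4::real} = UNIV" by auto
  with smooth_on_Un[OF 1 2] show ?thesis by simp
qed

lemma profile_has_derivative: "(profile a has_real_derivative - (a - 1) * s powr (- a) * step s) (at s)"
  and profile_1: "profile a 1 = 1"
proof -
  let ?f = "\<lambda>s. - (a - 1) * s powr (- a) * step s"
  have "isCont ?f s" for s
    using smooth_on_has_real_derivative[OF smooth_on_powr_step] by (auto intro: DERIV_isCont)
  then obtain F where F: "(F has_vector_derivative ?f s) (at s)" for s
    using einterval_antiderivative[of "-\<infinity>" "\<infinity>" ?f] by auto
  have "(\<forall>s. ((\<lambda>s. F s - F 1 + 1) has_real_derivative ?f s) (at s)) \<and> (F 1 - F 1 + 1) = 1"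
    using F by (auto intro!: derivative_eq_intros simp: has_real_derivative_iff_has_vector_derivative)
  then have "\<exists>F. (\<forall>s. (F has_real_derivative ?f s) (at s)) \<and> F 1 = 1"
    by (intro exI[of _ "\<lambda>s. F s - F 1 + 1"])
  from someI_ex[OF this] show "(profile a has_real_derivative ?f s) (at s)" "profile a 1 = 1"
    by (auto simp: profile_def)
qed

lemma smooth_profile: "smooth_on UNIV (profile a)"
  unfolding smooth_on_UNIV
  by (rule smooth_if_derivative[OF profile_has_derivative])
     (use smooth_on_powr_step smooth_on_UNIV in blast)

text \<open>The scale enters squared because \<open>s\<close> is a squared norm. The prefactor makes
  the function agree with \<open>s powr (1 - a)\<close> from \<open>\<epsilon>\<^sup>2\<close>
  onwards, at every scale; therefore differences of two scales have compact support.\<close>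

definition rprofile :: "real \<Rightarrow> real \<Rightarrow> real \<Rightarrow> real" where
  "rprofile a \<epsilon> s = \<epsilon> powr (2 - 2 * a) * profile a (s / \<epsilon>\<^sup>2)"

definition drprofile :: "real \<Rightarrow> real \<Rightarrow> real \<Rightarrow> real" where
  "drprofile a \<epsilon> s = - (a - 1) * s powr (- a) * step (s / \<epsilon>\<^sup>2)"

definition ddrprofile :: "real \<Rightarrow> real \<Rightarrow> real \<Rightarrow> real" where
  "ddrprofile a \<epsilon> s = (a - 1) * (a * s powr (- a - 1) * step (s / \<epsilon>\<^sup>2) - s powr (- a) * dstep (s / \<epsilon>\<^sup>2) / \<epsilon>\<^sup>2)"

lemma smooth_rprofile: "smooth_on UNIV (rprofile a \<epsilon>)"
  unfolding rprofile_def
  using smooth_on_mult[OF open_UNIV smooth_on_const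
      smooth_on_compose[OF open_UNIV smooth_on_linear[of "1/\<epsilon>\<^sup>2" 0] smooth_profile]] by simp

lemma DERIV_divide_const: "((\<lambda>s::real. s / c) has_real_derivative 1 / c) (at s)"
  using DERIV_cdivide[OF DERIV_ident, of c] by simp

text \<open>By homogeneity the powers of \<epsilon> cancel, and the scale survives only inside the
  cut-off. This makes derivatives at different scales directly comparable.\<close>

lemma rprofile_has_derivative:
  assumes "0 < \<epsilon>"
  shows "(rprofile a \<epsilon> has_real_derivative drprofile a \<epsilon> s) (at s)"
proof (cases "s \<le> 0")

  case True
  then have "s / \<epsilon>\<^sup>2 \<le> 0" using assms by (simp add: divide_nonpos_pos)
  then have "step (s / \<epsilon>\<^sup>2) = 0" by (intro step_zero) linarith
  moreover have "((\<lambda>s. profile a (s / \<epsilon>\<^sup>2)) has_real_derivative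
      (- (a - 1) * (s / \<epsilon>\<^sup>2) powr (- a) * step (s / \<epsilon>\<^sup>2)) * (1 / \<epsilon>\<^sup>2)) (at s)"
    by (rule DERIV_chain2[OF profile_has_derivative]) (rule DERIV_divide_const)
  ultimately have "((\<lambda>s. profile a (s / \<epsilon>\<^sup>2)) has_real_derivative 0) (at s)" by simp
  from DERIV_cmult[OF this, of "\<epsilon> powr (2 - 2 * a)"] show ?thesis
    using \<open>step (s / \<epsilon>\<^sup>2) = 0\<close> unfolding rprofile_def[abs_def] drprofile_def by simp
next
  case False
  have "((\<lambda>s. profile a (s / \<epsilon>\<^sup>2)) has_real_derivative
      (- (a - 1) * (s / \<epsilon>\<^sup>2) powr (- a) * step (s / \<epsilon>\<^sup>2)) * (1 / \<epsilon>\<^sup>2)) (at s)"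
    by (rule DERIV_chain2[OF profile_has_derivative]) (rule DERIV_divide_const)
  then have deriv: "(rprofile a \<epsilon> has_real_derivative \<epsilon> powr (2 - 2 * a) *
      ((- (a - 1) * (s / \<epsilon>\<^sup>2) powr (- a) * step (s / \<epsilon>\<^sup>2)) * (1 / \<epsilon>\<^sup>2))) (at s)"
    unfolding rprofile_def[abs_def] by (auto intro!: derivative_eq_intros)
  have "\<epsilon> powr (2 - 2 * a) * (s / \<epsilon>\<^sup>2) powr (- a) / \<epsilon>\<^sup>2 = s powr (- a)"
  proof -
    have e2: "\<epsilon> powr 2 = \<epsilon>\<^sup>2" "\<epsilon>\<^sup>2 powr (- a) = \<epsilon> powr (- 2 * a)"
      using assms powr_powr[of \<epsilon> 2 "- a"] by (simp_all add: powr_numeral)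
    have "(s / \<epsilon>\<^sup>2) powr (- a) = s powr (- a) / \<epsilon> powr (- 2 * a)"
      using False assms by (simp only: powr_divide e2)
    moreover have "\<epsilon> powr (2 - 2 * a) = \<epsilon>\<^sup>2 * \<epsilon> powr (- 2 * a)"
      using powr_add[of \<epsilon> 2 "- 2 * a"] e2 by simp
    ultimately show ?thesis
      using assms by simp
  qed
  have "\<epsilon> powr (2 - 2 * a) * ((- (a - 1) * (s / \<epsilon>\<^sup>2) powr (- a) * step (s / \<epsilon>\<^sup>2)) * (1 / \<epsilon>\<^sup>2)) = drprofile a \<epsilon> s"
  proof -
    have "A * ((- c * B * S) * (1 / E)) = - c * (A * B / E) * S" for A B c S E :: real by simp
    then show ?thesis using \<open>\<epsilon> powr (2 - 2 * a) * (s / \<epsilon>\<^sup>2) powr (- a) / \<epsilon>\<^sup>2 = s powr (- a)\<close>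
      unfolding drprofile_def by presburger
  qed
  with deriv show ?thesis by simp
qed

lemma drprofile_has_derivative:
  assumes "0 < \<epsilon>"
  shows "(drprofile a \<epsilon> has_real_derivative ddrprofile a \<epsilon> s) (at s)"
proof (cases "s \<le> 0")
  case True
  have "((\<lambda>s. 0) has_real_derivative ddrprofile a \<epsilon> s) (at s)"
  proof -
    have "s / \<epsilon>\<^sup>2 \<le> 0" using assms True by (simp add: divide_nonpos_pos)
    then have "s / \<epsilon>\<^sup>2 \<le> 1/4" by linarith
    then show ?thesis by (simp add: ddrprofile_def step_zero dstep_zero)
  qed
  then show ?thesis
  proof (rule has_field_derivative_transform_within_open[of _ _ _ "{..<\<epsilon>\<^sup>2/4}"])
    show "s \<in> {..<\<epsilon>\<^sup>2/4}" using True zero_less_power[OF assms, of 2] by (simp only: lessThan_iff)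
    fix t assume "t \<in> {..<\<epsilon>\<^sup>2/4}"
    then have "t / \<epsilon>\<^sup>2 \<le> 1/4" using assms by (simp add: divide_simps)
    then show "0 = drprofile a \<epsilon> t" by (simp add: drprofile_def step_zero)
  qed auto
next
  case False
  have 1: "((\<lambda>s. step (s / \<epsilon>\<^sup>2)) has_real_derivative dstep (s / \<epsilon>\<^sup>2) * (1 / \<epsilon>\<^sup>2)) (at s)"
    by (rule DERIV_chain2[OF step_has_derivative]) (rule DERIV_divide_const)
  have 2: "((\<lambda>s. s powr (- a)) has_real_derivative (- a * s powr (- a - 1))) (at s)"
    using False by (intro has_real_derivative_powr) auto
  show ?thesis unfolding drprofile_def[abs_def] ddrprofile_def
    by (rule DERIV_cong[OF DERIV_mult[OF DERIV_cmult[OF 2, of "- (a - 1)"] 1]])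
       (simp add: algebra_simps diff_divide_distrib)
qed

text \<open>Beyond \<open>\<epsilon>\<^sup>2\<close> the cut-off equals 1, so both sides have the
  same derivative, and \<open>profile_1\<close> makes them agree at
  \<open>\<epsilon>\<^sup>2\<close>.\<close>

lemma rprofile_outer:
  assumes \<epsilon>: "0 < \<epsilon>" and s: "\<epsilon>\<^sup>2 \<le> s"
  shows "rprofile a \<epsilon> s = s powr (1 - a)"
proof -
  have s0: "0 < \<epsilon>\<^sup>2" using \<epsilon> by simp
  have D: "((\<lambda>s. rprofile a \<epsilon> s - s powr (1 - a)) has_real_derivative 0) (at t)" if "\<epsilon>\<^sup>2 \<le> t" for t
  proof -
    have "0 < t" using that s0 by linarith
    moreover have "1 \<le> t / \<epsilon>\<^sup>2" using that s0 by (simp add: divide_simps)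
    ultimately show ?thesis
      using rprofile_has_derivative[OF \<epsilon>, of a t] has_real_derivative_powr[of t "1 - a"]
      by (auto intro!: derivative_eq_intros simp: drprofile_def step_one algebra_simps)
  qed
  have "\<epsilon> powr (2 - 2 * a) = (\<epsilon>\<^sup>2) powr (1 - a)"
  proof -
    have "(\<epsilon>\<^sup>2) powr (1 - a) = (\<epsilon> powr 2) powr (1 - a)" using \<epsilon> by (simp add: powr_numeral)
    then show ?thesis by (simp add: powr_powr algebra_simps)
  qed
  then have 0: "rprofile a \<epsilon> (\<epsilon>\<^sup>2) - (\<epsilon>\<^sup>2) powr (1 - a) = 0"
    using s0 by (simp add: rprofile_def profile_1)
  show ?thesis
  proof (cases "s = \<epsilon>\<^sup>2")
    case False
    then have "\<epsilon>\<^sup>2 < s" using s by simp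
    from MVT2[OF this, of "\<lambda>s. rprofile a \<epsilon> s - s powr (1 - a)" "\<lambda>_. 0"] D 0
    show ?thesis by auto
  qed (use 0 in simp)
qed

text \<open>The cut-off is at most 1, so the difference of the two sides is nondecreasing up to
  \<open>\<epsilon>\<^sup>2\<close>, where it is 0.\<close>

lemma rprofile_le:
  assumes \<epsilon>: "0 < \<epsilon>" and s: "0 < s" and a: "1 < a"
  shows "rprofile a \<epsilon> s \<le> s powr (1 - a)"
proof (cases "\<epsilon>\<^sup>2 \<le> s")
  case False
  have "rprofile a \<epsilon> s - s powr (1 - a) \<le> rprofile a \<epsilon> (\<epsilon>\<^sup>2) - (\<epsilon>\<^sup>2) powr (1 - a)"
  proof (rule DERIV_nonneg_imp_nondecreasing[of _ _ "\<lambda>s. rprofile a \<epsilon> s - s powr (1 - a)"])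
    fix t assume "s \<le> t" "t \<le> \<epsilon>\<^sup>2"
    then have "0 < t" using s by simp
    then have "((\<lambda>s. rprofile a \<epsilon> s - s powr (1 - a)) has_real_derivative
        (a - 1) * t powr (- a) * (1 - step (t / \<epsilon>\<^sup>2))) (at t)"
      using rprofile_has_derivative[OF \<epsilon>, of a t] has_real_derivative_powr[of t "1 - a"]
      by (auto intro!: derivative_eq_intros simp: drprofile_def algebra_simps)
    moreover have "0 \<le> (a - 1) * t powr (- a) * (1 - step (t / \<epsilon>\<^sup>2))"
      using a step_le_1 by simp
    ultimately show "\<exists>y. ((\<lambda>s. rprofile a \<epsilon> s - s powr (1 - a)) has_real_derivative y) (at t) \<and> 0 \<le> y"
      by blast
  qed (use False in simp)
  then show ?thesis using rprofile_outer[OF \<epsilon>, of "\<epsilon>\<^sup>2" a] by simp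
qed (use rprofile_outer[OF \<epsilon>] in simp)

text \<open>A larger scale cuts off more of the derivative, so the difference is nondecreasing up to
  \<open>r\<^sup>2\<close>, where it vanishes. This is the source of the positivity of
  \<open>kdiff\<close>.\<close>

lemma rprofile_antimono:
  assumes \<epsilon>: "0 < \<epsilon>" and r: "\<epsilon> \<le> r" and a: "1 < a"
  shows "rprofile a r s \<le> rprofile a \<epsilon> s"
proof (cases "r\<^sup>2 \<le> s")
  case True
  have "\<epsilon>\<^sup>2 \<le> r\<^sup>2" using \<epsilon> r by (intro power_mono) auto
  then show ?thesis using True \<epsilon> r rprofile_outer[of \<epsilon> s a] rprofile_outer[of r s a]
      order_trans[OF \<open>\<epsilon>\<^sup>2 \<le> r\<^sup>2\<close> True] by simp
next
  case False
  have r0: "0 < r" using \<epsilon> r by simp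
  have "\<epsilon>\<^sup>2 \<le> r\<^sup>2" using \<epsilon> r by (intro power_mono) auto
  have "rprofile a r s - rprofile a \<epsilon> s \<le> rprofile a r (r\<^sup>2) - rprofile a \<epsilon> (r\<^sup>2)"
  proof (rule DERIV_nonneg_imp_nondecreasing[of _ _ "\<lambda>s. rprofile a r s - rprofile a \<epsilon> s"])
    fix t assume "s \<le> t" "t \<le> r\<^sup>2"
    have "((\<lambda>s. rprofile a r s - rprofile a \<epsilon> s) has_real_derivative
        (a - 1) * t powr (- a) * (step (t / \<epsilon>\<^sup>2) - step (t / r\<^sup>2))) (at t)"
      using rprofile_has_derivative[OF \<epsilon>, of a t] rprofile_has_derivative[OF r0, of a t]
      by (auto intro!: derivative_eq_intros simp: drprofile_def algebra_simps)
    moreover have "step (t / r\<^sup>2) \<le> step (t / \<epsilon>\<^sup>2)"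
    proof (cases "0 \<le> t")
      case True
      then show ?thesis using \<open>\<epsilon>\<^sup>2 \<le> r\<^sup>2\<close> \<epsilon> r0 by (intro step_mono divide_left_mono) auto
    next
      case False
      then have "t / r\<^sup>2 \<le> 0" using r0 by (intro divide_nonpos_pos) auto
      then have "step (t / r\<^sup>2) = 0" by (intro step_zero) linarith
      then show ?thesis using step_nonneg by simp
    qed
    then have "0 \<le> (a - 1) * t powr (- a) * (step (t / \<epsilon>\<^sup>2) - step (t / r\<^sup>2))"
      using a by simp
    ultimately show "\<exists>y. ((\<lambda>s. rprofile a r s - rprofile a \<epsilon> s) has_real_derivative y) (at t) \<and> 0 \<le> y"
      by blast
  qed (use False in simp)
  then show ?thesis
    using rprofile_outer[OF r0, of "r\<^sup>2" a] rprofile_outer[OF \<epsilon> \<open>\<epsilon>\<^sup>2 \<le> r\<^sup>2\<close>, of a] by simp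
qed

lemma rprofile_nonneg:
  assumes \<epsilon>: "0 < \<epsilon>" and a: "1 < a"
  shows "0 \<le> rprofile a \<epsilon> s"
proof -
  show ?thesis
  proof (cases "\<epsilon>\<^sup>2 \<le> s")
    case True
    then show ?thesis using rprofile_outer[OF \<epsilon>] by simp
  next
    case False
    have "rprofile a \<epsilon> (\<epsilon>\<^sup>2) \<le> rprofile a \<epsilon> s"
    proof (rule DERIV_nonpos_imp_nonincreasing[of _ _ "rprofile a \<epsilon>"])
      fix t
      have "drprofile a \<epsilon> t \<le> 0"
        using a step_nonneg[of "t / \<epsilon>\<^sup>2"] by (simp add: drprofile_def mult_nonpos_nonneg)
      then show "\<exists>y. (rprofile a \<epsilon> has_real_derivative y) (at t) \<and> y \<le> 0"
        using rprofile_has_derivative[OF \<epsilon>] by blast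
    qed (use False in simp)
    then show ?thesis using rprofile_outer[OF \<epsilon>, of "\<epsilon>\<^sup>2" a] by (smt (verit) powr_ge_zero)
  qed
qed

text \<open>Minus the Laplacian of the flattened kernel, written in
  \<open>s = |x|\<^sup>2\<close>.\<close>

definition rkappa :: "real \<Rightarrow> real \<Rightarrow> real \<Rightarrow> real" where
  "rkappa a \<epsilon> s = 4 * (a - 1) * s powr (1 - a) * dstep (s / \<epsilon>\<^sup>2) / \<epsilon>\<^sup>2"

text \<open>The left side is the Laplacian of a radial function of \<open>s = |x|\<^sup>2\<close> in
  dimension 2a. The terms with \<open>step\<close> cancel because s^(1-a) is harmonic away from 0;
  only the term with \<open>dstep\<close> remains, and it has a sign. Cutting off the kernel itself
  would leave terms of both signs.\<close>

lemma rkappa_eq: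
  assumes "0 < \<epsilon>" "0 \<le> s"
  shows "4 * s * ddrprofile a \<epsilon> s + 4 * a * drprofile a \<epsilon> s = - rkappa a \<epsilon> s"
proof (cases "s = 0")
  case True
  then show ?thesis by (simp add: ddrprofile_def drprofile_def rkappa_def)
next
  case False
  define P St D where "P = s powr (- a)" and "St = step (s / \<epsilon>\<^sup>2)"
    and "D = dstep (s / \<epsilon>\<^sup>2) / \<epsilon>\<^sup>2"
  have "s powr (- a - 1) = P / s" "s powr (1 - a) = s * P"
    using False assms by (simp_all add: P_def powr_diff powr_minus field_simps)
  then have *: "ddrprofile a \<epsilon> s = (a - 1) * (a * (P / s) * St - P * D)"
    "drprofile a \<epsilon> s = - (a - 1) * P * St"
    "rkappa a \<epsilon> s = 4 * (a - 1) * (s * P) * D"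
    by (simp_all add: ddrprofile_def drprofile_def rkappa_def P_def St_def D_def)
  show ?thesis unfolding * using False by (simp add: field_simps)
qed

section \<open>Radial functions\<close>

lemma smooth_on_quad: "smooth_on UNIV (\<lambda>z::'a::real_inner. (z - c) \<bullet> (z - c))"
proof -
  let ?G = "insert (\<lambda>z::'a. (z - c) \<bullet> (z - c)) (range (\<lambda>v z. z \<bullet> v))"
  have quad: "((\<lambda>z::'a. (z - c) \<bullet> (z - c)) has_derivative (\<lambda>v. 2 * (x \<bullet> v + (- (c \<bullet> v))))) (at x)" for x
    by (auto intro!: derivative_eq_intros simp: inner_diff_left inner_diff_right inner_commute algebra_simps)
  show ?thesis
  proof (rule alg_smooth_on[where G = ?G])
    fix g assume "g \<in> ?G"
    then consider "g = (\<lambda>z. (z - c) \<bullet> (z - c))" | v where "g = (\<lambda>z. z \<bullet> v)" by blast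
    then show "\<exists>D. (\<forall>v. (\<lambda>x. D x v) \<in> alg ?G) \<and> (\<forall>x\<in>UNIV. (g has_derivative D x) (at x))"
    proof cases
      case 1
      show ?thesis
      proof (rule exI[of _ "\<lambda>x v. 2 * (x \<bullet> v + (- (c \<bullet> v)))"], intro conjI allI ballI)
        show "(\<lambda>x. 2 * (x \<bullet> v + (- (c \<bullet> v)))) \<in> alg ?G" for v
          by (intro alg.mult alg.add alg.const alg.gen) auto
      qed (use quad 1 in simp)
    next
      case (2 v)
      show ?thesis
        by (rule exI[of _ "\<lambda>x w. w \<bullet> v"]) (auto intro!: alg.const derivative_eq_intros simp: 2)
    qed
  qed (auto intro: alg.gen)
qed

lemma smooth_on_radial:
  "smooth_on UNIV (F :: real \<Rightarrow> real) \<Longrightarrow> smooth_on UNIV (\<lambda>z::'a::real_inner. F ((z - c) \<bullet> (z - c)))"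
  using smooth_on_compose[OF open_UNIV smooth_on_quad[of c], of UNIV F] by simp

lemma test_function_radial:
  fixes c :: "'a::{real_inner, heine_borel}"
  assumes "smooth_on UNIV F" "\<And>s. r\<^sup>2 < s \<Longrightarrow> F s = 0" "cball c r \<subseteq> S" "0 \<le> r"
  shows "test_function S (\<lambda>z. F ((z - c) \<bullet> (z - c)))"
  unfolding test_function_def
proof (intro conjI exI[of _ "cball c r"] allI impI)
  show "smooth (\<lambda>z. F ((z - c) \<bullet> (z - c)))"
    using smooth_on_radial[OF assms(1)] by (simp add: smooth_on_UNIV)
  fix x assume "x \<notin> cball c r"
  then have "r < norm (x - c)" by (simp add: dist_norm norm_minus_commute)
  then have "r\<^sup>2 < (norm (x - c))\<^sup>2" using assms(4) by (intro power_strict_mono) auto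
  then show "F ((x - c) \<bullet> (x - c)) = 0" by (intro assms(2)) (simp add: power2_norm_eq_inner)
qed (use assms in auto)

lemma radial_iter_deriv:
  fixes c :: "'a::real_inner"
  assumes F1: "\<And>s. (F has_real_derivative F1 s) (at s)" and F2: "\<And>s. (F1 has_real_derivative F2 s) (at s)"
  shows "iter_deriv [w] (\<lambda>z. F ((z - c) \<bullet> (z - c))) = (\<lambda>z. F1 ((z - c) \<bullet> (z - c)) * (2 * ((z - c) \<bullet> w)))" (is ?A)
    and "iter_deriv [v, w] (\<lambda>z. F ((z - c) \<bullet> (z - c))) =
      (\<lambda>z. F2 ((z - c) \<bullet> (z - c)) * (2 * ((z - c) \<bullet> v)) * (2 * ((z - c) \<bullet> w)) + F1 ((z - c) \<bullet> (z - c)) * (2 * (v \<bullet> w)))" (is ?B)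
proof -
  have quad: "((\<lambda>z::'a. (z - c) \<bullet> (z - c)) has_derivative (\<lambda>v. 2 * ((z - c) \<bullet> v))) (at z)" for z
    by (auto intro!: derivative_eq_intros simp: inner_commute)
  have comp: "((\<lambda>z. G ((z - c) \<bullet> (z - c))) has_derivative (\<lambda>v. G' * (2 * ((z - c) \<bullet> v)))) (at z)"
    if "(G has_real_derivative G') (at ((z - c) \<bullet> (z - c)))" for G G' z
    using has_derivative_compose[OF quad that[unfolded has_field_derivative_def]] by simp
  show A: ?A
  proof
    fix z
    show "iter_deriv [w] (\<lambda>z. F ((z - c) \<bullet> (z - c))) z = F1 ((z - c) \<bullet> (z - c)) * (2 * ((z - c) \<bullet> w))"
      using fun_cong[OF frechet_derivative_at[OF comp[OF F1, of z]], of w] by simp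
  qed
  show ?B
  proof
    fix z
    have "((\<lambda>z. F1 ((z - c) \<bullet> (z - c)) * (2 * ((z - c) \<bullet> w))) has_derivative
        (\<lambda>v. F1 ((z - c) \<bullet> (z - c)) * (2 * (v \<bullet> w)) + F2 ((z - c) \<bullet> (z - c)) * (2 * ((z - c) \<bullet> v)) * (2 * ((z - c) \<bullet> w)))) (at z)"
      by (rule has_derivative_mult[OF comp[OF F2]]) (auto intro!: derivative_eq_intros)
    from fun_cong[OF frechet_derivative_at[OF this], of v]
    show "iter_deriv [v, w] (\<lambda>z. F ((z - c) \<bullet> (z - c))) z =
      F2 ((z - c) \<bullet> (z - c)) * (2 * ((z - c) \<bullet> v)) * (2 * ((z - c) \<bullet> w)) + F1 ((z - c) \<bullet> (z - c)) * (2 * (v \<bullet> w))"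
      using A by simp
  qed
qed

lemma partial2_radial:
  fixes c :: "real ^ 'n"
  assumes "\<And>s. (F has_real_derivative F1 s) (at s)" "\<And>s. (F1 has_real_derivative F2 s) (at s)"
  shows "partial2 i j (\<lambda>z. F ((z - c) \<bullet> (z - c))) z =
    4 * F2 ((z - c) \<bullet> (z - c)) * ((z - c) $ i) * ((z - c) $ j) + (if i = j then 2 * F1 ((z - c) \<bullet> (z - c)) else 0)"
proof -
  define x s where "x = z - c" and "s = x \<bullet> x"
  have "partial2 i j (\<lambda>z. F ((z - c) \<bullet> (z - c))) z =
      F2 s * (2 * (x \<bullet> axis i 1)) * (2 * (x \<bullet> axis j 1)) + F1 s * (2 * (axis i 1 \<bullet> (axis j 1 :: real ^ 'n)))"
    unfolding partial2_def radial_iter_deriv(2)[OF assms] x_def s_def ..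
  also have "\<dots> = 4 * F2 s * (x $ i) * (x $ j) + (if i = j then 2 * F1 s else 0)"
  proof -
    have "(axis i 1 :: real ^ 'n) \<bullet> axis j 1 = (if i = j then 1 else 0)"
      by (auto simp: inner_axis_axis)
    then show ?thesis by (simp add: inner_axis)
  qed
  finally show ?thesis by (simp only: x_def s_def)
qed

lemma laplacian_radial:
  fixes c :: "real ^ 'n"
  assumes "\<And>s. (F has_real_derivative F1 s) (at s)" "\<And>s. (F1 has_real_derivative F2 s) (at s)"
  shows "laplacian (\<lambda>z. F ((z - c) \<bullet> (z - c))) z =
    4 * ((z - c) \<bullet> (z - c)) * F2 ((z - c) \<bullet> (z - c)) + 2 * real CARD('n) * F1 ((z - c) \<bullet> (z - c))"
proof -
  have "(\<Sum>i\<in>UNIV. 4 * F2 s * (x $ i) * (x $ i) + 2 * F1 s) = 4 * (x \<bullet> x) * F2 s + 2 * real CARD('n) * F1 s"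
    for x :: "real ^ 'n" and s
    by (simp add: sum.distrib inner_vec_def sum_distrib_left sum_distrib_right mult_ac)
  then show ?thesis
    unfolding laplacian_def partial2_radial[OF assms] by (simp only: if_True refl)
qed

subsection \<open>The mollified Newtonian kernel\<close>

text \<open>The value at 0 is the junk value 0.\<close>

definition newton :: "real ^ 'n::finite \<Rightarrow> real" where
  "newton x = (x \<bullet> x) powr (1 - real CARD('n) / 2)"

definition newton_reg :: "real \<Rightarrow> real ^ 'n::finite \<Rightarrow> real" where
  "newton_reg \<epsilon> x = rprofile (real CARD('n) / 2) \<epsilon> (x \<bullet> x)"

definition kappa :: "real \<Rightarrow> real ^ 'n::finite \<Rightarrow> real" where
  "kappa \<epsilon> x = rkappa (real CARD('n) / 2) \<epsilon> (x \<bullet> x)"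

definition kdiff :: "real \<Rightarrow> real \<Rightarrow> real ^ 'n::finite \<Rightarrow> real" where
  "kdiff \<epsilon> r x = newton_reg \<epsilon> x - newton_reg r x"

lemma newton_norm: "newton (x :: real ^ 'n) = norm x powr (2 - real CARD('n))"
proof -
  have "newton x = (norm x powr 2) powr (1 - real CARD('n) / 2)"
    by (simp add: newton_def dot_square_norm powr_numeral)
  also have "\<dots> = norm x powr (2 * (1 - real CARD('n) / 2))" by (rule powr_powr)
  also have "2 * (1 - real CARD('n) / 2) = 2 - real CARD('n)" by simp
  finally show ?thesis .
qed

lemma even_kernels:
  "newton (x - z) = newton (z - x)" "newton_reg \<epsilon> (x - z) = newton_reg \<epsilon> (z - x)"
  "kappa \<epsilon> (x - z) = kappa \<epsilon> (z - x)" "kdiff \<epsilon> r (x - z) = kdiff \<epsilon> r (z - x)"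
proof -
  have "(x - z) \<bullet> (x - z) = (z - x) \<bullet> (z - x)"
    by (simp add: inner_diff_left inner_diff_right inner_commute)
  then show "newton (x - z) = newton (z - x)" "newton_reg \<epsilon> (x - z) = newton_reg \<epsilon> (z - x)"
    "kappa \<epsilon> (x - z) = kappa \<epsilon> (z - x)" "kdiff \<epsilon> r (x - z) = kdiff \<epsilon> r (z - x)"
    by (simp_all add: newton_def newton_reg_def kappa_def kdiff_def)
qed

lemma inner_ge_power2: "\<epsilon> \<le> norm x \<Longrightarrow> 0 \<le> \<epsilon> \<Longrightarrow> \<epsilon>\<^sup>2 \<le> x \<bullet> x"
  by (simp add: dot_square_norm power_mono)

lemma newton_nonneg: "0 \<le> newton x"
  by (simp add: newton_def)

lemma newton_reg_outer: "0 < \<epsilon> \<Longrightarrow> \<epsilon> \<le> norm x \<Longrightarrow> newton_reg \<epsilon> x = newton x"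
  by (simp add: newton_reg_def newton_def rprofile_outer inner_ge_power2)

lemma kdiff_outer: "0 < \<epsilon> \<Longrightarrow> \<epsilon> \<le> r \<Longrightarrow> r \<le> norm x \<Longrightarrow> kdiff \<epsilon> r x = 0"
  by (simp add: kdiff_def newton_reg_outer)

lemma kappa_outer: "0 < \<epsilon> \<Longrightarrow> \<epsilon> \<le> norm x \<Longrightarrow> kappa \<epsilon> x = 0"
  using inner_ge_power2[of \<epsilon> x] by (simp add: kappa_def rkappa_def dstep_zero)

text \<open>Together with \<open>kappa_outer\<close> this confines the kernel to the shell between
  radii \<epsilon>/2 and \<epsilon>. Thanks to the hole in the middle, averages at large radii see
  only values near infinity.\<close>

lemma kappa_inner: "0 < \<epsilon> \<Longrightarrow> norm x \<le> \<epsilon> / 2 \<Longrightarrow> kappa \<epsilon> x = 0"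
  using power_mono[of "norm x" "\<epsilon> / 2" 2]
  by (simp add: kappa_def rkappa_def dstep_zero dot_square_norm power_divide field_simps)

lemma smooth_kdiff: "smooth_on UNIV (\<lambda>s. rprofile a \<epsilon> s - rprofile a r s)"
  using smooth_on_add[OF open_UNIV smooth_rprofile[of a \<epsilon>]
      smooth_on_mult[OF open_UNIV smooth_on_const[of _ "-1"] smooth_rprofile[of a r]]] by simp

lemma test_function_kdiff:
  fixes c :: "real ^ 'n"
  assumes "0 < \<epsilon>" "\<epsilon> \<le> r" "cball c r \<subseteq> S"
  shows "test_function S (\<lambda>z. kdiff \<epsilon> r (z - c))"
  unfolding kdiff_def newton_reg_def
proof (rule test_function_radial[OF smooth_kdiff])
  fix s assume "r\<^sup>2 < s"
  moreover have "\<epsilon>\<^sup>2 \<le> r\<^sup>2" using assms by (intro power_mono) auto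
  ultimately have "\<epsilon>\<^sup>2 \<le> s" "r\<^sup>2 \<le> s" by linarith+
  then show "rprofile (real CARD('n) / 2) \<epsilon> s - rprofile (real CARD('n) / 2) r s = 0"
    using assms by (simp add: rprofile_outer)
qed (use assms in auto)

lemma laplacian_kdiff:
  fixes c :: "real ^ 'n"
  assumes "0 < \<epsilon>" "\<epsilon> \<le> r"
  shows "laplacian (\<lambda>z. kdiff \<epsilon> r (z - c)) z = kappa r (z - c) - kappa \<epsilon> (z - c)"
proof -
  let ?a = "real CARD('n) / 2" and ?s = "(z - c) \<bullet> (z - c)"
  have r: "0 < r" using assms by simp
  have "laplacian (\<lambda>z. kdiff \<epsilon> r (z - c)) z = 4 * ?s * (ddrprofile ?a \<epsilon> ?s - ddrprofile ?a r ?s)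
      + 2 * real CARD('n) * (drprofile ?a \<epsilon> ?s - drprofile ?a r ?s)"
    unfolding kdiff_def newton_reg_def
    by (rule laplacian_radial)
       (intro DERIV_diff rprofile_has_derivative drprofile_has_derivative assms r)+
  also have "\<dots> = (4 * ?s * ddrprofile ?a \<epsilon> ?s + 4 * ?a * drprofile ?a \<epsilon> ?s)
      - (4 * ?s * ddrprofile ?a r ?s + 4 * ?a * drprofile ?a r ?s)"
    by (simp add: algebra_simps)
  also have "\<dots> = kappa r (z - c) - kappa \<epsilon> (z - c)"
    using assms r by (simp only: rkappa_eq inner_ge_zero kappa_def)
  finally show ?thesis .
qed

lemma continuous_on_newton_reg:
  assumes "0 < \<epsilon>"
  shows "continuous_on A (newton_reg \<epsilon>)"
proof -
  have "continuous_on UNIV (rprofile a \<epsilon>)" for a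
    using rprofile_has_derivative[OF assms] by (intro continuous_at_imp_continuous_on) (auto intro: DERIV_isCont)
  then show ?thesis unfolding newton_reg_def
    by (rule continuous_on_compose2) (auto intro!: continuous_intros)
qed

lemma continuous_on_kdiff: "0 < \<epsilon> \<Longrightarrow> 0 < r \<Longrightarrow> continuous_on A (kdiff \<epsilon> r)"
  unfolding kdiff_def[abs_def] by (intro continuous_intros continuous_on_newton_reg)

lemma isCont_rkappa: "isCont (rkappa a 1) s"
proof (cases "0 < s")
  case True
  then show ?thesis unfolding rkappa_def[abs_def]
    by (intro continuous_intros) (auto intro: isCont_dstep)
next
  case False
  have "eventually (\<lambda>t. t \<in> {..<1/4}) (nhds s)" using False by (intro eventually_nhds_in_open) auto
  then have "eventually (\<lambda>t. rkappa a 1 t = 0) (nhds s)"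
    by eventually_elim (auto simp: rkappa_def dstep_zero)
  then show ?thesis using isCont_cong[of "rkappa a 1" "\<lambda>_. 0" s] by auto
qed

lemma continuous_on_kappa1: "continuous_on A (kappa 1)"
proof -
  have "continuous_on UNIV (rkappa a 1)" for a
    using isCont_rkappa by (intro continuous_at_imp_continuous_on) auto
  then show ?thesis unfolding kappa_def
    by (rule continuous_on_compose2) (auto intro!: continuous_intros)
qed

text \<open>The Newtonian kernel is homogeneous of degree 2 - d, so its Laplacian scales with degree
  -d, exactly as an approximate identity must. Continuity and mass at every scale reduce to scale
  1.\<close>

lemma kappa_scale:
  fixes x :: "real ^ 'n"
  assumes "0 < \<epsilon>"
  shows "kappa \<epsilon> x = \<epsilon> powr (- real CARD('n)) * kappa 1 (x /\<^sub>R \<epsilon>)"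
proof -
  let ?a = "real CARD('n) / 2"
  define s where "s = x \<bullet> x"
  have s: "0 \<le> s" by (simp add: s_def)
  have e2: "\<epsilon>\<^sup>2 powr (1 - ?a) = \<epsilon>\<^sup>2 * \<epsilon> powr (- real CARD('n))"
    using assms powr_powr[of \<epsilon> 2 "1 - ?a"] powr_add[of \<epsilon> 2 "- real CARD('n)"]
    by (simp add: powr_numeral)
  have "(s / \<epsilon>\<^sup>2) powr (1 - ?a) = s powr (1 - ?a) / (\<epsilon>\<^sup>2 * \<epsilon> powr (- real CARD('n)))"
    using s assms by (simp only: powr_divide e2 zero_le_power less_imp_le)
  moreover have "(x /\<^sub>R \<epsilon>) \<bullet> (x /\<^sub>R \<epsilon>) = s / \<epsilon>\<^sup>2"
    by (simp add: s_def power2_eq_square field_simps)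
  ultimately show ?thesis
    using assms unfolding kappa_def s_def [symmetric] rkappa_def by simp
qed

lemma continuous_on_kappa:
  assumes "0 < \<epsilon>"
  shows "continuous_on A (kappa \<epsilon> :: real ^ 'n \<Rightarrow> real)"
proof -
  have "continuous_on A (\<lambda>x :: real ^ 'n. \<epsilon> powr (- real CARD('n)) * kappa 1 (x /\<^sub>R \<epsilon>))"
    by (intro continuous_intros continuous_on_compose2[OF continuous_on_kappa1[of UNIV]]) auto
  then show ?thesis using kappa_scale[OF assms, where 'n = 'n] by presburger
qed

context
  assumes dim3: "3 \<le> CARD('n::finite)"
begin

lemma kappa_nonneg: "0 \<le> kappa \<epsilon> (x :: real ^ 'n)"
  using dim3 dstep_nonneg by (simp add: kappa_def rkappa_def)

lemma kdiff_nonneg: "0 < \<epsilon> \<Longrightarrow> \<epsilon> \<le> r \<Longrightarrow> 0 \<le> kdiff \<epsilon> r (x :: real ^ 'n)"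
  using dim3 by (simp add: kdiff_def newton_reg_def rprofile_antimono)

lemma newton_reg_nonneg: "0 < \<epsilon> \<Longrightarrow> 0 \<le> newton_reg \<epsilon> (x :: real ^ 'n)"
  using dim3 by (simp add: newton_reg_def rprofile_nonneg)

lemma newton_reg_le: "0 < \<epsilon> \<Longrightarrow> x \<noteq> 0 \<Longrightarrow> newton_reg \<epsilon> (x :: real ^ 'n) \<le> newton x"
  using dim3 by (simp add: newton_reg_def newton_def rprofile_le)

lemma newton_reg_antimono: "0 < \<epsilon> \<Longrightarrow> \<epsilon> \<le> r \<Longrightarrow> newton_reg r x \<le> newton_reg \<epsilon> (x :: real ^ 'n)"
  using dim3 by (simp add: newton_reg_def rprofile_antimono)

end

section \<open>Integration tools\<close>

lemma measurable_lebesgue: "f \<in> borel_measurable borel \<Longrightarrow> f \<in> borel_measurable lebesgue"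
  by (simp add: measurable_completion)

lemma sigma_finite_lebesgue: "sigma_finite_measure (lebesgue :: 'a::euclidean_space measure)"
proof
  show "\<exists>A::'a set set. countable A \<and> A \<subseteq> sets lebesgue \<and> \<Union> A = space lebesgue \<and> (\<forall>a\<in>A. emeasure lebesgue a \<noteq> \<infinity>)"
  proof (intro exI[of _ "range (\<lambda>n::nat. ball 0 (real n))"] conjI ballI)
    show "\<Union> (range (\<lambda>n. ball (0::'a) (real n))) = space lebesgue"
      using reals_Archimedean2 by (auto simp: dist_norm)
    fix a :: "'a set" assume "a \<in> range (\<lambda>n. ball 0 (real n))"
    then show "emeasure lebesgue a \<noteq> \<infinity>"
      using emeasure_lborel_ball_finite by (auto simp: less_top)
  qed auto
qed

interpretation lebesgue: sigma_finite_measure "lebesgue :: 'a::euclidean_space measure"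
  by (rule sigma_finite_lebesgue)

interpretation lebesgue_pair: pair_sigma_finite "lebesgue :: 'a::euclidean_space measure" "lebesgue :: 'b::euclidean_space measure" ..

lemma lborel_reflect: "lborel = distr lborel borel (\<lambda>z::'a::euclidean_space. x - z)"
  using lborel_affine[of "-1" x] by (simp add: density_1)

lemma
  fixes f :: "'a::euclidean_space \<Rightarrow> real"
  assumes [measurable]: "f \<in> borel_measurable borel"
  shows integral_reflect: "(LINT z|lebesgue. f (x - z)) = (LINT z|lebesgue. f z)"
    and integrable_reflect: "integrable lebesgue (\<lambda>z. f (x - z)) \<longleftrightarrow> integrable lebesgue f"
proof -
  have "integral\<^sup>L (distr lborel borel (\<lambda>z. x - z)) f = (LINT z|lborel. f (x - z))"
    by (rule integral_distr) auto
  then have "integral\<^sup>L lborel f = (LINT z|lborel. f (x - z))"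
    by (metis lborel_reflect)
  then show "(LINT z|lebesgue. f (x - z)) = (LINT z|lebesgue. f z)"
    by (simp add: integral_completion)
  have "integrable (distr lborel borel (\<lambda>z. x - z)) f \<longleftrightarrow> integrable lborel (\<lambda>z. f (x - z))"
    by (rule integrable_distr_eq) auto
  then have "integrable lborel f \<longleftrightarrow> integrable lborel (\<lambda>z. f (x - z))"
    by (metis lborel_reflect)
  then show "integrable lebesgue (\<lambda>z. f (x - z)) \<longleftrightarrow> integrable lebesgue f"
    by (simp add: integrable_completion)
qed

lemma nn_integral_reflect:
  fixes f :: "'a::euclidean_space \<Rightarrow> ennreal"
  assumes [measurable]: "f \<in> borel_measurable borel"
  shows "(\<integral>\<^sup>+z. f (x - z) \<partial>lebesgue) = (\<integral>\<^sup>+z. f z \<partial>lebesgue)"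
proof -
  have "integral\<^sup>N (distr lborel borel (\<lambda>z. x - z)) f = (\<integral>\<^sup>+z. f (x - z) \<partial>lborel)"
    by (rule nn_integral_distr) auto
  then have "integral\<^sup>N lborel f = (\<integral>\<^sup>+z. f (x - z) \<partial>lborel)"
    by (metis lborel_reflect)
  then show ?thesis by (simp add: nn_integral_completion)
qed

lemma integral_scale:
  fixes f :: "'a::euclidean_space \<Rightarrow> real"
  assumes [measurable]: "f \<in> borel_measurable borel" and c: "0 < c"
  shows "(LINT z|lebesgue. f (z /\<^sub>R c)) = c ^ DIM('a) * (LINT z|lebesgue. f z)"
proof -
  have "integral\<^sup>L (density (distr lborel borel (\<lambda>x. 0 + c *\<^sub>R x)) (\<lambda>_. ennreal (\<bar>c\<bar> ^ DIM('a)))) (\<lambda>z. f (z /\<^sub>R c))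
      = c ^ DIM('a) * integral\<^sup>L lborel f"
    using c by (subst integral_density) (auto simp: integral_distr)
  moreover have "density (distr lborel borel (\<lambda>x::'a. 0 + c *\<^sub>R x)) (\<lambda>_. ennreal (\<bar>c\<bar> ^ DIM('a))) = lborel"
    using lborel_affine[of c "0::'a"] c by simp
  ultimately have "integral\<^sup>L lborel (\<lambda>z. f (z /\<^sub>R c)) = c ^ DIM('a) * integral\<^sup>L lborel f"
    by (simp only:)
  then show ?thesis by (simp add: integral_completion)
qed

lemma integrable_bounded_support:
  fixes f :: "'a::euclidean_space \<Rightarrow> real"
  assumes [measurable]: "f \<in> borel_measurable lebesgue" and "\<And>x. \<bar>f x\<bar> \<le> B" "\<And>x. x \<notin> cball c r \<Longrightarrow> f x = 0"
  shows "integrable lebesgue f"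
proof (rule Bochner_Integration.integrable_bound)
  show "integrable lebesgue (\<lambda>x. B * indicator (cball c r) x :: real)"
    using emeasure_lborel_cball_finite by (intro integrable_mult_right integrable_real_indicator) auto
  show "AE x in lebesgue. norm (f x) \<le> norm (B * indicator (cball c r) x :: real)"
    using assms(2,3) by (intro AE_I2) (auto simp: indicator_def intro: order_trans[OF _ abs_ge_self])
qed fact

lemma continuous_support_bounded:
  fixes f :: "'a::euclidean_space \<Rightarrow> real"
  assumes "continuous_on UNIV f" "\<And>x. x \<notin> K \<Longrightarrow> f x = 0" "compact K"
  obtains B where "0 \<le> B" "\<And>x. \<bar>f x\<bar> \<le> B"
proof -
  have "compact (f ` K)" using assms continuous_on_subset by (intro compact_continuous_image) blast+
  then obtain B where "\<And>y. y \<in> f ` K \<Longrightarrow> norm y \<le> B" using compact_imp_bounded bounded_iff by metis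
  then have "\<bar>f x\<bar> \<le> max B 0" for x using assms(2)[of x] by (cases "x \<in> K") force+
  then show ?thesis using that[of "max B 0"] by simp
qed

lemma compact_subset_cball:
  fixes K :: "'a::euclidean_space set"
  assumes "compact K" obtains r where "0 \<le> r" "K \<subseteq> cball a r"
proof -
  obtain e where e: "\<And>x. x \<in> K \<Longrightarrow> dist a x \<le> e"
    using compact_imp_bounded[OF assms] bounded_any_center[of K a] by blast
  show ?thesis by (rule that[of "max e 0"]) (use e in fastforce)+
qed

lemma continuous_support_integrable:
  fixes f :: "'a::euclidean_space \<Rightarrow> real"
  assumes "continuous_on UNIV f" "\<And>x. x \<notin> K \<Longrightarrow> f x = 0" "compact K"
  shows "integrable lebesgue f"
proof -
  obtain B where B: "\<And>x. \<bar>f x\<bar> \<le> B" using continuous_support_bounded[OF assms] by metis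
  obtain r where r: "K \<subseteq> cball 0 r" using compact_subset_cball[OF assms(3)] by metis
  show ?thesis
  proof (rule integrable_bounded_support[of f B 0 r])
    show "f \<in> borel_measurable lebesgue"
      by (intro measurable_lebesgue borel_measurable_continuous_onI assms(1))
    show "f x = 0" if "x \<notin> cball 0 r" for x using assms(2) r that by blast
  qed (rule B)
qed

lemma locally_integrable_onD:
  "locally_integrable_on f S \<Longrightarrow> compact K \<Longrightarrow> K \<subseteq> S \<Longrightarrow> integrable lebesgue (\<lambda>x. indicator K x *\<^sub>R f x)"
  by (auto simp: locally_integrable_on_def set_integrable_def)

lemma locally_integrable_measurable:
  fixes f :: "'a::euclidean_space \<Rightarrow> 'b::euclidean_space"
  assumes "locally_integrable_on f UNIV"
  shows "f \<in> borel_measurable lebesgue"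
proof (rule borel_measurable_LIMSEQ_metric)
  show "(\<lambda>x. indicator (cball 0 (real n)) x *\<^sub>R f x) \<in> borel_measurable lebesgue" for n
    using locally_integrable_onD[OF assms, of "cball 0 (real n)"] by auto
  show "(\<lambda>n. indicator (cball 0 (real n)) x *\<^sub>R f x) \<longlonglongrightarrow> f x" for x
  proof (rule tendsto_eventually)
    obtain m where m: "norm x \<le> real m" using real_arch_simple by blast
    show "\<forall>\<^sub>F n in sequentially. indicator (cball 0 (real n)) x *\<^sub>R f x = f x"
      using eventually_ge_at_top[of m] by eventually_elim (use m in \<open>auto simp: indicator_def\<close>)
  qed
qed

lemma locally_integrable_mult:
  fixes u :: "'a::euclidean_space \<Rightarrow> real"
  assumes u: "locally_integrable_on u S" and [measurable]: "g \<in> borel_measurable lebesgue"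
    and B: "\<And>x. \<bar>g x\<bar> \<le> B" and K: "\<And>x. x \<notin> K \<Longrightarrow> g x = 0" "compact K" "K \<subseteq> S"
  shows "integrable lebesgue (\<lambda>x. u x * g x)"
proof (rule Bochner_Integration.integrable_bound)
  have 1: "integrable lebesgue (\<lambda>x. indicator K x *\<^sub>R u x)"
    by (rule locally_integrable_onD[OF u K(2,3)])
  then show "integrable lebesgue (\<lambda>x. B * (indicator K x *\<^sub>R u x))" by (rule integrable_mult_right)
  have eq: "(\<lambda>x. u x * g x) = (\<lambda>x. (indicator K x *\<^sub>R u x) * g x)"
    using K by (auto simp: fun_eq_iff indicator_def)
  show "(\<lambda>x. u x * g x) \<in> borel_measurable lebesgue"
    unfolding eq using 1 by (intro borel_measurable_times) auto
  show "AE x in lebesgue. norm (u x * g x) \<le> norm (B * (indicator K x *\<^sub>R u x))"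
  proof (intro AE_I2)
    fix x
    have "\<bar>u x\<bar> * \<bar>g x\<bar> \<le> \<bar>u x\<bar> * \<bar>B\<bar>"
      using B[of x] by (intro mult_left_mono) auto
    then show "norm (u x * g x) \<le> norm (B * (indicator K x *\<^sub>R u x))"
      using K by (cases "x \<in> K") (auto simp: abs_mult mult.commute)
  qed
qed

lemma measurable_difference:
  fixes k :: "'a::euclidean_space \<Rightarrow> 'b::topological_space"
  assumes "k \<in> borel_measurable borel"
  shows "(\<lambda>p. k (fst p - snd p)) \<in> borel_measurable (lebesgue \<Otimes>\<^sub>M lebesgue)"
proof -
  have id: "(\<lambda>x. x) \<in> lebesgue \<rightarrow>\<^sub>M (borel :: 'a measure)" by (simp add: measurable_completion)
  have "(\<lambda>p. fst p - snd p) \<in> (lebesgue \<Otimes>\<^sub>M lebesgue) \<rightarrow>\<^sub>M (borel :: 'a measure)"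
    by (intro borel_measurable_diff measurable_compose[OF measurable_fst id] measurable_compose[OF measurable_snd id])
  from measurable_compose[OF this assms] show ?thesis .
qed

text \<open>Integrating in \<open>x\<close> first, translation invariance bounds the double integral
  by B times the L^1 norms of \<open>u\<close> and \<open>k\<close>.\<close>

lemma kernel_integrable_pair:
  fixes u :: "'a::euclidean_space \<Rightarrow> real"
  assumes u: "integrable lebesgue u" and [measurable]: "g \<in> borel_measurable lebesgue"
    and B: "\<And>x. \<bar>g x\<bar> \<le> B" and [measurable]: "k \<in> borel_measurable borel" and k: "integrable lebesgue k"
  shows "integrable (lebesgue \<Otimes>\<^sub>M lebesgue) (\<lambda>(x, z). g x * u z * k (x - z))"
proof -
  have [measurable]: "u \<in> borel_measurable lebesgue" using u by simp
  have km: "(\<lambda>(x, z). k (x - z)) \<in> borel_measurable (lebesgue \<Otimes>\<^sub>M (lebesgue :: 'a measure))"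
    using measurable_difference[OF \<open>k \<in> borel_measurable borel\<close>] by (simp add: split_beta')
  have meas: "(\<lambda>(x, z). g x * u z * k (x - z)) \<in> borel_measurable (lebesgue \<Otimes>\<^sub>M lebesgue)"
    using km by (simp add: split_beta')
  have "(\<integral>\<^sup>+p. ennreal (norm (case p of (x, z) \<Rightarrow> g x * u z * k (x - z))) \<partial>(lebesgue \<Otimes>\<^sub>M lebesgue))
      = (\<integral>\<^sup>+z. (\<integral>\<^sup>+x. ennreal \<bar>g x * u z * k (x - z)\<bar> \<partial>lebesgue) \<partial>lebesgue)"
    using meas by (subst lebesgue_pair.nn_integral_snd [symmetric]) auto
  also have "\<dots> \<le> (\<integral>\<^sup>+z. ennreal (\<bar>B\<bar> * \<bar>u z\<bar>) * (\<integral>\<^sup>+x. ennreal \<bar>k x\<bar> \<partial>lebesgue) \<partial>lebesgue)"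
  proof (rule nn_integral_mono)
    fix z :: 'a
    have "(\<integral>\<^sup>+x. ennreal \<bar>g x * u z * k (x - z)\<bar> \<partial>lebesgue)
        \<le> (\<integral>\<^sup>+x. ennreal (\<bar>B\<bar> * \<bar>u z\<bar>) * ennreal \<bar>k (x - z)\<bar> \<partial>lebesgue)"
    proof (rule nn_integral_mono)
      fix x
      have "\<bar>g x * u z * k (x - z)\<bar> \<le> (\<bar>B\<bar> * \<bar>u z\<bar>) * \<bar>k (x - z)\<bar>"
        unfolding abs_mult using B[of x] by (intro mult_right_mono) auto
      then show "ennreal \<bar>g x * u z * k (x - z)\<bar> \<le> ennreal (\<bar>B\<bar> * \<bar>u z\<bar>) * ennreal \<bar>k (x - z)\<bar>"
        by (simp add: ennreal_mult'[symmetric] ennreal_leI)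
    qed
    also have "\<dots> = ennreal (\<bar>B\<bar> * \<bar>u z\<bar>) * (\<integral>\<^sup>+x. ennreal \<bar>k (x - z)\<bar> \<partial>lebesgue)"
      by (rule nn_integral_cmult, rule measurable_lebesgue) measurable
    also have "(\<integral>\<^sup>+x. ennreal \<bar>k (x - z)\<bar> \<partial>lebesgue) = (\<integral>\<^sup>+x. ennreal \<bar>k x\<bar> \<partial>lebesgue)"
    proof -
      have "(\<integral>\<^sup>+x. ennreal \<bar>k (x - z)\<bar> \<partial>lebesgue) = (\<integral>\<^sup>+x. ennreal \<bar>k (- x)\<bar> \<partial>lebesgue)"
        using nn_integral_reflect[of "\<lambda>x. ennreal \<bar>k (- x)\<bar>" z] by simp
      also have "\<dots> = (\<integral>\<^sup>+x. ennreal \<bar>k x\<bar> \<partial>lebesgue)"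
        using nn_integral_reflect[of "\<lambda>x. ennreal \<bar>k x\<bar>" 0] by simp
      finally show ?thesis .
    qed
    finally show "(\<integral>\<^sup>+x. ennreal \<bar>g x * u z * k (x - z)\<bar> \<partial>lebesgue)
        \<le> ennreal (\<bar>B\<bar> * \<bar>u z\<bar>) * (\<integral>\<^sup>+x. ennreal \<bar>k x\<bar> \<partial>lebesgue)" .
  qed
  also have "\<dots> = (\<integral>\<^sup>+z. ennreal (\<bar>B\<bar> * \<bar>u z\<bar>) \<partial>lebesgue) * (\<integral>\<^sup>+x. ennreal \<bar>k x\<bar> \<partial>lebesgue)"
    by (rule nn_integral_multc) auto
  also have "\<dots> < \<infinity>"
  proof -
    have "integrable lebesgue (\<lambda>z. \<bar>B\<bar> * \<bar>u z\<bar>)" using u by (intro integrable_mult_right integrable_abs)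
    then have "(\<integral>\<^sup>+z. ennreal (\<bar>B\<bar> * \<bar>u z\<bar>) \<partial>lebesgue) < \<infinity>"
      by (subst nn_integral_eq_integral) auto
    have "integrable lebesgue (\<lambda>z. \<bar>k z\<bar>)" using k by (intro integrable_abs)
    then have "(\<integral>\<^sup>+x. ennreal \<bar>k x\<bar> \<partial>lebesgue) < \<infinity>"
      by (subst nn_integral_eq_integral) auto
    with \<open>(\<integral>\<^sup>+z. ennreal (\<bar>B\<bar> * \<bar>u z\<bar>) \<partial>lebesgue) < \<infinity>\<close> show ?thesis
      by (simp add: ennreal_mult_less_top)
  qed
  finally show ?thesis using meas by (simp add: integrable_iff_bounded)
qed

lemma kernel_Fubini:
  fixes u :: "'a::euclidean_space \<Rightarrow> real"
  assumes u: "locally_integrable_on u UNIV" and [measurable]: "g \<in> borel_measurable lebesgue"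
    and B: "\<And>x. \<bar>g x\<bar> \<le> B" and K: "\<forall>x. x \<notin> cball c R \<longrightarrow> g x = 0"
    and km [measurable]: "k \<in> borel_measurable borel" and k: "integrable lebesgue k"
    and kr: "\<forall>x. r \<le> norm x \<longrightarrow> k x = 0"
  shows "(LINT x|lebesgue. g x * (LINT z|lebesgue. u z * k (x - z)))
        = (LINT z|lebesgue. u z * (LINT x|lebesgue. g x * k (x - z)))" (is ?eq)
    and "integrable lebesgue (\<lambda>x. g x * (LINT z|lebesgue. u z * k (x - z)))" (is ?int1)
    and "integrable lebesgue (\<lambda>z. u z * (LINT x|lebesgue. g x * k (x - z)))" (is ?int2)
    and "AE x in lebesgue. g x \<noteq> 0 \<longrightarrow> integrable lebesgue (\<lambda>z. u z * k (x - z))" (is ?ae)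
proof -
  \<comment> \<open>Where the integrand is nonzero, x lies within R of c and z within r of x;
    cutting \<open>u\<close> off at radius R + r changes nothing there and makes a locally
    integrable function integrable.\<close>
  define v where "v = (\<lambda>x. indicator (cball c (R + r)) x *\<^sub>R u x)"
  have v: "integrable lebesgue v"
    unfolding v_def by (rule locally_integrable_onD[OF u]) auto
  have P: "integrable (lebesgue \<Otimes>\<^sub>M lebesgue) (\<lambda>(x, z). g x * v z * k (x - z))"
    by (rule kernel_integrable_pair[OF v _ B km k]) auto
  have eq: "g x * v z * k (x - z) = g x * u z * k (x - z)" for x z
  proof (cases "g x = 0 \<or> k (x - z) = 0")
    case False
    then have "x \<in> cball c R" "norm (x - z) \<le> r" using K[rule_format, of x] kr[rule_format, of "x - z"] by force+
    then have "dist c z \<le> R + r"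
      using dist_triangle[of c z x] by (simp add: dist_norm)
    then show ?thesis by (simp add: v_def)
  qed auto
  have P': "integrable (lebesgue \<Otimes>\<^sub>M lebesgue) (\<lambda>(x, z). g x * u z * k (x - z))"
    using P by (simp only: eq)
  have e1: "(LINT z|lebesgue. g x * u z * k (x - z)) = g x * (LINT z|lebesgue. u z * k (x - z))" for x
    by (simp only: mult.assoc integral_mult_right_zero)
  have e2: "(LINT x|lebesgue. g x * u z * k (x - z)) = u z * (LINT x|lebesgue. g x * k (x - z))" for z
    by (simp only: mult.assoc integral_mult_right_zero mult.left_commute[of _ "u z"])
  show ?eq using lebesgue_pair.Fubini_integral[OF P'] unfolding e1 e2 by simp
  show ?int1 using lebesgue_pair.integrable_fst'[OF P'] by (simp add: e1)
  show ?int2 using lebesgue_pair.integrable_snd[OF P'] by (simp add: e2)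
  show ?ae using lebesgue_pair.AE_integrable_fst'[OF P']
  proof eventually_elim
    fix x assume "integrable lebesgue (\<lambda>z. case (x, z) of (x, z) \<Rightarrow> g x * u z * k (x - z))"
    then have "integrable lebesgue (\<lambda>z. g x * (u z * k (x - z)))" by (simp add: mult.assoc)
    then show "g x \<noteq> 0 \<longrightarrow> integrable lebesgue (\<lambda>z. u z * k (x - z))" by auto
  qed
qed

section \<open>Decomposition into shells of geometrically decreasing radii\<close>

lemma theta_adic_ex:
  fixes \<theta> s r :: real
  assumes "0 < \<theta>" "\<theta> < 1" "0 < s" "s < r"
  obtains j where "\<theta> ^ Suc j * r \<le> s" "s < \<theta> ^ j * r"
proof -
  obtain n where "\<theta> ^ n < s / r" using real_arch_pow_inv[of "s / r" \<theta>] assms by auto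
  then have ex: "\<exists>n. \<theta> ^ n * r \<le> s" using assms by (intro exI[of _ n]) (simp add: field_simps)
  define m where "m = (LEAST n. \<theta> ^ n * r \<le> s)"
  have m: "\<theta> ^ m * r \<le> s" unfolding m_def using ex by (rule LeastI_ex)
  then obtain j where j: "m = Suc j" using assms by (cases m) auto
  have "\<not> \<theta> ^ j * r \<le> s" using not_less_Least[of j "\<lambda>n. \<theta> ^ n * r \<le> s"] j m_def by auto
  then show ?thesis using that m j by auto
qed

text \<open>On the shell between \<theta>^(j+1) r and \<theta>^j r the weight is at most its value
  at the inner radius, which costs \<theta>^(-p) against the outer one. Enlarging the shell to a
  ball and inserting \<open>bound\<close> leaves a geometric series in \<open>g\<close>.\<close>

lemma nn_integral_theta_adic:
  fixes f :: "'a::euclidean_space \<Rightarrow> ennreal"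
  assumes [measurable]: "f \<in> borel_measurable lebesgue"
    and \<theta>: "0 < \<theta>" "\<theta> < 1" and r: "0 < r" and p: "0 \<le> p" and K: "0 \<le> K" and g: "0 \<le> g" "g < 1"
    and bound: "\<And>j. (\<integral>\<^sup>+z. f z * indicator (ball a (\<theta> ^ j * r)) z \<partial>lebesgue) \<le> ennreal (K * (\<theta> ^ j * r) powr p * g ^ j)"
  shows "(\<integral>\<^sup>+z. ennreal (norm (z - a) powr (- p)) * (f z * indicator (ball a r) z) \<partial>lebesgue)
      \<le> ennreal (K * \<theta> powr (- p) / (1 - g))"
proof -
  have fm: "(\<lambda>z. f z * indicator (ball a s) z) \<in> borel_measurable lebesgue" for s
    by (intro borel_measurable_times_ennreal borel_measurable_indicator assms(1)) auto
  let ?c = "\<lambda>j. ennreal ((\<theta> ^ Suc j * r) powr (- p))"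
  let ?t = "\<lambda>j z. ?c j * (f z * indicator (ball a (\<theta> ^ j * r)) z)"
  have "(\<integral>\<^sup>+z. ennreal (norm (z - a) powr (- p)) * (f z * indicator (ball a r) z) \<partial>lebesgue)
      \<le> (\<integral>\<^sup>+z. (\<Sum>j. ?t j z) \<partial>lebesgue)"
  proof (rule nn_integral_mono)
    fix z
    show "ennreal (norm (z - a) powr (- p)) * (f z * indicator (ball a r) z) \<le> (\<Sum>j. ?t j z)"
    \<comment> \<open>At the centre the weight is \<open>0 powr (- p) = 0\<close>, so the singular
      point contributes nothing.\<close>
    proof (cases "z = a \<or> z \<notin> ball a r")
      case False
      then have "0 < norm (z - a)" "norm (z - a) < r" by (auto simp: dist_norm norm_minus_commute)
      then obtain j where j: "\<theta> ^ Suc j * r \<le> norm (z - a)" "norm (z - a) < \<theta> ^ j * r"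
        using theta_adic_ex[OF \<theta>] by metis
      have "norm (z - a) powr (- p) \<le> (\<theta> ^ Suc j * r) powr (- p)"
        using j \<theta> r p by (intro powr_mono2') auto
      then have "ennreal (norm (z - a) powr (- p)) * (f z * indicator (ball a r) z) \<le> ?t j z"
        using j(2) False by (intro mult_mono ennreal_leI) (auto simp: dist_norm norm_minus_commute)
      also have "\<dots> = (\<Sum>i\<in>{j}. ?t i z)" by simp
      also have "\<dots> \<le> (\<Sum>j. ?t j z)" by (rule sum_le_suminf) auto
      finally show ?thesis .
    qed auto
  qed
  also have "\<dots> = (\<Sum>j. \<integral>\<^sup>+z. ?t j z \<partial>lebesgue)"
    by (intro nn_integral_suminf borel_measurable_times_ennreal borel_measurable_const fm)
  also have "\<dots> \<le> (\<Sum>j. ennreal (K * \<theta> powr (- p) * g ^ j))"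
  proof (intro suminf_le summableI)
    fix j
    have "(\<integral>\<^sup>+z. ?t j z \<partial>lebesgue) = ?c j * (\<integral>\<^sup>+z. f z * indicator (ball a (\<theta> ^ j * r)) z \<partial>lebesgue)"
      by (intro nn_integral_cmult fm)
    also have "\<dots> \<le> ?c j * ennreal (K * (\<theta> ^ j * r) powr p * g ^ j)"
      by (intro mult_left_mono bound) auto
    also have "\<dots> = ennreal ((\<theta> ^ Suc j * r) powr (- p) * (K * (\<theta> ^ j * r) powr p * g ^ j))"
      using K g by (intro ennreal_mult[symmetric]) auto
    also have "(\<theta> ^ Suc j * r) powr (- p) * (K * (\<theta> ^ j * r) powr p * g ^ j) = K * \<theta> powr (- p) * g ^ j"
    proof -
      have "(\<theta> ^ Suc j * r) powr (- p) = \<theta> powr (- p) * (\<theta> ^ j * r) powr (- p)"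
        using \<theta> r by (simp add: powr_mult mult.assoc)
      moreover have "(\<theta> ^ j * r) powr (- p) * (\<theta> ^ j * r) powr p = 1"
        using \<theta> r by (simp flip: powr_add)
      ultimately show ?thesis by (simp add: mult.commute mult.left_commute)
    qed
    finally show "(\<integral>\<^sup>+z. ?t j z \<partial>lebesgue) \<le> ennreal (K * \<theta> powr (- p) * g ^ j)" .
  qed
  also have "\<dots> = ennreal (K * \<theta> powr (- p) / (1 - g))"
  proof -
    have "(\<lambda>j. K * \<theta> powr (- p) * g ^ j) sums (K * \<theta> powr (- p) * (1 / (1 - g)))"
      using g by (intro sums_mult geometric_sums) auto
    then show ?thesis using K g
      by (intro suminf_ennreal_eq) auto
  qed
  finally show ?thesis .
qed

lemma measure_ball_power:
  "0 \<le> r \<Longrightarrow> measure lebesgue (ball (c :: 'a::euclidean_space) r) = r ^ DIM('a) * measure lebesgue (ball (0 :: 'a) 1)"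
  using content_ball_conv_unit_ball[of r c] by (simp add: measure_completion)

lemma emeasure_ball_power:
  "0 \<le> r \<Longrightarrow> emeasure lebesgue (ball (c :: 'a::euclidean_space) r) = ennreal (r ^ DIM('a) * measure lebesgue (ball (0 :: 'a) 1))"
proof -
  assume "0 \<le> r"
  have "emeasure lebesgue (ball c r) \<noteq> top" using emeasure_lborel_ball_finite[of c r] by auto
  from emeasure_eq_ennreal_measure[OF this] show ?thesis
    by (simp only: measure_ball_power[OF \<open>0 \<le> r\<close>])
qed

section \<open>Integration by parts\<close>

lemma smooth_on_iter_deriv: "smooth_on U f \<Longrightarrow> smooth_on U (iter_deriv vs f)"
  by (metis smooth_on_def iter_deriv_append)

lemma smooth_continuous_on: "smooth_on UNIV f \<Longrightarrow> continuous_on A (iter_deriv vs f)"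
  by (intro continuous_at_imp_continuous_on ballI differentiable_imp_continuous_within)
     (auto simp: smooth_on_def)

lemma smooth_line_derivative:
  fixes f :: "'a::real_normed_vector \<Rightarrow> real"
  assumes "smooth_on UNIV f"
  shows "((\<lambda>t. f (x + t *\<^sub>R v)) has_real_derivative iter_deriv [v] f (x + t *\<^sub>R v)) (at t)"
proof -
  have 1: "((\<lambda>t. x + t *\<^sub>R v) has_derivative (\<lambda>h. h *\<^sub>R v)) (at t)"
    by (auto intro!: derivative_eq_intros)
  have 2: "(f has_derivative (\<lambda>w. iter_deriv [w] f (x + t *\<^sub>R v))) (at (x + t *\<^sub>R v))"
    using smooth_on_iter_deriv_has_derivative[OF assms, of "x + t *\<^sub>R v" "[]"] by simp
  have "linear (\<lambda>w. iter_deriv [w] f (x + t *\<^sub>R v))"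
    using 2 has_derivative_linear by blast
  then have "iter_deriv [h *\<^sub>R v] f (x + t *\<^sub>R v) = h * iter_deriv [v] f (x + t *\<^sub>R v)" for h
    using linear_scale[of "\<lambda>w. iter_deriv [w] f (x + t *\<^sub>R v)" h v]
    unfolding real_scaleR_def by blast
  moreover have "((\<lambda>t. f (x + t *\<^sub>R v)) has_derivative (\<lambda>h. iter_deriv [h *\<^sub>R v] f (x + t *\<^sub>R v))) (at t)"
    by (rule has_derivative_compose[OF 1 2])
  ultimately show ?thesis
    unfolding has_real_derivative_iff_mult by presburger
qed

lemma test_function_support:
  fixes \<phi> :: "'a::euclidean_space \<Rightarrow> real"
  assumes "test_function S \<phi>"
  obtains K where "compact K" "K \<subseteq> S" "\<And>vs x. x \<notin> K \<Longrightarrow> iter_deriv vs \<phi> x = 0"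
proof -
  obtain K where K: "compact K" "K \<subseteq> S" "\<And>x. x \<notin> K \<Longrightarrow> \<phi> x = 0"
    using assms by (auto simp: test_function_def)
  have z: "iter_deriv vs (\<lambda>_::'a. 0::real) = (\<lambda>_. 0)" for vs
    by (induction vs) (auto simp: frechet_derivative_const)
  have "open (- K)" using K(1) compact_imp_closed by blast
  then have "\<forall>x\<in>- K. iter_deriv vs \<phi> x = iter_deriv vs (\<lambda>_. 0) x" for vs
    by (rule iter_deriv_cong_open) (use K in auto)
  then show ?thesis using that[OF K(1,2)] z by simp
qed

lemma test_function_smooth: "test_function S \<phi> \<Longrightarrow> smooth_on UNIV \<phi>"
  by (simp add: test_function_def smooth_on_UNIV)

lemma integral_shift:
  fixes f :: "'a::euclidean_space \<Rightarrow> real"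
  assumes [measurable]: "f \<in> borel_measurable borel"
  shows "(LINT z|lebesgue. f (z + a)) = (LINT z|lebesgue. f z)"
proof -
  have "(LINT z|lebesgue. f (z + a)) = (LINT z|lebesgue. f (- z))"
    using integral_reflect[of "\<lambda>z. f (- z)" "- a"] by (simp add: add.commute)
  also have "\<dots> = (LINT z|lebesgue. f z)"
    using integral_reflect[of f 0] by simp
  finally show ?thesis .
qed

text \<open>Difference quotients of \<open>h\<close> have integral 0 by translation invariance. The
  mean value theorem bounds them by the supremum of \<open>D\<close>, so dominated convergence
  carries this over to the derivative.\<close>

lemma integral_derivative_zero:
  fixes h D :: "'a::euclidean_space \<Rightarrow> real"
  assumes D: "\<And>x t. ((\<lambda>t. h (x + t *\<^sub>R v)) has_real_derivative D (x + t *\<^sub>R v)) (at t)"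
    and cont: "continuous_on UNIV h" "continuous_on UNIV D"
    and K: "compact K" "\<And>x. x \<notin> K \<Longrightarrow> h x = 0" "\<And>x. x \<notin> K \<Longrightarrow> D x = 0"
  shows "(LINT x|lebesgue. D x) = 0"
proof -
  obtain B where B: "0 \<le> B" "\<And>x. \<bar>D x\<bar> \<le> B"
    using continuous_support_bounded[OF cont(2) K(3,1)] by metis
  obtain R where R: "0 \<le> R" "K \<subseteq> cball 0 R" using compact_subset_cball[OF K(1)] by metis
  define \<tau> where "\<tau> n = inverse (real (Suc n))" for n
  have \<tau>: "0 < \<tau> n" "\<tau> n \<le> 1" for n by (auto simp: \<tau>_def inverse_le_1_iff)
  let ?q = "\<lambda>n x. (h (x + \<tau> n *\<^sub>R v) - h x) / \<tau> n"
  have hb: "h \<in> borel_measurable borel" using cont by (simp add: borel_measurable_continuous_onI)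
  have hi: "integrable lebesgue h" by (rule continuous_support_integrable[OF cont(1) K(2,1)])
  have hs: "integrable lebesgue (\<lambda>x. h (x + a))" for a
  proof (rule continuous_support_integrable[where K = "(\<lambda>x. x - a) ` K"])
    show "continuous_on UNIV (\<lambda>x. h (x + a))"
      by (rule continuous_on_compose2[OF cont(1)]) (auto intro!: continuous_intros)
    show "compact ((\<lambda>x. x - a) ` K)" by (intro compact_continuous_image K continuous_intros)
    fix x assume "x \<notin> (\<lambda>x. x - a) ` K"
    then have "x + a \<notin> K" by force
    then show "h (x + a) = 0" by (rule K)
  qed
  have "(\<lambda>n. LINT x|lebesgue. ?q n x) \<longlonglongrightarrow> (LINT x|lebesgue. D x)"
  proof (rule integral_dominated_convergence)
    \<comment> \<open>The increments satisfy \<open>\<tau> n \<le> 1\<close>, so all quotients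
      vanish outside the ball containing \<open>K\<close> enlarged by \<open>norm v\<close>.\<close>
    show "integrable lebesgue (\<lambda>x. B * indicator (cball 0 (R + norm v)) x :: real)"
      using emeasure_lborel_cball_finite by (intro integrable_mult_right integrable_real_indicator) auto
    show "AE x in lebesgue. (\<lambda>n. ?q n x) \<longlonglongrightarrow> D x"
    proof (intro AE_I2)
      fix x
      have "((\<lambda>t. (h (x + t *\<^sub>R v) - h x) / t) \<longlongrightarrow> D x) (at 0)"
        using D[of x 0] by (simp add: DERIV_def)
      moreover have "\<tau> \<longlonglongrightarrow> 0" unfolding \<tau>_def by (rule LIMSEQ_inverse_real_of_nat)
      then have "filterlim \<tau> (at 0) sequentially"
        unfolding filterlim_at using \<tau>(1) by (simp add: less_imp_neq[THEN not_sym])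
      ultimately show "(\<lambda>n. ?q n x) \<longlonglongrightarrow> D x" by (rule filterlim_compose)
    qed
    show "AE x in lebesgue. norm (?q n x) \<le> B * indicator (cball 0 (R + norm v)) x" for n
    proof (intro AE_I2)
      fix x
      show "norm (?q n x) \<le> B * indicator (cball 0 (R + norm v)) x"
      proof (cases "x \<in> cball 0 (R + norm v)")
        case True
        obtain z where "h (x + \<tau> n *\<^sub>R v) - h (x + 0 *\<^sub>R v) = (\<tau> n - 0) * D (x + z *\<^sub>R v)"
          using MVT2[OF \<tau>(1)[of n], of "\<lambda>t. h (x + t *\<^sub>R v)" "\<lambda>t. D (x + t *\<^sub>R v)"] D by blast
        then have "?q n x = D (x + z *\<^sub>R v)" using \<tau>(1)[of n] by simp
        then show ?thesis using True B by simp
      next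
        case False
        have "norm (\<tau> n *\<^sub>R v) \<le> norm v" using \<tau>[of n] by (simp add: mult_left_le_one_le)
        then have "R < norm (x + \<tau> n *\<^sub>R v)"
          using False norm_triangle_ineq4[of "x + \<tau> n *\<^sub>R v" "\<tau> n *\<^sub>R v"] by simp
        then have "x + \<tau> n *\<^sub>R v \<notin> K" using R by auto
        moreover have "x \<notin> K"
        proof
          assume "x \<in> K"
          then have "norm x \<le> R" using R by auto
          then show False using False norm_ge_zero[of v] by simp
        qed
        ultimately show ?thesis using K False by simp
      qed
    qed
    show "?q n \<in> borel_measurable lebesgue" for n
      using hi hs by (intro borel_measurable_divide borel_measurable_diff borel_measurable_const) auto
    show "D \<in> borel_measurable lebesgue"
      using cont by (intro measurable_lebesgue borel_measurable_continuous_onI)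
  qed
  moreover have "(LINT x|lebesgue. ?q n x) = 0" for n
    using hi hs integral_shift[OF hb] by simp
  ultimately show ?thesis by (simp only: LIMSEQ_const_iff)
qed

lemma integral_by_parts:
  fixes f g :: "'a::euclidean_space \<Rightarrow> real"
  assumes f: "smooth_on UNIV f" and g: "smooth_on UNIV g"
    and K: "compact K" "\<And>vs x. x \<notin> K \<Longrightarrow> iter_deriv vs g x = 0"
  shows "(LINT x|lebesgue. f x * iter_deriv [v] g x) = - (LINT x|lebesgue. iter_deriv [v] f x * g x)"
proof -
  note cf = smooth_continuous_on[OF f] and cg = smooth_continuous_on[OF g]
  have cf0: "continuous_on A f" and cg0: "continuous_on A g" for A
    using cf[of A "[]"] cg[of A "[]"] by simp_all
  have K0: "x \<notin> K \<Longrightarrow> g x = 0" for x using K(2)[of x "[]"] by simp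
  have i1: "integrable lebesgue (\<lambda>x. f x * iter_deriv [v] g x)"
    by (rule continuous_support_integrable[OF _ _ K(1)]) (use K cf0 cg in \<open>auto intro!: continuous_on_mult simp del: iter_deriv.simps\<close>)
  have i2: "integrable lebesgue (\<lambda>x. iter_deriv [v] f x * g x)"
    by (rule continuous_support_integrable[OF _ _ K(1)]) (use K0 cf cg0 in \<open>auto intro!: continuous_on_mult simp del: iter_deriv.simps\<close>)
  have "(LINT x|lebesgue. iter_deriv [v] f x * g x + iter_deriv [v] g x * f x) = 0"
  proof (rule integral_derivative_zero[where h = "\<lambda>x. f x * g x" and v = v, OF _ _ _ K(1)])
    show "((\<lambda>t. f (x + t *\<^sub>R v) * g (x + t *\<^sub>R v)) has_real_derivative
      iter_deriv [v] f (x + t *\<^sub>R v) * g (x + t *\<^sub>R v) + iter_deriv [v] g (x + t *\<^sub>R v) * f (x + t *\<^sub>R v)) (at t)" for x t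
      by (rule DERIV_mult[OF smooth_line_derivative[OF f] smooth_line_derivative[OF g]])
    show "continuous_on UNIV (\<lambda>x. f x * g x)" by (intro continuous_on_mult cf0 cg0)
    show "continuous_on UNIV (\<lambda>x. iter_deriv [v] f x * g x + iter_deriv [v] g x * f x)"
      by (intro continuous_on_add continuous_on_mult cf cg cf0 cg0)
  qed (use K K0 in \<open>auto simp del: iter_deriv.simps\<close>)
  then show ?thesis using i1 i2 by (simp add: mult.commute del: iter_deriv.simps)
qed

text \<open>The indices come out swapped because the derivatives are moved one at a time, the
  outermost first.\<close>

lemma integral_by_parts2:
  fixes f g :: "real ^ 'n \<Rightarrow> real"
  assumes f: "smooth_on UNIV f" and g: "test_function S g"
  shows "(LINT x|lebesgue. f x * partial2 i j g x) = (LINT x|lebesgue. partial2 j i f x * g x)"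
proof -
  obtain K where K: "compact K" "\<And>vs x. x \<notin> K \<Longrightarrow> iter_deriv vs g x = 0"
    using test_function_support[OF g] by metis
  note sg = test_function_smooth[OF g]
  have K': "iter_deriv vs (iter_deriv [axis j 1] g) x = 0" if "x \<notin> K" for vs x
    using K(2)[OF that, of "vs @ [axis j 1]"] by (simp only: iter_deriv_append)
  have "(LINT x|lebesgue. f x * partial2 i j g x) = (LINT x|lebesgue. f x * iter_deriv [axis i 1] (iter_deriv [axis j 1] g) x)"
    by (simp add: partial2_def)
  also have "\<dots> = - (LINT x|lebesgue. iter_deriv [axis i 1] f x * iter_deriv [axis j 1] g x)"
    by (rule integral_by_parts[OF f smooth_on_iter_deriv[OF sg] K(1) K'])
  also have "\<dots> = (LINT x|lebesgue. iter_deriv [axis j 1] (iter_deriv [axis i 1] f) x * g x)"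
    using integral_by_parts[OF smooth_on_iter_deriv[OF f] sg K, of "[axis i 1]" "axis j 1"] by linarith
  also have "\<dots> = (LINT x|lebesgue. partial2 j i f x * g x)"
    by (simp add: partial2_def)
  finally show ?thesis .
qed

lemma continuous_on_partial2: "smooth_on UNIV f \<Longrightarrow> continuous_on A (partial2 i j f)"
  unfolding partial2_def by (rule smooth_continuous_on)

lemma continuous_on_laplacian: "smooth_on UNIV f \<Longrightarrow> continuous_on A (laplacian f)"
  unfolding laplacian_def[abs_def] by (intro continuous_on_sum continuous_on_partial2)

lemma integral_laplacian:
  fixes f g :: "real ^ 'n \<Rightarrow> real"
  assumes f: "smooth_on UNIV f" and g: "test_function S g"
  shows "(LINT x|lebesgue. f x * laplacian g x) = (LINT x|lebesgue. laplacian f x * g x)"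
proof -
  obtain K where K: "compact K" "\<And>vs x. x \<notin> K \<Longrightarrow> iter_deriv vs g x = 0"
    using test_function_support[OF g] by metis
  note sg = test_function_smooth[OF g]
  have cf0: "continuous_on A f" and cg0: "continuous_on A g" for A
    using smooth_continuous_on[OF f, of A "[]"] smooth_continuous_on[OF sg, of A "[]"] by simp_all
  have K0: "x \<notin> K \<Longrightarrow> g x = 0" for x using K(2)[of x "[]"] by simp
  have i1: "integrable lebesgue (\<lambda>x. f x * partial2 i i g x)" for i
    by (rule continuous_support_integrable[OF _ _ K(1)])
       (intro continuous_on_mult cf0 continuous_on_partial2 sg, simp add: partial2_def K del: iter_deriv.simps)
  have i2: "integrable lebesgue (\<lambda>x. partial2 i i f x * g x)" for i
    by (rule continuous_support_integrable[OF _ _ K(1)])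
       (intro continuous_on_mult cg0 continuous_on_partial2 f, simp add: K0)
  show ?thesis
    unfolding laplacian_def sum_distrib_left sum_distrib_right
    using i1 i2 by (simp add: Bochner_Integration.integral_sum integral_by_parts2[OF f g])
qed

lemma test_function_laplacian_support:
  fixes \<phi> :: "real ^ 'n \<Rightarrow> real"
  assumes "test_function S \<phi>"
  obtains K where "compact K" "K \<subseteq> S" "\<And>x. x \<notin> K \<Longrightarrow> \<phi> x = 0" "\<And>x. x \<notin> K \<Longrightarrow> laplacian \<phi> x = 0"
    "\<And>i j x. x \<notin> K \<Longrightarrow> partial2 i j \<phi> x = 0"
proof -
  obtain K where K: "compact K" "K \<subseteq> S" "\<And>vs x. x \<notin> K \<Longrightarrow> iter_deriv vs \<phi> x = 0"
    using test_function_support[OF assms] by metis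
  have "\<phi> x = 0" if "x \<notin> K" for x using K(3)[OF that, of "[]"] by simp
  then show ?thesis
    using that[OF K(1,2)] K(3) by (simp add: laplacian_def partial2_def del: iter_deriv.simps)
qed

section \<open>Mass and integrability of the kernels\<close>

lemma weighted_average_close:
  fixes k u :: "'a \<Rightarrow> real"
  assumes ik: "integrable M k" and k: "\<And>z. 0 \<le> k z" and iu: "integrable M (\<lambda>z. u z * k z)"
    and close: "\<And>z. k z \<noteq> 0 \<Longrightarrow> \<bar>u z - c\<bar> \<le> \<eta>"
  shows "\<bar>(LINT z|M. u z * k z) - c * (LINT z|M. k z)\<bar> \<le> \<eta> * (LINT z|M. k z)"
proof -
  have "(LINT z|M. u z * k z) - c * (LINT z|M. k z) = (LINT z|M. u z * k z - c * k z)"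
    using iu ik by simp
  also have "\<bar>\<dots>\<bar> \<le> (LINT z|M. \<bar>u z * k z - c * k z\<bar>)"
    using integral_abs_bound by blast
  also have "\<dots> \<le> (LINT z|M. \<eta> * k z)"
  proof (rule Bochner_Integration.integral_mono)
    show "integrable M (\<lambda>z. \<bar>u z * k z - c * k z\<bar>)"
      using iu ik by (intro integrable_abs Bochner_Integration.integrable_diff integrable_mult_right)
    show "integrable M (\<lambda>z. \<eta> * k z)" using ik by (intro integrable_mult_right)
    show "\<bar>u z * k z - c * k z\<bar> \<le> \<eta> * k z" for z
    proof (cases "k z = 0")
      case False
      have "\<bar>u z * k z - c * k z\<bar> = \<bar>u z - c\<bar> * k z"
        using k[of z] by (simp add: abs_mult flip: left_diff_distrib)
      then show ?thesis using close[OF False] k[of z] by (simp add: mult_right_mono)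
    qed simp
  qed
  also have "\<dots> = \<eta> * (LINT z|M. k z)" by simp
  finally show ?thesis .
qed

lemma newton_measurable [measurable]: "newton \<in> borel_measurable borel"
  unfolding newton_def by measurable

lemma kappa_measurable: "0 < \<epsilon> \<Longrightarrow> kappa \<epsilon> \<in> borel_measurable borel"
  by (intro borel_measurable_continuous_onI continuous_on_kappa)

lemma newton_reg_measurable: "0 < \<epsilon> \<Longrightarrow> newton_reg \<epsilon> \<in> borel_measurable borel"
  by (intro borel_measurable_continuous_onI continuous_on_newton_reg)

text \<open>The limit of \<open>kdiff \<epsilon> r\<close> as \<epsilon> tends to 0. The origin is
  treated apart because \<open>newton 0 = 0\<close> would give a negative value there in dimension
  at least 3.\<close>

definition kball :: "real \<Rightarrow> real ^ 'n::finite \<Rightarrow> real" where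
  "kball r x = (if x = 0 then 0 else newton x - newton_reg r x)"

lemma kball_measurable: "0 < r \<Longrightarrow> kball r \<in> borel_measurable borel"
  unfolding kball_def
  by (intro measurable_If borel_measurable_diff newton_measurable newton_reg_measurable) auto

lemma kball_even: "kball r (x - z) = kball r (z - x)"
  by (simp add: kball_def even_kernels)

lemma kball_outer: "0 < r \<Longrightarrow> r \<le> norm x \<Longrightarrow> kball r x = 0"
  by (simp add: kball_def newton_reg_outer)

lemma kdiff_eq_kball: "0 < \<epsilon> \<Longrightarrow> \<epsilon> \<le> norm x \<Longrightarrow> kdiff \<epsilon> r x = kball r x"
  by (auto simp: kball_def kdiff_def newton_reg_outer)

text \<open>The constant c of the integral equation. Mathematically it is d - 2 times the area of
  the unit sphere; the proof works with its positivity and its independence of the scale.\<close>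

definition kmass :: "(real ^ 'n::finite) itself \<Rightarrow> real" where
  "kmass _ = (LINT x|lebesgue. kappa 1 (x :: real ^ 'n))"

lemma integrable_kappa:
  assumes "0 < \<epsilon>" shows "integrable lebesgue (kappa \<epsilon> :: real ^ 'n \<Rightarrow> real)"
  by (rule continuous_support_integrable[where K = "cball 0 \<epsilon>"])
     (auto intro!: continuous_on_kappa kappa_outer assms)

lemma integral_kappa:
  assumes "0 < \<epsilon>"
  shows "(LINT x|lebesgue. kappa \<epsilon> (x :: real ^ 'n)) = kmass TYPE(real ^ 'n)"
proof -
  have "(LINT x|lebesgue. kappa \<epsilon> (x :: real ^ 'n)) =
      \<epsilon> powr (- real CARD('n)) * (LINT x|lebesgue. kappa 1 ((x :: real ^ 'n) /\<^sub>R \<epsilon>))"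
    by (simp add: kappa_scale[OF assms])
  also have "\<dots> = \<epsilon> powr (- real CARD('n)) * (\<epsilon> ^ CARD('n) * kmass TYPE(real ^ 'n))"
    unfolding kmass_def by (subst integral_scale[OF kappa_measurable[OF zero_less_one] assms]) simp
  also have "\<dots> = kmass TYPE(real ^ 'n)"
    using assms by (simp add: powr_minus powr_realpow)
  finally show ?thesis .
qed

context
  assumes dim3: "3 \<le> CARD('n::finite)"
begin

lemma kball_nonneg: "0 < r \<Longrightarrow> 0 \<le> kball r (x :: real ^ 'n)"
  using newton_reg_le[OF dim3, of r x] by (simp add: kball_def)

lemma kball_le: "0 < r \<Longrightarrow> kball r (x :: real ^ 'n) \<le> newton x"
  using newton_reg_nonneg[OF dim3, of r x] newton_nonneg[of x] by (auto simp: kball_def)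

lemma kdiff_le_kball: "0 < \<epsilon> \<Longrightarrow> 0 < r \<Longrightarrow> x \<noteq> 0 \<Longrightarrow> kdiff \<epsilon> r (x :: real ^ 'n) \<le> kball r x"
  using newton_reg_le[OF dim3, of \<epsilon> x] by (simp add: kball_def kdiff_def)

lemma kmass_pos: "0 < kmass TYPE(real ^ 'n)"
proof -
  obtain s where s: "1/4 < s" "s < 1" "0 < dstep s" using dstep_pos_ex by blast
  obtain x :: "real ^ 'n" where x: "norm x = sqrt s"
    using vector_choose_size[of "sqrt s"] s by auto
  have xx: "x \<bullet> x = s" using x s by (simp add: dot_square_norm)
  have pos: "0 < kappa 1 x"
    using s dim3 by (simp add: kappa_def rkappa_def xx)
  have "open {z. kappa 1 x / 2 < kappa 1 z}"
    by (intro open_Collect_less continuous_intros continuous_on_kappa) auto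
  then obtain e where e: "0 < e" "ball x e \<subseteq> {z. kappa 1 x / 2 < kappa 1 z}"
    using pos open_contains_ball[of "{z. kappa 1 x / 2 < kappa 1 z}"] by force
  have "0 < (kappa 1 x / 2) * measure lebesgue (ball x e)"
    using pos e content_ball_pos[of e x] by (simp add: measure_completion)
  also have "\<dots> = (LINT z|lebesgue. (kappa 1 x / 2) * indicator (ball x e) z)" by simp
  also have "\<dots> \<le> (LINT z|lebesgue. kappa 1 (z :: real ^ 'n))"
  proof (rule Bochner_Integration.integral_mono)
    show "integrable lebesgue (\<lambda>z. (kappa 1 x / 2) * indicator (ball x e) z :: real)"
      using emeasure_lborel_ball_finite by (intro integrable_mult_right integrable_real_indicator) auto
    show "integrable lebesgue (kappa 1 :: real ^ 'n \<Rightarrow> real)" by (intro integrable_kappa) simp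
    show "(kappa 1 x / 2) * indicator (ball x e) z \<le> kappa 1 z" for z :: "real ^ 'n"
      using e kappa_nonneg[OF dim3, of 1 z] by (auto simp: indicator_def less_imp_le subset_eq)
  qed
  finally show ?thesis by (simp add: kmass_def)
qed

text \<open>The volume r^d has two powers to spare over the singularity of order d - 2, so halving
  the radius gains the ratio 1/4.\<close>

lemma nn_integral_newton_ball:
  fixes a :: "real ^ 'n"
  assumes "0 < r"
  shows "(\<integral>\<^sup>+z. ennreal (newton (z - a)) * indicator (ball a r) z \<partial>lebesgue) < \<infinity>"
proof -
  let ?w = "measure lebesgue (ball (0 :: real ^ 'n) 1)" and ?p = "real CARD('n) - 2"
  have "(\<integral>\<^sup>+z. ennreal (norm (z - a) powr (- ?p)) * (1 * indicator (ball a r) z) \<partial>lebesgue)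
     \<le> ennreal ((?w * r\<^sup>2) * (1/2) powr (- ?p) / (1 - 1/4))"
  proof (rule nn_integral_theta_adic)
    fix j :: nat
    have "(1 / 2) ^ j * r \<ge> 0" using assms by simp
    define \<rho> where "\<rho> = (1 / 2) ^ j * r"
    have \<rho>: "0 < \<rho>" using assms by (simp add: \<rho>_def)
    have "(\<integral>\<^sup>+z. 1 * indicator (ball a \<rho>) z \<partial>lebesgue) = ennreal (\<rho> ^ CARD('n) * ?w)"
      using emeasure_ball_power[of \<rho> a] \<rho> by simp
    also have "\<rho> ^ CARD('n) = \<rho> powr ?p * \<rho>\<^sup>2"
      using \<rho> dim3 powr_add[of \<rho> ?p 2] by (simp add: powr_realpow powr_numeral)
    also have "\<rho>\<^sup>2 = (1 / 4) ^ j * r\<^sup>2"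
      by (simp add: \<rho>_def power_mult_distrib power2_eq_square field_simps flip: power_mult_distrib)
    finally show "(\<integral>\<^sup>+z. 1 * indicator (ball a ((1 / 2) ^ j * r)) z \<partial>lebesgue)
       \<le> ennreal (?w * r\<^sup>2 * ((1 / 2) ^ j * r) powr ?p * (1 / 4) ^ j)"
      by (simp add: \<rho>_def mult_ac)
  qed (use assms dim3 in auto)
  also have "\<dots> < \<infinity>" by simp
  finally show ?thesis by (simp add: newton_norm)
qed

lemma integrable_kball:
  assumes r: "0 < r" shows "integrable lebesgue (kball r :: real ^ 'n \<Rightarrow> real)"
proof (rule integrableI_bounded)
  show "kball r \<in> borel_measurable lebesgue" by (intro measurable_lebesgue kball_measurable r)
  have "(\<integral>\<^sup>+z. ennreal (norm (kball r (z :: real ^ 'n))) \<partial>lebesgue) \<le>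
     (\<integral>\<^sup>+z. ennreal (newton (z - 0 :: real ^ 'n)) * indicator (ball 0 r) z \<partial>lebesgue)"
  proof (rule nn_integral_mono)
    fix z :: "real ^ 'n"
    show "ennreal (norm (kball r z)) \<le> ennreal (newton (z - 0)) * indicator (ball 0 r) z"
      using kball_nonneg[OF r, of z] kball_le[OF r, of z] kball_outer[OF r, of z]
      by (cases "norm z < r") (auto simp: ennreal_leI)
  qed
  also have "\<dots> < \<infinity>" by (rule nn_integral_newton_ball[OF r])
  finally show "(\<integral>\<^sup>+z. ennreal (norm (kball r (z :: real ^ 'n))) \<partial>lebesgue) < \<infinity>" .
qed

text \<open>Near 0 the Newtonian kernel is unbounded while its flattened version stays bounded.
  Positive mass allows \<open>kball\<close>, divided by it, to act as an approximate
  identity.\<close>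

lemma kball_mass_pos:
  assumes r: "0 < r" shows "0 < (LINT x|lebesgue. kball r (x :: real ^ 'n))"
proof -
  have "compact (newton_reg r ` cball (0 :: real ^ 'n) 1)"
    by (intro compact_continuous_image continuous_on_newton_reg r compact_cball)
  then have "bounded (newton_reg r ` cball (0 :: real ^ 'n) 1)" by (rule compact_imp_bounded)
  then obtain B where "\<forall>y\<in>newton_reg r ` cball (0 :: real ^ 'n) 1. norm y \<le> B"
    unfolding bounded_iff by blast
  then have B: "\<bar>newton_reg r x\<bar> \<le> B" if "norm x \<le> 1" for x :: "real ^ 'n"
    using that by simp
  \<comment> \<open>For 0 < |x| < e one has |x|^(2-d) \<ge> 1/|x| \<ge> B + 1, the first inequality
    by |x| \<le> 1 and d \<ge> 3.\<close>
  define e where "e = min 1 (1 / (B + 1))"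
  have "0 \<le> B" using B[of 0] by simp
  then have e: "0 < e" "e \<le> 1" "e * (B + 1) \<le> 1" by (auto simp: e_def min_def field_simps)
  have low: "1 \<le> kball r x" if "x \<noteq> 0" "norm x < e" for x :: "real ^ 'n"
  proof -
    have nx: "0 < norm x" "norm x \<le> 1" using that e by auto
    have "norm x powr (-1) \<le> norm x powr (2 - real CARD('n))"
      using nx dim3 by (intro powr_mono') auto
    moreover have "B + 1 \<le> norm x powr (-1)"
    proof -
      have "norm x * (B + 1) \<le> e * (B + 1)" using that \<open>0 \<le> B\<close> by (intro mult_right_mono) auto
      then have "norm x * (B + 1) \<le> 1" using e by linarith
      then show ?thesis using nx by (simp add: powr_minus_divide field_simps)
    qed
    ultimately show ?thesis using B[OF nx(2)] that by (simp add: kball_def newton_norm)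
  qed
  have "0 < measure lebesgue (ball (0 :: real ^ 'n) e)"
    using e content_ball_pos[of e "0 :: real ^ 'n"] by (simp add: measure_completion)
  also have "\<dots> = (LINT z|lebesgue. indicator (ball (0 :: real ^ 'n) e) z)" by simp
  also have "\<dots> \<le> (LINT z|lebesgue. kball r (z :: real ^ 'n))"
  proof (rule Bochner_Integration.integral_mono_AE)
    show "integrable lebesgue (\<lambda>z. indicator (ball (0 :: real ^ 'n) e) z :: real)"
      using emeasure_lborel_ball_finite by (intro integrable_real_indicator) auto
    have "AE z in lebesgue. z \<noteq> (0 :: real ^ 'n)"
      using AE_lborel_singleton by (rule AE_completion)
    then show "AE z in lebesgue. indicator (ball (0 :: real ^ 'n) e) z \<le> kball r z"
      by eventually_elim (use low kball_nonneg[OF r] in \<open>auto simp: indicator_def\<close>)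
  qed (rule integrable_kball[OF r])
  finally show ?thesis .
qed

lemma kappa_average_close:
  fixes u :: "real ^ 'n \<Rightarrow> real"
  assumes u: "locally_integrable_on u UNIV" and \<epsilon>: "0 < \<epsilon>"
    and close: "\<And>z. \<epsilon> / 2 < norm (x - z) \<Longrightarrow> norm (x - z) < \<epsilon> \<Longrightarrow> \<bar>u z - c\<bar> \<le> \<eta>"
  shows "\<bar>(LINT z|lebesgue. u z * kappa \<epsilon> (x - z)) - c * kmass TYPE(real ^ 'n)\<bar> \<le> \<eta> * kmass TYPE(real ^ 'n)"
proof -
  let ?k = "\<lambda>z. kappa \<epsilon> (x - z)"
  have ik: "integrable lebesgue ?k" and mk: "(LINT z|lebesgue. ?k z) = kmass TYPE(real ^ 'n)"
    using integrable_kappa[OF \<epsilon>, where 'n = 'n] integral_kappa[OF \<epsilon>, where 'n = 'n]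
      integrable_reflect[OF kappa_measurable[OF \<epsilon>], of x] integral_reflect[OF kappa_measurable[OF \<epsilon>], of x]
    by simp_all
  have "continuous_on UNIV ?k"
    by (rule continuous_on_compose2[OF continuous_on_kappa[OF \<epsilon>, of UNIV]]) (auto intro!: continuous_intros)
  moreover have out: "?k z = 0" if "z \<notin> cball x \<epsilon>" for z
    using that by (intro kappa_outer \<epsilon>) (simp add: dist_norm)
  ultimately obtain B where B: "\<And>z. \<bar>?k z\<bar> \<le> B"
    using continuous_support_bounded[of ?k "cball x \<epsilon>"] compact_cball by metis
  have iu: "integrable lebesgue (\<lambda>z. u z * ?k z)"
    by (rule locally_integrable_mult[OF u, where B = B and K = "cball x \<epsilon>"])
       (use ik B out in \<open>auto simp del: mem_cball\<close>)
  have "\<bar>u z - c\<bar> \<le> \<eta>" if "?k z \<noteq> 0" for z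
    using that close[of z] kappa_outer[OF \<epsilon>, of "x - z"] kappa_inner[OF \<epsilon>, of "x - z"] by force
  with weighted_average_close[OF ik kappa_nonneg[OF dim3] iu] show ?thesis by (simp add: mk)
qed

end

section \<open>Limits of kernel averages\<close>

lemma locally_integrable_mult_continuous:
  fixes u :: "'a::euclidean_space \<Rightarrow> real"
  assumes u: "locally_integrable_on u UNIV" and k: "continuous_on UNIV k" and K: "\<And>z. z \<notin> K \<Longrightarrow> k z = 0" "compact K"
  shows "integrable lebesgue (\<lambda>z. u z * k z)"
proof -
  obtain B where "\<And>z. \<bar>k z\<bar> \<le> B" using continuous_support_bounded[OF k K] by metis
  moreover have "k \<in> borel_measurable lebesgue"
    using k by (intro measurable_lebesgue borel_measurable_continuous_onI)
  ultimately show ?thesis using locally_integrable_mult[OF u, of k B K] K by blast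
qed

lemma continuous_locally_integrable:
  fixes f :: "'a::euclidean_space \<Rightarrow> real"
  assumes "continuous_on UNIV f"
  shows "locally_integrable_on f UNIV"
  unfolding locally_integrable_on_def set_integrable_def
proof (intro allI impI)
  fix K :: "'a set" assume "compact K \<and> K \<subseteq> UNIV"
  then have K: "integrable lborel (\<lambda>x. indicator K x *\<^sub>R f x)"
    using assms continuous_on_subset by (intro borel_integrable_compact) auto
  then show "integrable lebesgue (\<lambda>x. indicator K x *\<^sub>R f x)"
    using integrable_completion[of "\<lambda>x. indicator K x *\<^sub>R f x" lborel] by auto
qed

lemma integrable_mult_kappa:
  assumes u: "locally_integrable_on u UNIV" and \<epsilon>: "0 < \<epsilon>"
  shows "integrable lebesgue (\<lambda>z. u z * kappa \<epsilon> (x - z))"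
proof (rule locally_integrable_mult_continuous[OF u _ _ compact_cball[of x \<epsilon>]])
  show "continuous_on UNIV (\<lambda>z. kappa \<epsilon> (x - z))"
    by (rule continuous_on_compose2[OF continuous_on_kappa[OF \<epsilon>, of UNIV]]) (auto intro!: continuous_intros)
  fix z assume "z \<notin> cball x \<epsilon>"
  then show "kappa \<epsilon> (x - z) = 0" by (intro kappa_outer \<epsilon>) (simp add: dist_norm)
qed

lemma integrable_mult_kdiff:
  assumes u: "locally_integrable_on u UNIV" and \<epsilon>: "0 < \<epsilon>" "\<epsilon> \<le> r"
  shows "integrable lebesgue (\<lambda>z. u z * kdiff \<epsilon> r (x - z))"
proof (rule locally_integrable_mult_continuous[OF u _ _ compact_cball[of x r]])
  have "0 < r" using \<epsilon> by simp
  then show "continuous_on UNIV (\<lambda>z. kdiff \<epsilon> r (x - z))"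
    by (intro continuous_on_compose2[OF continuous_on_kdiff[OF \<epsilon>(1), of r UNIV]]) (auto intro!: continuous_intros)
  fix z assume "z \<notin> cball x r"
  then show "kdiff \<epsilon> r (x - z) = 0" by (intro kdiff_outer \<epsilon>) (simp add: dist_norm)
qed

lemma kdiff_limit_pointwise:
  assumes e: "\<And>n. 0 < e n" "e \<longlonglongrightarrow> 0" and x: "x \<noteq> 0"
  shows "(\<lambda>n. kdiff (e n) r x) \<longlonglongrightarrow> kball r x"
proof (rule tendsto_eventually)
  have "0 < norm x" using x by simp
  then have "\<forall>\<^sub>F n in sequentially. e n < norm x" using e(2) by (rule order_tendstoD(2)[rotated])
  then show "\<forall>\<^sub>F n in sequentially. kdiff (e n) r x = kball r x"
    by eventually_elim (simp add: kdiff_eq_kball e)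
qed

lemma AE_lebesgue_neq: "AE z in lebesgue. z \<noteq> (a :: 'a::euclidean_space)"
  using AE_lborel_singleton[of a] by (rule AE_completion)

context
  assumes dim3: "3 \<le> CARD('n::finite)"
begin

lemma kappa_limit:
  fixes u :: "real ^ 'n \<Rightarrow> real"
  assumes u: "locally_integrable_on u UNIV" and x: "isCont u x" and e: "\<And>n. 0 < e n" "e \<longlonglongrightarrow> 0"
  shows "(\<lambda>n. LINT z|lebesgue. u z * kappa (e n) (x - z)) \<longlonglongrightarrow> u x * kmass TYPE(real ^ 'n)"
proof (rule tendstoI)
  fix \<eta> :: real assume \<eta>: "0 < \<eta>"
  define m where "m = kmass TYPE(real ^ 'n)"
  have m: "0 < m" using kmass_pos[OF dim3] by (simp add: m_def)
  have "0 < \<eta> / (2 * m)" using \<eta> m by simp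
  then obtain d where d: "0 < d" "\<And>z. dist z x < d \<Longrightarrow> dist (u z) (u x) < \<eta> / (2 * m)"
    using x[unfolded continuous_at_eps_delta] by metis
  have "\<forall>\<^sub>F n in sequentially. e n < d" using e(2) d(1) by (rule order_tendstoD(2))
  then show "\<forall>\<^sub>F n in sequentially. dist (LINT z|lebesgue. u z * kappa (e n) (x - z)) (u x * kmass TYPE(real ^ 'n)) < \<eta>"
  proof eventually_elim
    fix n assume n: "e n < d"
    have "\<bar>(LINT z|lebesgue. u z * kappa (e n) (x - z)) - u x * m\<bar> \<le> \<eta> / (2 * m) * m"
      unfolding m_def
    proof (rule kappa_average_close[OF dim3 u e(1)])
      fix z assume "norm (x - z) < e n"
      then have "dist z x < d" using n by (simp add: dist_norm norm_minus_commute)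
      then show "\<bar>u z - u x\<bar> \<le> \<eta> / (2 * kmass TYPE(real ^ 'n))"
        using d(2)[of z] by (simp add: dist_real_def m_def)
    qed
    also have "\<dots> < \<eta>" using m \<eta> by simp
    finally show "dist (LINT z|lebesgue. u z * kappa (e n) (x - z)) (u x * kmass TYPE(real ^ 'n)) < \<eta>"
      by (simp add: dist_real_def m_def)
  qed
qed

text \<open>The shell R/2 < |x - z| < R leaves every bounded set as R grows, so decay of
  \<open>u\<close> decides the limit whatever its local singularities.\<close>

lemma kappa_limit_at_infinity:
  fixes u :: "real ^ 'n \<Rightarrow> real"
  assumes u: "locally_integrable_on u UNIV" and lim: "(u \<longlongrightarrow> 0) at_infinity"
  shows "((\<lambda>R. LINT z|lebesgue. u z * kappa R (x - z)) \<longlongrightarrow> 0) at_top"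
proof (rule tendstoI)
  fix \<eta> :: real assume \<eta>: "0 < \<eta>"
  define m where "m = kmass TYPE(real ^ 'n)"
  have m: "0 < m" using kmass_pos[OF dim3] by (simp add: m_def)
  have "0 < \<eta> / (2 * m)" using \<eta> m by simp
  with lim have "\<forall>\<^sub>F z in at_infinity. dist (u z) 0 < \<eta> / (2 * m)" by (rule tendstoD)
  then obtain b where b: "\<And>z. b \<le> norm z \<Longrightarrow> dist (u z) 0 < \<eta> / (2 * m)"
    unfolding eventually_at_infinity by blast
  show "\<forall>\<^sub>F R in at_top. dist (LINT z|lebesgue. u z * kappa R (x - z)) 0 < \<eta>"
    using eventually_gt_at_top[of "max 0 (2 * (b + norm x))"]
  proof eventually_elim
    fix R :: real assume R: "max 0 (2 * (b + norm x)) < R"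
    have "\<bar>(LINT z|lebesgue. u z * kappa R (x - z)) - 0 * m\<bar> \<le> \<eta> / (2 * m) * m"
      unfolding m_def
    proof (rule kappa_average_close[OF dim3 u])
      fix z assume "R / 2 < norm (x - z)"
      moreover have "norm (x - z) \<le> norm x + norm z" by (rule norm_triangle_ineq4)
      moreover have "2 * (b + norm x) < R" using R by simp
      ultimately have "b \<le> norm z" by (simp add: algebra_simps)
      then show "\<bar>u z - 0\<bar> \<le> \<eta> / (2 * kmass TYPE(real ^ 'n))"
        using b[of z] by (simp add: dist_real_def m_def)
    qed (use R in simp)
    also have "\<dots> < \<eta>" using m \<eta> by simp
    finally show "dist (LINT z|lebesgue. u z * kappa R (x - z)) 0 < \<eta>"
      by (simp add: dist_real_def)
  qed
qed

lemma kdiff_limit: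
  fixes h :: "real ^ 'n \<Rightarrow> real"
  assumes h: "h \<in> borel_measurable lebesgue" and hi: "integrable lebesgue (\<lambda>z. h z * kball r (x - z))"
    and r: "0 < r" and e: "\<And>n. 0 < e n" "\<And>n. e n \<le> r" "e \<longlonglongrightarrow> 0"
  shows "(\<lambda>n. LINT z|lebesgue. h z * kdiff (e n) r (x - z)) \<longlonglongrightarrow> (LINT z|lebesgue. h z * kball r (x - z))"
proof (rule integral_dominated_convergence)
  show "integrable lebesgue (\<lambda>z. \<bar>h z * kball r (x - z)\<bar>)" using hi by (rule integrable_abs)
  show "AE z in lebesgue. (\<lambda>n. h z * kdiff (e n) r (x - z)) \<longlonglongrightarrow> h z * kball r (x - z)"
    using AE_lebesgue_neq[of x]
    by eventually_elim (intro tendsto_mult tendsto_const kdiff_limit_pointwise e, auto)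
  show "AE z in lebesgue. norm (h z * kdiff (e n) r (x - z)) \<le> \<bar>h z * kball r (x - z)\<bar>" for n
    using AE_lebesgue_neq[of x]
  proof eventually_elim
    fix z assume "z \<noteq> x"
    then have "\<bar>kdiff (e n) r (x - z)\<bar> \<le> \<bar>kball r (x - z)\<bar>"
      using kdiff_le_kball[OF dim3 e(1) r, of "x - z" n] kdiff_nonneg[OF dim3 e(1,2), of n "x - z"] by simp
    then show "norm (h z * kdiff (e n) r (x - z)) \<le> \<bar>h z * kball r (x - z)\<bar>"
      by (simp add: abs_mult mult_left_mono)
  qed
  show "(\<lambda>z. h z * kball r (x - z)) \<in> borel_measurable lebesgue" using hi by simp
  have "(\<lambda>z. kdiff (e n) r (x - z)) \<in> borel_measurable borel" for n
    by (intro borel_measurable_continuous_onI continuous_on_compose2[OF continuous_on_kdiff[OF e(1) r, of UNIV]])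
       (auto intro!: continuous_intros)
  then show "(\<lambda>z. h z * kdiff (e n) r (x - z)) \<in> borel_measurable lebesgue" for n
    by (intro borel_measurable_times h measurable_lebesgue)
qed

text \<open>Move the Laplacian from \<phi> to \<open>kdiff\<close> and let the inner scale shrink,
  so that the inner average becomes \<phi> z times the mass. The identity converts an average minus
  a value, the discrete Laplacian in the proof of Kato's inequality, back into
  \<open>laplacian \<phi>\<close>.\<close>

lemma kappa_average_test_function:
  fixes \<phi> :: "real ^ 'n \<Rightarrow> real"
  assumes \<phi>: "test_function UNIV \<phi>" and r: "0 < r"
  shows "(LINT x|lebesgue. \<phi> x * kappa r (x - z)) - \<phi> z * kmass TYPE(real ^ 'n)
       = (LINT x|lebesgue. laplacian \<phi> x * kball r (x - z))"
proof -
  define e where "e n = r * inverse (real (Suc n))" for n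
  have e: "0 < e n" "e n \<le> r" for n using r by (auto simp: e_def field_simps)
  have e0: "e \<longlonglongrightarrow> 0"
    unfolding e_def using tendsto_mult[OF tendsto_const LIMSEQ_inverse_real_of_nat, of r] by simp
  note s\<phi> = test_function_smooth[OF \<phi>]
  obtain K where K: "compact K" "\<And>x. x \<notin> K \<Longrightarrow> \<phi> x = 0" "\<And>x. x \<notin> K \<Longrightarrow> laplacian \<phi> x = 0"
    using test_function_laplacian_support[OF \<phi>] by metis
  have c\<phi>: "continuous_on UNIV \<phi>" using smooth_continuous_on[OF s\<phi>, of UNIV "[]"] by simp
  have cL: "continuous_on UNIV (laplacian \<phi>)" by (rule continuous_on_laplacian[OF s\<phi>])
  have loc: "locally_integrable_on \<phi> UNIV"
    by (rule continuous_locally_integrable[OF c\<phi>])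
  have ev: "kappa \<epsilon> (x - z) = kappa \<epsilon> (z - x)" "kdiff \<epsilon> r (x - z) = kdiff \<epsilon> r (z - x)"
    "kball r (x - z) = kball r (z - x)" for \<epsilon> x
    by (rule even_kernels kball_even)+
  have id: "(LINT x|lebesgue. \<phi> x * kappa r (x - z)) - (LINT x|lebesgue. \<phi> x * kappa (e n) (z - x))
      = (LINT x|lebesgue. laplacian \<phi> x * kdiff (e n) r (z - x))" for n
  proof -
    have "(LINT x|lebesgue. laplacian \<phi> x * kdiff (e n) r (x - z)) =
        (LINT x|lebesgue. \<phi> x * laplacian (\<lambda>x. kdiff (e n) r (x - z)) x)"
      by (rule integral_laplacian[OF s\<phi> test_function_kdiff[OF e subset_UNIV], symmetric])
    also have "\<dots> = (LINT x|lebesgue. \<phi> x * kappa r (z - x) - \<phi> x * kappa (e n) (z - x))"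
      by (simp only: laplacian_kdiff[OF e] right_diff_distrib) (simp only: ev)
    also have "\<dots> = (LINT x|lebesgue. \<phi> x * kappa r (z - x)) - (LINT x|lebesgue. \<phi> x * kappa (e n) (z - x))"
      by (rule Bochner_Integration.integral_diff; rule integrable_mult_kappa[OF loc]; rule e r)
    finally show ?thesis by (simp only: ev)
  qed
  have 1: "(\<lambda>n. (LINT x|lebesgue. \<phi> x * kappa r (x - z)) - (LINT x|lebesgue. \<phi> x * kappa (e n) (z - x)))
      \<longlonglongrightarrow> (LINT x|lebesgue. \<phi> x * kappa r (x - z)) - \<phi> z * kmass TYPE(real ^ 'n)"
    using c\<phi> by (intro tendsto_diff tendsto_const kappa_limit[OF loc _ e(1) e0])
      (simp add: continuous_on_eq_continuous_at)
  obtain B where B: "\<And>x. \<bar>laplacian \<phi> x\<bar> \<le> B" using continuous_support_bounded[OF cL K(3,1)] by metis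
  have "integrable lebesgue (\<lambda>x. kball r (z - x) * laplacian \<phi> x)"
  proof (rule Bochner_Integration.integrable_bound)
    have ik: "integrable lebesgue (\<lambda>x. kball r (z - x))"
      using integrable_reflect[OF kball_measurable[OF r], of z] integrable_kball[OF dim3 r] by blast
    then show "integrable lebesgue (\<lambda>x. B * kball r (z - x))" by (rule integrable_mult_right)
    show "(\<lambda>x. kball r (z - x) * laplacian \<phi> x) \<in> borel_measurable lebesgue"
      by (intro borel_measurable_times borel_measurable_integrable[OF ik]
          measurable_lebesgue[OF borel_measurable_continuous_onI[OF cL]])
    have "\<bar>kball r (z - x)\<bar> * \<bar>laplacian \<phi> x\<bar> \<le> \<bar>kball r (z - x)\<bar> * \<bar>B\<bar>" for x
      using B[of x] by (intro mult_left_mono) auto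
    then show "AE x in lebesgue. norm (kball r (z - x) * laplacian \<phi> x) \<le> norm (B * kball r (z - x))"
      by (intro AE_I2) (simp add: abs_mult mult.commute)
  qed
  then have "(\<lambda>n. LINT x|lebesgue. laplacian \<phi> x * kdiff (e n) r (z - x))
      \<longlonglongrightarrow> (LINT x|lebesgue. laplacian \<phi> x * kball r (z - x))"
    using cL by (intro kdiff_limit r e e0 measurable_lebesgue borel_measurable_continuous_onI)
      (simp_all add: mult.commute)
  from LIMSEQ_unique[OF 1[unfolded id] this] show ?thesis by (simp only: ev)
qed

text \<open>A maximum principle at infinity. Testing with \<open>kdiff\<close> shows that the shell
  averages around \<open>x\<close> increase with the radius. They tend to 0 at infinity, so all are
  nonpositive, and at small radii they tend to a positive multiple of \<open>u x\<close>.\<close>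

lemma subharmonic_nonpos:
  fixes u :: "real ^ 'n \<Rightarrow> real"
  assumes u: "locally_integrable_on u UNIV" and lim: "(u \<longlongrightarrow> 0) at_infinity" and x: "isCont u x"
    and sub: "\<And>\<phi>. test_function UNIV \<phi> \<Longrightarrow> (\<And>z. 0 \<le> \<phi> z) \<Longrightarrow> 0 \<le> (LINT z|lebesgue. u z * laplacian \<phi> z)"
  shows "u x \<le> 0"
proof -
  define m where "m = kmass TYPE(real ^ 'n)"
  have m: "0 < m" using kmass_pos[OF dim3] by (simp add: m_def)
  have mono: "(LINT z|lebesgue. u z * kappa \<epsilon> (x - z)) \<le> (LINT z|lebesgue. u z * kappa R (x - z))"
    if "0 < \<epsilon>" "\<epsilon> \<le> R" for \<epsilon> R
  proof -
    have "0 \<le> (LINT z|lebesgue. u z * laplacian (\<lambda>z. kdiff \<epsilon> R (z - x)) z)"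
      using that by (intro sub test_function_kdiff kdiff_nonneg[OF dim3]) auto
    also have "\<dots> = (LINT z|lebesgue. u z * kappa R (x - z) - u z * kappa \<epsilon> (x - z))"
      by (simp only: laplacian_kdiff[OF that] right_diff_distrib) (simp only: even_kernels(3)[of _ _ x])
    also have "\<dots> = (LINT z|lebesgue. u z * kappa R (x - z)) - (LINT z|lebesgue. u z * kappa \<epsilon> (x - z))"
      by (rule Bochner_Integration.integral_diff; rule integrable_mult_kappa[OF u]) (use that in auto)
    finally show ?thesis by simp
  qed
  have le0: "(LINT z|lebesgue. u z * kappa \<epsilon> (x - z)) \<le> 0" if "0 < \<epsilon>" for \<epsilon>
  proof (rule tendsto_lowerbound[OF kappa_limit_at_infinity[OF u lim, of x]])
    show "\<forall>\<^sub>F R in at_top. (LINT z|lebesgue. u z * kappa \<epsilon> (x - z)) \<le> (LINT z|lebesgue. u z * kappa R (x - z))"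
      using eventually_ge_at_top[of \<epsilon>] by eventually_elim (rule mono[OF that])
  qed simp
  have "(\<lambda>n. LINT z|lebesgue. u z * kappa (inverse (real (Suc n))) (x - z)) \<longlonglongrightarrow> u x * m"
    unfolding m_def by (rule kappa_limit[OF u x _ LIMSEQ_inverse_real_of_nat]) simp
  then have "u x * m \<le> 0"
    by (rule tendsto_upperbound) (auto intro!: always_eventually le0)
  then show ?thesis using m by (simp add: mult_le_0_iff)
qed

end

section \<open>Kato's inequality\<close>

lemma locally_integrable_max0:
  fixes u :: "'a::euclidean_space \<Rightarrow> real"
  assumes "locally_integrable_on u S"
  shows "locally_integrable_on (\<lambda>z. max (u z) 0) S"
  unfolding locally_integrable_on_def set_integrable_def
proof (intro allI impI)
  fix K assume "compact K \<and> K \<subseteq> S"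
  then have "integrable lebesgue (\<lambda>x. max (indicator K x *\<^sub>R u x) 0)"
    using locally_integrable_onD[OF assms] by (intro Bochner_Integration.integrable_max integrable_zero) auto
  moreover have "max (indicator K x *\<^sub>R u x) 0 = indicator K x *\<^sub>R max (u x) 0" for x
    by (simp add: indicator_def)
  ultimately show "integrable lebesgue (\<lambda>x. indicator K x *\<^sub>R max (u x) 0)" by simp
qed

context
  assumes dim3: "3 \<le> CARD('n::finite)"
begin

lemma integrable_mult_kball:
  fixes g :: "real ^ 'n \<Rightarrow> real"
  assumes g: "g \<in> borel_measurable lebesgue" and B: "\<And>x. \<bar>g x\<bar> \<le> B" and r: "0 < r"
  shows "integrable lebesgue (\<lambda>x. g x * kball r (x - z))"
    and "integrable lebesgue (\<lambda>x. kball r (x - z))"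
    and "(LINT x|lebesgue. kball r (x - z)) = (LINT x|lebesgue. kball r (x :: real ^ 'n))"
proof -
  have "integrable lebesgue (\<lambda>x. kball r (z - x))"
    by (rule integrable_reflect[OF kball_measurable[OF r], THEN iffD2, OF integrable_kball[OF dim3 r]])
  moreover have "(LINT x|lebesgue. kball r (z - x)) = (LINT x|lebesgue. kball r (x :: real ^ 'n))"
    by (rule integral_reflect[OF kball_measurable[OF r]])
  ultimately show ik: "integrable lebesgue (\<lambda>x. kball r (x - z))"
    and "(LINT x|lebesgue. kball r (x - z)) = (LINT x|lebesgue. kball r (x :: real ^ 'n))"
    by (simp_all only: kball_even[of r z])
  show "integrable lebesgue (\<lambda>x. g x * kball r (x - z))"
  proof (rule Bochner_Integration.integrable_bound)
    show "integrable lebesgue (\<lambda>x. B * kball r (x - z))" using ik by (rule integrable_mult_right)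
    show "(\<lambda>x. g x * kball r (x - z)) \<in> borel_measurable lebesgue"
      by (intro borel_measurable_times g borel_measurable_integrable[OF ik])
    show "AE x in lebesgue. norm (g x * kball r (x - z)) \<le> norm (B * kball r (x - z))"
    proof (intro AE_I2)
      fix x
      have "\<bar>g x\<bar> * \<bar>kball r (x - z)\<bar> \<le> \<bar>B\<bar> * \<bar>kball r (x - z)\<bar>"
        using B[of x] by (intro mult_right_mono) auto
      then show "norm (g x * kball r (x - z)) \<le> norm (B * kball r (x - z))" by (simp add: abs_mult)
    qed
  qed
qed

lemma kball_average_bound:
  fixes g :: "real ^ 'n \<Rightarrow> real"
  assumes g: "g \<in> borel_measurable lebesgue" and B: "\<And>x. \<bar>g x\<bar> \<le> B" and r: "0 < r"
    and close: "\<And>x. norm (x - z) < r \<Longrightarrow> \<bar>g x - c\<bar> \<le> \<eta>"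
  shows "\<bar>(LINT x|lebesgue. g x * kball r (x - z)) / (LINT x|lebesgue. kball r (x :: real ^ 'n)) - c\<bar> \<le> \<eta>"
proof -
  let ?c = "LINT x|lebesgue. kball r (x :: real ^ 'n)"
  have c: "0 < ?c" by (rule kball_mass_pos[OF dim3 r])
  note i = integrable_mult_kball[OF g B r, of z]
  have "\<bar>g x - c\<bar> \<le> \<eta>" if "kball r (x - z) \<noteq> 0" for x
    using that close[of x] kball_outer[OF r, of "x - z"] by force
  then have "\<bar>(LINT x|lebesgue. g x * kball r (x - z)) - c * ?c\<bar> \<le> \<eta> * ?c"
    using weighted_average_close[OF i(2) kball_nonneg[OF dim3 r] i(1)] i(3) by simp
  moreover have "(LINT x|lebesgue. g x * kball r (x - z)) / ?c - c = ((LINT x|lebesgue. g x * kball r (x - z)) - c * ?c) / ?c"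
    using c by (simp add: field_simps)
  ultimately show ?thesis using c by (simp add: divide_le_eq)
qed

lemma kball_average_limit:
  fixes g :: "real ^ 'n \<Rightarrow> real"
  assumes g: "g \<in> borel_measurable lebesgue" and B: "\<And>x. \<bar>g x\<bar> \<le> B" and z: "isCont g z"
  shows "(\<lambda>n. (LINT x|lebesgue. g x * kball (inverse (real (Suc n))) (x - z))
    / (LINT x|lebesgue. kball (inverse (real (Suc n))) (x :: real ^ 'n))) \<longlonglongrightarrow> g z"
proof (rule tendstoI)
  fix \<eta> :: real assume \<eta>: "0 < \<eta>"
  then have "0 < \<eta> / 2" by simp
  then obtain d where d: "0 < d" "\<And>x. dist x z < d \<Longrightarrow> dist (g x) (g z) < \<eta> / 2"
    using z[unfolded continuous_at_eps_delta] by metis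
  have "\<forall>\<^sub>F n in sequentially. inverse (real (Suc n)) < d"
    using LIMSEQ_inverse_real_of_nat d(1) by (rule order_tendstoD(2))
  then show "\<forall>\<^sub>F n in sequentially. dist ((LINT x|lebesgue. g x * kball (inverse (real (Suc n))) (x - z))
    / (LINT x|lebesgue. kball (inverse (real (Suc n))) (x :: real ^ 'n))) (g z) < \<eta>"
  proof eventually_elim
    fix n assume n: "inverse (real (Suc n)) < d"
    have "\<bar>(LINT x|lebesgue. g x * kball (inverse (real (Suc n))) (x - z))
      / (LINT x|lebesgue. kball (inverse (real (Suc n))) (x :: real ^ 'n)) - g z\<bar> \<le> \<eta> / 2"
    proof (rule kball_average_bound[OF g B])
      fix x assume "norm (x - z) < inverse (real (Suc n))"
      then have "dist x z < d" using n by (simp only: dist_norm)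
      then show "\<bar>g x - g z\<bar> \<le> \<eta> / 2" using d(2)[of x] by (simp add: dist_real_def)
    qed simp
    then show "dist ((LINT x|lebesgue. g x * kball (inverse (real (Suc n))) (x - z))
      / (LINT x|lebesgue. kball (inverse (real (Suc n))) (x :: real ^ 'n))) (g z) < \<eta>"
      using \<eta> by (simp only: dist_real_def)
  qed
qed

text \<open>Divided by its mass, \<open>kball\<close> is an approximate identity. Continuity of
  \<open>g\<close> is asked only where \<open>h\<close> is nonzero: in the application
  \<open>g\<close> contains the indicator of {u > 0}, whose jumps lie on {u = 0}, and there
  \<open>h = c u\<close> vanishes.\<close>

lemma kball_mollify_limit:
  fixes g h :: "real ^ 'n \<Rightarrow> real"
  assumes h: "locally_integrable_on h UNIV" and g: "g \<in> borel_measurable lebesgue"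
    and B: "\<And>x. \<bar>g x\<bar> \<le> B" and R: "\<forall>x. x \<notin> cball 0 R \<longrightarrow> g x = 0"
    and cont: "AE z in lebesgue. h z \<noteq> 0 \<longrightarrow> isCont g z"
  shows "(\<lambda>n. (LINT z|lebesgue. h z * (LINT x|lebesgue. g x * kball (inverse (real (Suc n))) (x - z)))
    / (LINT x|lebesgue. kball (inverse (real (Suc n))) (x :: real ^ 'n))) \<longlonglongrightarrow> (LINT z|lebesgue. h z * g z)"
proof -
  define r where "r n = inverse (real (Suc n))" for n
  have r: "0 < r n" "r n \<le> 1" for n by (auto simp: r_def inverse_le_1_iff)
  let ?c = "\<lambda>n. LINT x|lebesgue. kball (r n) (x :: real ^ 'n)"
  let ?a = "\<lambda>n z. (LINT x|lebesgue. g x * kball (r n) (x - z)) / ?c n"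
  have int: "integrable lebesgue (\<lambda>z. h z * (LINT x|lebesgue. g x * kball (r n) (x - z)))" for n
    by (rule kernel_Fubini(3)[OF h g B R kball_measurable[OF r(1)] integrable_kball[OF dim3 r(1)], where r = "r n"])
       (use kball_outer[OF r(1)] in blast)
  have "(\<lambda>n. LINT z|lebesgue. h z * ?a n z) \<longlonglongrightarrow> (LINT z|lebesgue. h z * g z)"
  proof (rule integral_dominated_convergence)
    have "integrable lebesgue (\<lambda>z. indicator (cball 0 (R + 1)) z *\<^sub>R h z)"
      by (rule locally_integrable_onD[OF h]) auto
    then show "integrable lebesgue (\<lambda>z. B * \<bar>indicator (cball 0 (R + 1)) z *\<^sub>R h z\<bar>)"
      by (intro integrable_mult_right integrable_abs)
    show "AE z in lebesgue. (\<lambda>n. h z * ?a n z) \<longlonglongrightarrow> h z * g z"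
      using cont
    proof eventually_elim
      fix z assume z: "h z \<noteq> 0 \<longrightarrow> isCont g z"
      show "(\<lambda>n. h z * ?a n z) \<longlonglongrightarrow> h z * g z"
      proof (cases "h z = 0")
        case False
        then show ?thesis using z unfolding r_def
          by (intro tendsto_mult tendsto_const kball_average_limit[OF g B]) auto
      qed simp
    qed
    show "AE z in lebesgue. norm (h z * ?a n z) \<le> B * \<bar>indicator (cball 0 (R + 1)) z *\<^sub>R h z\<bar>" for n
    proof (intro AE_I2)
      fix z
      show "norm (h z * ?a n z) \<le> B * \<bar>indicator (cball 0 (R + 1)) z *\<^sub>R h z\<bar>"
      proof (cases "z \<in> cball 0 (R + 1)")
        case True
        have "\<bar>?a n z - 0\<bar> \<le> B" by (rule kball_average_bound[OF g B r(1)]) (use B in simp)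
        then have "\<bar>h z\<bar> * \<bar>?a n z\<bar> \<le> \<bar>h z\<bar> * B" by (intro mult_left_mono) auto
        then show ?thesis using True by (simp add: abs_mult mult.commute)
      next
        case False
        have "g x * kball (r n) (x - z) = 0" for x
        proof (cases "x \<in> cball 0 R")
          case True
          have "norm z \<le> norm x + norm (x - z)" using norm_triangle_ineq4[of x "x - z"] by simp
          then have "r n \<le> norm (x - z)" using True False r(2)[of n] by simp
          then show ?thesis by (simp add: kball_outer r)
        qed (simp add: R)
        then have "(\<lambda>x. g x * kball (r n) (x - z)) = (\<lambda>_. 0)" by blast
        then show ?thesis using False by simp
      qed
    qed
    show "(\<lambda>z. h z * g z) \<in> borel_measurable lebesgue"
      by (intro borel_measurable_times g locally_integrable_measurable h)
    show "(\<lambda>z. h z * ?a n z) \<in> borel_measurable lebesgue" for n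
      using borel_measurable_divide[OF borel_measurable_integrable[OF int[of n]] borel_measurable_const[of "?c n"]]
      by simp
  qed
  then show ?thesis by (simp add: r_def)
qed

text \<open>Hypothesis \<open>ineq\<close> is c u \<le> \<Delta>u tested against
  \<open>kdiff\<close> only. It passes to the positive part of \<open>u\<close> because averaging is
  monotone; the positive part is then subharmonic and \<open>subharmonic_nonpos\<close>
  applies.\<close>

lemma kato_nonpos:
  fixes u c :: "real ^ 'n \<Rightarrow> real"
  assumes u: "locally_integrable_on u UNIV" and f: "locally_integrable_on (\<lambda>z. c z * u z) UNIV"
    and c: "AE z in lebesgue. 0 \<le> c z" and cont: "\<And>x. x \<noteq> y \<Longrightarrow> isCont u x"
    and lim: "(u \<longlongrightarrow> 0) at_infinity"
    and ineq: "\<And>x \<epsilon> r. 0 < \<epsilon> \<Longrightarrow> \<epsilon> \<le> r \<Longrightarrow> (LINT z|lebesgue. (c z * u z) * kdiff \<epsilon> r (x - z))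
      \<le> (LINT z|lebesgue. u z * kappa r (x - z)) - (LINT z|lebesgue. u z * kappa \<epsilon> (x - z))"
    and x: "x \<noteq> y"
  shows "u x \<le> 0"
proof -
  define v where "v z = max (u z) 0" for z
  define F where "F z = c z * u z" for z
  define P :: "real ^ 'n \<Rightarrow> real" where "P z = indicator {z. 0 < u z} z" for z
  define m where "m = kmass TYPE(real ^ 'n)"
  have v: "locally_integrable_on v UNIV" unfolding v_def by (rule locally_integrable_max0[OF u])
  have F: "locally_integrable_on F UNIV" unfolding F_def by (rule f)
  have um: "u \<in> borel_measurable lebesgue" by (rule locally_integrable_measurable[OF u])
  have P: "P \<in> borel_measurable lebesgue"
    unfolding P_def using um by simp
  have "v x \<le> 0"
  proof (rule subharmonic_nonpos[OF dim3 v])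
    have "((\<lambda>z. max (u z) 0) \<longlongrightarrow> max 0 0) at_infinity" by (intro tendsto_max lim tendsto_const)
    then show "(v \<longlongrightarrow> 0) at_infinity" by (simp add: v_def[abs_def])
    show "isCont v x" unfolding v_def using cont[OF x] by (intro continuous_max continuous_const)
  next
    fix \<phi> :: "real ^ 'n \<Rightarrow> real"
    assume \<phi>: "test_function UNIV \<phi>" and \<phi>0: "\<And>z. 0 \<le> \<phi> z"
    note s\<phi> = test_function_smooth[OF \<phi>]
    obtain K where K: "compact K" "\<And>x. x \<notin> K \<Longrightarrow> \<phi> x = 0" "\<And>x. x \<notin> K \<Longrightarrow> laplacian \<phi> x = 0"
      using test_function_laplacian_support[OF \<phi>] by metis
    obtain R where R: "K \<subseteq> cball 0 R" using compact_subset_cball[OF K(1)] by metis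
    have c\<phi>: "continuous_on UNIV \<phi>" using smooth_continuous_on[OF s\<phi>, of UNIV "[]"] by simp
    have cL: "continuous_on UNIV (laplacian \<phi>)" by (rule continuous_on_laplacian[OF s\<phi>])
    obtain B where B: "\<And>x. \<bar>\<phi> x\<bar> \<le> B" using continuous_support_bounded[OF c\<phi> K(2,1)] by metis
    obtain B' where B': "\<And>x. \<bar>laplacian \<phi> x\<bar> \<le> B'" using continuous_support_bounded[OF cL K(3,1)] by metis
    have \<phi>m: "\<phi> \<in> borel_measurable lebesgue" and Lm: "laplacian \<phi> \<in> borel_measurable lebesgue"
      using c\<phi> cL by (auto intro!: measurable_lebesgue borel_measurable_continuous_onI)
    have \<phi>R: "\<forall>x. x \<notin> cball 0 R \<longrightarrow> \<phi> x = 0" "\<forall>x. x \<notin> cball 0 R \<longrightarrow> laplacian \<phi> x = 0"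
      using K R by blast+
    have \<phi>P: "(\<lambda>x. \<phi> x * P x) \<in> borel_measurable lebesgue" by (intro borel_measurable_times \<phi>m P)
    have \<phi>PB: "\<bar>\<phi> x * P x\<bar> \<le> B" for x
      using B[of x] by (auto simp: P_def indicator_def intro: order_trans[OF abs_ge_zero B])
    have \<phi>PR: "\<forall>x. x \<notin> cball 0 R \<longrightarrow> \<phi> x * P x = 0" using \<phi>R by simp
    \<comment> \<open>Kato's inequality mollified at scale \<open>r\<close>: the pointwise
      comparison of averages is integrated against \<phi>, and Fubini moves the kernels onto \<phi>.
      Dividing by the mass of \<open>kball r\<close> and letting \<open>r\<close> tend to 0 then
      yields the distributional inequality.\<close>
    have key: "(LINT z|lebesgue. F z * (LINT x|lebesgue. (\<phi> x * P x) * kball r (x - z)))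
        \<le> (LINT z|lebesgue. v z * (LINT x|lebesgue. laplacian \<phi> x * kball r (x - z)))" if r: "0 < r" for r
    proof -
      let ?A = "\<lambda>x. LINT z|lebesgue. v z * kappa r (x - z)"
      let ?k = "\<lambda>x. LINT z|lebesgue. F z * kball r (x - z)"
      have ko: "\<forall>x :: real ^ 'n. r \<le> norm x \<longrightarrow> kappa r x = 0" "\<forall>x :: real ^ 'n. r \<le> norm x \<longrightarrow> kball r x = 0"
        using kappa_outer[OF r] kball_outer[OF r] by blast+
      note Fub1 = kernel_Fubini[OF v \<phi>m B \<phi>R(1) kappa_measurable[OF r] integrable_kappa[OF r] ko(1)]
      note Fub2 = kernel_Fubini[OF F \<phi>P \<phi>PB \<phi>PR kball_measurable[OF r] integrable_kball[OF dim3 r] ko(2)]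
      have v\<phi>: "integrable lebesgue (\<lambda>z. v z * \<phi> z)"
        by (rule locally_integrable_mult[OF v \<phi>m B K(2,1)]) auto
      have "(LINT z|lebesgue. F z * (LINT x|lebesgue. (\<phi> x * P x) * kball r (x - z))) = (LINT x|lebesgue. (\<phi> x * P x) * ?k x)"
        by (rule Fub2(1)[symmetric])
      also have "\<dots> \<le> (LINT x|lebesgue. \<phi> x * ?A x - m * (v x * \<phi> x))"
      proof (rule Bochner_Integration.integral_mono_AE)
        show "integrable lebesgue (\<lambda>x. (\<phi> x * P x) * ?k x)" by (rule Fub2(2))
        show "integrable lebesgue (\<lambda>x. \<phi> x * ?A x - m * (v x * \<phi> x))"
          by (intro Bochner_Integration.integrable_diff Fub1(2) integrable_mult_right v\<phi>)
        show "AE x in lebesgue. (\<phi> x * P x) * ?k x \<le> \<phi> x * ?A x - m * (v x * \<phi> x)"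
          using Fub2(4) AE_lebesgue_neq[of y]
        proof eventually_elim
          fix x assume 1: "\<phi> x * P x \<noteq> 0 \<longrightarrow> integrable lebesgue (\<lambda>z. F z * kball r (x - z))" and xy: "x \<noteq> y"
          \<comment> \<open>If u x \<le> 0, then \<open>P x\<close> and \<open>v x\<close> vanish
            and the average of \<open>v\<close> is nonnegative. If u x > 0, then v x = u x while the
            averages of \<open>v\<close> dominate those of \<open>u\<close>.\<close>
          have *: "P x * ?k x \<le> ?A x - m * v x" if "\<phi> x \<noteq> 0"
          proof (cases "0 < u x")
            case False
            have "0 \<le> ?A x"
              using kappa_nonneg[OF dim3, of r] by (intro Bochner_Integration.integral_nonneg) (simp add: v_def)
            then show ?thesis using False by (simp add: P_def v_def)
          next
            case True
            then have Px: "P x = 1" "v x = u x" by (simp_all add: P_def v_def)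
            with 1 that have i: "integrable lebesgue (\<lambda>z. F z * kball r (x - z))" by simp
            define e where "e n = r * inverse (real (Suc n))" for n
            have e: "0 < e n" "e n \<le> r" for n using r by (auto simp: e_def field_simps)
            have e0: "e \<longlonglongrightarrow> 0"
              unfolding e_def using tendsto_mult[OF tendsto_const LIMSEQ_inverse_real_of_nat, of r] by simp
            have "?k x \<le> (LINT z|lebesgue. u z * kappa r (x - z)) - u x * m"
            proof (rule LIMSEQ_le)
              show "(\<lambda>n. LINT z|lebesgue. F z * kdiff (e n) r (x - z)) \<longlonglongrightarrow> ?k x"
                by (rule kdiff_limit[OF dim3 locally_integrable_measurable[OF F] i r e e0])
              show "(\<lambda>n. (LINT z|lebesgue. u z * kappa r (x - z)) - (LINT z|lebesgue. u z * kappa (e n) (x - z)))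
                \<longlonglongrightarrow> (LINT z|lebesgue. u z * kappa r (x - z)) - u x * m"
                unfolding m_def by (intro tendsto_diff tendsto_const kappa_limit[OF dim3 u cont[OF xy] e(1) e0])
              show "\<exists>N. \<forall>n\<ge>N. (LINT z|lebesgue. F z * kdiff (e n) r (x - z))
                \<le> (LINT z|lebesgue. u z * kappa r (x - z)) - (LINT z|lebesgue. u z * kappa (e n) (x - z))"
                unfolding F_def using ineq[OF e] by blast
            qed
            also have "(LINT z|lebesgue. u z * kappa r (x - z)) \<le> ?A x"
            proof (rule Bochner_Integration.integral_mono)
              show "u z * kappa r (x - z) \<le> v z * kappa r (x - z)" for z
                using kappa_nonneg[OF dim3, of r "x - z"] by (intro mult_right_mono) (simp_all add: v_def)
            qed (rule integrable_mult_kappa[OF _ r]; fact)+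
            finally show ?thesis by (simp add: Px mult.commute)
          qed
          show "(\<phi> x * P x) * ?k x \<le> \<phi> x * ?A x - m * (v x * \<phi> x)"
          proof (cases "\<phi> x = 0")
            case False
            have "\<phi> x * (P x * ?k x) \<le> \<phi> x * (?A x - m * v x)"
              by (rule mult_left_mono[OF *[OF False] \<phi>0])
            then show ?thesis by (simp add: algebra_simps)
          qed simp
        qed
      qed
      also have "\<dots> = (LINT x|lebesgue. \<phi> x * ?A x) - (LINT x|lebesgue. m * (v x * \<phi> x))"
        by (intro Bochner_Integration.integral_diff Fub1(2) integrable_mult_right v\<phi>)
      also have "\<dots> = (LINT z|lebesgue. v z * (LINT x|lebesgue. \<phi> x * kappa r (x - z))) - (LINT z|lebesgue. m * (v z * \<phi> z))"
        unfolding Fub1(1) ..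
      also have "\<dots> = (LINT z|lebesgue. v z * (LINT x|lebesgue. \<phi> x * kappa r (x - z)) - m * (v z * \<phi> z))"
        by (intro Bochner_Integration.integral_diff[symmetric] Fub1(3) integrable_mult_right v\<phi>)
      also have "\<dots> = (LINT z|lebesgue. v z * (LINT x|lebesgue. laplacian \<phi> x * kball r (x - z)))"
        unfolding kappa_average_test_function[OF dim3 \<phi> r, symmetric] m_def
        by (simp add: algebra_simps)
      finally show ?thesis .
    qed
    let ?c = "\<lambda>n. LINT x|lebesgue. kball (inverse (real (Suc n))) (x :: real ^ 'n)"
    have "(LINT z|lebesgue. F z * (\<phi> z * P z)) \<le> (LINT z|lebesgue. v z * laplacian \<phi> z)"
    proof (rule LIMSEQ_le)
      show "(\<lambda>n. (LINT z|lebesgue. v z * (LINT x|lebesgue. laplacian \<phi> x * kball (inverse (real (Suc n))) (x - z))) / ?c n)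
          \<longlonglongrightarrow> (LINT z|lebesgue. v z * laplacian \<phi> z)"
        using cL by (intro kball_mollify_limit[OF v Lm B' \<phi>R(2)]) (simp add: continuous_on_eq_continuous_at)
      show "(\<lambda>n. (LINT z|lebesgue. F z * (LINT x|lebesgue. (\<phi> x * P x) * kball (inverse (real (Suc n))) (x - z))) / ?c n)
          \<longlonglongrightarrow> (LINT z|lebesgue. F z * (\<phi> z * P z))"
      proof (rule kball_mollify_limit[OF F \<phi>P \<phi>PB \<phi>PR])
        show "AE z in lebesgue. F z \<noteq> 0 \<longrightarrow> isCont (\<lambda>x. \<phi> x * P x) z"
          using AE_lebesgue_neq[of y]
        proof eventually_elim
          fix z assume "z \<noteq> y"
          then have uz: "(u \<longlongrightarrow> u z) (nhds z)" using cont[of z] by (simp add: isCont_def tendsto_nhds_iff)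
          show "F z \<noteq> 0 \<longrightarrow> isCont (\<lambda>x. \<phi> x * P x) z"
          proof
            assume "F z \<noteq> 0"
            then have "u z > 0 \<or> u z < 0" by (auto simp: F_def)
            then have "\<forall>\<^sub>F w in nhds z. P w = P z"
            proof
              assume "u z > 0"
              with uz have "\<forall>\<^sub>F w in nhds z. 0 < u w" by (rule order_tendstoD(1))
              then show ?thesis by eventually_elim (use \<open>u z > 0\<close> in \<open>simp add: P_def\<close>)
            next
              assume "u z < 0"
              with uz have "\<forall>\<^sub>F w in nhds z. u w < 0" by (rule order_tendstoD(2))
              then show ?thesis by eventually_elim (use \<open>u z < 0\<close> in \<open>simp add: P_def\<close>)
            qed
            then have "isCont P z" by (simp add: isCont_cong[of P "\<lambda>_. P z"])
            then show "isCont (\<lambda>x. \<phi> x * P x) z"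
              using c\<phi> by (intro continuous_mult) (simp_all add: continuous_on_eq_continuous_at)
          qed
        qed
      qed
      show "\<exists>N. \<forall>n\<ge>N. (LINT z|lebesgue. F z * (LINT x|lebesgue. (\<phi> x * P x) * kball (inverse (real (Suc n))) (x - z))) / ?c n
        \<le> (LINT z|lebesgue. v z * (LINT x|lebesgue. laplacian \<phi> x * kball (inverse (real (Suc n))) (x - z))) / ?c n"
      proof (intro exI allI impI divide_right_mono key)
        fix n
        show "0 \<le> ?c n" using kball_mass_pos[OF dim3, of "inverse (real (Suc n))"] by simp
      qed simp
    qed
    moreover have "0 \<le> (LINT z|lebesgue. F z * (\<phi> z * P z))"
    proof (rule integral_nonneg_AE)
      show "AE z in lebesgue. 0 \<le> F z * (\<phi> z * P z)"
        using c by eventually_elim (use \<phi>0 in \<open>simp add: F_def P_def indicator_def\<close>)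
    qed
    ultimately show "0 \<le> (LINT z|lebesgue. v z * laplacian \<phi> z)" by simp
  qed
  then show ?thesis by (simp add: v_def)
qed

end

section \<open>Fundamental solutions\<close>

text \<open>The profile is evaluated ever closer to 0, where it is continuous, while the prefactor
  has the negative exponent 2 - d.\<close>

lemma newton_reg_limit:
  fixes x :: "real ^ 'n"
  assumes "3 \<le> CARD('n)"
  shows "(\<lambda>n. newton_reg (real (Suc n)) x) \<longlonglongrightarrow> 0"
proof -
  let ?a = "real CARD('n) / 2" and ?s = "x \<bullet> x"
  have top: "filterlim (\<lambda>n. real (Suc n)) at_top sequentially"
    by (rule filterlim_compose[OF filterlim_real_sequentially filterlim_Suc])
  have 1: "(\<lambda>n. real (Suc n) powr (2 - 2 * ?a)) \<longlonglongrightarrow> 0"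
    by (rule tendsto_neg_powr[OF _ top]) (use assms in simp)
  have "(\<lambda>n. ?s / (real (Suc n))\<^sup>2) \<longlonglongrightarrow> 0"
    by (rule real_tendsto_divide_at_top[OF tendsto_const])
       (rule filterlim_pow_at_top[OF _ top], simp)
  moreover have "isCont (profile ?a) 0" using profile_has_derivative DERIV_isCont by blast
  ultimately have 2: "(\<lambda>n. profile ?a (?s / (real (Suc n))\<^sup>2)) \<longlonglongrightarrow> profile ?a 0"
    by (rule isCont_tendsto_compose[rotated])
  from tendsto_mult[OF 1 2] show ?thesis
    unfolding newton_reg_def rprofile_def by simp
qed

context
  fixes V :: "real ^ 'n::finite \<Rightarrow> real" and G
  assumes dim3: "3 \<le> CARD('n)" and G: "fundamental_solution V G"
begin

lemma fundamental_locally_integrable: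
  "locally_integrable_on (\<lambda>x. G x y) UNIV" "locally_integrable_on (\<lambda>x. V x * G x y) UNIV"
  using G by (auto simp: fundamental_solution_def)

lemma fundamental_isCont: "x \<noteq> y \<Longrightarrow> isCont (\<lambda>x. G x y) x"
  using G continuous_on_eq_continuous_at[of "- {y}" "\<lambda>x. G x y"]
  by (auto simp: fundamental_solution_def)

lemma fundamental_identity:
  assumes \<epsilon>: "0 < \<epsilon>" "\<epsilon> \<le> r"
  shows "(LINT z|lebesgue. G z y * kappa \<epsilon> (x - z)) - (LINT z|lebesgue. G z y * kappa r (x - z))
      = kdiff \<epsilon> r (x - y) - (LINT z|lebesgue. (V z * G z y) * kdiff \<epsilon> r (x - z))"
proof -
  let ?\<phi> = "\<lambda>z. kdiff \<epsilon> r (z - x)"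
  have r: "0 < r" using \<epsilon> by simp
  note loc = fundamental_locally_integrable[of y]
  have ev: "kappa e (z - x) = kappa e (x - z)" "kdiff \<epsilon> r (z - x) = kdiff \<epsilon> r (x - z)" for e z
    by (rule even_kernels)+
  have "kdiff \<epsilon> r (x - y) = ?\<phi> y" by (simp only: ev)
  also have "\<dots> = (LINT z|lebesgue. G z y * (- laplacian ?\<phi> z + V z * ?\<phi> z))"
    using G test_function_kdiff[OF \<epsilon> subset_UNIV, of x] by (auto simp: fundamental_solution_def)
  also have "\<dots> = (LINT z|lebesgue. G z y * kappa \<epsilon> (x - z) - G z y * kappa r (x - z) + (V z * G z y) * kdiff \<epsilon> r (x - z))"
    unfolding laplacian_kdiff[OF \<epsilon>] unfolding ev by (simp add: algebra_simps)
  also have "\<dots> = (LINT z|lebesgue. G z y * kappa \<epsilon> (x - z)) - (LINT z|lebesgue. G z y * kappa r (x - z))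
      + (LINT z|lebesgue. (V z * G z y) * kdiff \<epsilon> r (x - z))"
    using integrable_mult_kappa[OF loc(1) \<epsilon>(1)] integrable_mult_kappa[OF loc(1) r] integrable_mult_kdiff[OF loc(2) \<epsilon>]
    by simp
  finally show ?thesis by simp
qed

context
  assumes V: "AE x in lebesgue. 0 \<le> V x"
begin

text \<open>In the equation for -G the pole contributes -\<open>kdiff\<close>, which has the
  favourable sign, so Kato's inequality applies to -G across its singularity.\<close>

lemma fundamental_nonneg:
  assumes "x \<noteq> y" shows "0 \<le> G x y"
proof -
  note loc = fundamental_locally_integrable[of y]
  have neg: "locally_integrable_on (\<lambda>z. - h z) UNIV" if "locally_integrable_on h UNIV" for h :: "real ^ 'n \<Rightarrow> real"
    using that by (simp add: locally_integrable_on_def set_integrable_def)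
  have "- G x y \<le> 0"
  proof (rule kato_nonpos[OF dim3, where u = "\<lambda>z. - G z y" and c = V and y = y])
    show "locally_integrable_on (\<lambda>z. - G z y) UNIV" by (rule neg[OF loc(1)])
    show "locally_integrable_on (\<lambda>z. V z * - G z y) UNIV" using neg[OF loc(2)] by simp
    show "isCont (\<lambda>z. - G z y) x" if "x \<noteq> y" for x
      by (rule continuous_minus[OF fundamental_isCont[OF that]])
    show "((\<lambda>z. - G z y) \<longlongrightarrow> 0) at_infinity"
      using G tendsto_minus[of "\<lambda>z. G z y" 0] by (auto simp: fundamental_solution_def)
    fix x \<epsilon> r :: real and x' :: "real ^ 'n" assume \<epsilon>: "0 < \<epsilon>" "\<epsilon> \<le> r"
    have "(LINT z|lebesgue. (V z * - G z y) * kdiff \<epsilon> r (x' - z)) = - (LINT z|lebesgue. (V z * G z y) * kdiff \<epsilon> r (x' - z))"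
      by simp
    also have "\<dots> \<le> kdiff \<epsilon> r (x' - y) - (LINT z|lebesgue. (V z * G z y) * kdiff \<epsilon> r (x' - z))"
      using kdiff_nonneg[OF dim3 \<epsilon>, of "x' - y"] by simp
    also have "\<dots> = (LINT z|lebesgue. - G z y * kappa r (x' - z)) - (LINT z|lebesgue. - G z y * kappa \<epsilon> (x' - z))"
      using fundamental_identity[OF \<epsilon>, of y x'] by simp
    finally show "(LINT z|lebesgue. (V z * - G z y) * kdiff \<epsilon> r (x' - z))
      \<le> (LINT z|lebesgue. - G z y * kappa r (x' - z)) - (LINT z|lebesgue. - G z y * kappa \<epsilon> (x' - z))" .
  qed (use V assms in auto)
  then show ?thesis by simp
qed

lemma fundamental_potential_nonneg: "AE z in lebesgue. 0 \<le> V z * G z y"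
  using V AE_lebesgue_neq[of y] by eventually_elim (simp add: fundamental_nonneg)

text \<open>With inner scale 1/(n+1) and outer scale n+1 the kernels increase to the Newtonian one.
  As V G is nonnegative, monotone convergence delivers integrability together with the value; the
  inner averages tend to c G(x,y) by continuity off the pole, the outer ones to 0 by decay.\<close>

lemma fundamental_representation:
  assumes xy: "x \<noteq> y"
  shows "integrable lebesgue (\<lambda>z. newton (x - z) * (V z * G z y))"
    and "kmass TYPE(real ^ 'n) * G x y + (LINT z|lebesgue. newton (x - z) * (V z * G z y)) = newton (x - y)"
proof -
  note loc = fundamental_locally_integrable[of y]
  define m where "m = kmass TYPE(real ^ 'n)"
  define e R where "e n = inverse (real (Suc n))" and "R n = real (Suc n)" for n
  have eR: "0 < e n" "e n \<le> R n" "0 < R n" for n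
    by (auto simp: e_def R_def intro: order_trans[of _ 1] simp: inverse_le_1_iff)
  have e0: "e \<longlonglongrightarrow> 0" unfolding e_def by (rule LIMSEQ_inverse_real_of_nat)
  have Rtop: "filterlim R at_top sequentially"
    unfolding R_def by (rule filterlim_compose[OF filterlim_real_sequentially filterlim_Suc])
  let ?f = "\<lambda>n z. (V z * G z y) * kdiff (e n) (R n) (x - z)"
  have klim: "(\<lambda>n. kdiff (e n) (R n) w) \<longlonglongrightarrow> newton w" if "w \<noteq> 0" for w :: "real ^ 'n"
  proof -
    have "(\<lambda>n. newton_reg (e n) w) \<longlonglongrightarrow> newton w"
    proof (rule tendsto_eventually)
      have "0 < norm w" using that by simp
      with e0 have "\<forall>\<^sub>F n in sequentially. e n < norm w" by (rule order_tendstoD(2))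
      then show "\<forall>\<^sub>F n in sequentially. newton_reg (e n) w = newton w"
        by eventually_elim (simp add: newton_reg_outer eR)
    qed
    from tendsto_diff[OF this newton_reg_limit[OF dim3, of w]] show ?thesis
      by (simp add: kdiff_def R_def)
  qed
  have int: "integrable lebesgue (?f n)" for n
    by (rule integrable_mult_kdiff[OF loc(2) eR(1,2)])
  have mono: "AE z in lebesgue. mono (\<lambda>n. ?f n z)"
    using fundamental_potential_nonneg[of y]
  proof eventually_elim
    fix z assume z: "0 \<le> V z * G z y"
    show "mono (\<lambda>n. ?f n z)"
    proof (intro monoI mult_left_mono z)
      fix m n :: nat assume "m \<le> n"
      then have "e n \<le> e m" "R m \<le> R n" by (simp_all add: e_def R_def le_imp_inverse_le)
      then show "kdiff (e m) (R m) (x - z) \<le> kdiff (e n) (R n) (x - z)"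
        unfolding kdiff_def
        by (intro diff_mono newton_reg_antimono[OF dim3] eR)
    qed
  qed
  have lim: "AE z in lebesgue. (\<lambda>n. ?f n z) \<longlonglongrightarrow> (V z * G z y) * newton (x - z)"
    using AE_lebesgue_neq[of x]
    by eventually_elim (intro tendsto_mult tendsto_const klim, simp)
  have pos: "AE z in lebesgue. 0 \<le> ?f n z" for n
    using fundamental_potential_nonneg[of y]
    by eventually_elim (rule mult_nonneg_nonneg, assumption, intro kdiff_nonneg[OF dim3] eR)
  have id: "(LINT z|lebesgue. ?f n z) = kdiff (e n) (R n) (x - y)
      - ((LINT z|lebesgue. G z y * kappa (e n) (x - z)) - (LINT z|lebesgue. G z y * kappa (R n) (x - z)))" for n
    using fundamental_identity[OF eR(1)[of n] eR(2)[of n], of y x] by linarith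
  have Ginf: "((\<lambda>z. G z y) \<longlongrightarrow> 0) at_infinity" using G by (auto simp: fundamental_solution_def)
  have ilim: "(\<lambda>n. LINT z|lebesgue. ?f n z) \<longlonglongrightarrow> newton (x - y) - (G x y * m - 0)"
    unfolding id m_def
    by (intro tendsto_diff klim kappa_limit[OF dim3 loc(1) fundamental_isCont[OF xy] eR(1) e0]
        filterlim_compose[OF kappa_limit_at_infinity[OF dim3 loc(1) Ginf] Rtop])
       (use xy in simp)
  have meas: "(\<lambda>z. (V z * G z y) * newton (x - z)) \<in> borel_measurable lebesgue"
    by (intro borel_measurable_times locally_integrable_measurable loc measurable_lebesgue) measurable
  have "integrable lebesgue (\<lambda>z. (V z * G z y) * newton (x - z))"
    by (rule integral_monotone_convergence_nonneg(1)[OF int mono pos lim ilim meas])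
  then show "integrable lebesgue (\<lambda>z. newton (x - z) * (V z * G z y))" by (simp only: mult.commute)
  have "(LINT z|lebesgue. (V z * G z y) * newton (x - z)) = newton (x - y) - (G x y * m - 0)"
    by (rule integral_monotone_convergence_nonneg(2)[OF int mono pos lim ilim meas])
  moreover have "(LINT z|lebesgue. (V z * G z y) * newton (x - z)) = (LINT z|lebesgue. newton (x - z) * (V z * G z y))"
    by (simp only: mult.commute)
  ultimately show "kmass TYPE(real ^ 'n) * G x y + (LINT z|lebesgue. newton (x - z) * (V z * G z y)) = newton (x - y)"
    by (simp add: m_def)
qed

lemma fundamental_representation_nn:
  assumes xy: "x \<noteq> y"
  shows "ennreal (kmass TYPE(real ^ 'n) * G x y) + (\<integral>\<^sup>+z. ennreal (newton (x - z)) * ennreal (V z * G z y) \<partial>lebesgue)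
    = ennreal (newton (x - y))"
proof -
  have nn: "AE z in lebesgue. 0 \<le> newton (x - z) * (V z * G z y)"
    using fundamental_potential_nonneg[of y] by eventually_elim (rule mult_nonneg_nonneg[OF newton_nonneg])
  have "(\<integral>\<^sup>+z. ennreal (newton (x - z)) * ennreal (V z * G z y) \<partial>lebesgue)
      = (\<integral>\<^sup>+z. ennreal (newton (x - z) * (V z * G z y)) \<partial>lebesgue)"
    by (simp only: ennreal_mult'[OF newton_nonneg])
  also have "\<dots> = ennreal (LINT z|lebesgue. newton (x - z) * (V z * G z y))"
    by (rule nn_integral_eq_integral[OF fundamental_representation(1)[OF xy] nn])
  finally show ?thesis
    using fundamental_representation(2)[OF xy] kmass_pos[OF dim3] fundamental_nonneg[OF xy]
      integral_nonneg_AE[OF nn]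
    by (simp flip: ennreal_plus)
qed

lemma fundamental_le:
  assumes xy: "x \<noteq> y"
  shows "kmass TYPE(real ^ 'n) * G x y \<le> newton (x - y)"
proof -
  have "AE z in lebesgue. 0 \<le> newton (x - z) * (V z * G z y)"
    using fundamental_potential_nonneg[of y] by eventually_elim (rule mult_nonneg_nonneg[OF newton_nonneg])
  from integral_nonneg_AE[OF this] fundamental_representation(2)[OF xy] show ?thesis by simp
qed

text \<open>Insert the equation for N(z - y) into the potential of V G(.,x) at y. It splits into
  \<open>S\<close>, with integrand V G(.,x) G(.,y) up to a constant and so visibly symmetric, and
  \<open>J\<close>, symmetric by Tonelli. Thus c G(x,y) and c G(y,x) complete the same number to N(x
  - y).\<close>

lemma fundamental_symmetric:
  assumes xy: "x \<noteq> y"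
  shows "G x y = G y x"
proof -
  let ?m = "kmass TYPE(real ^ 'n)"
  have m: "0 < ?m" by (rule kmass_pos[OF dim3])
  define g where "g y z = ennreal (V z * G z y)" for y z
  have gm: "g y \<in> borel_measurable lebesgue" for y
    unfolding g_def
    by (intro measurable_compose[OF _ measurable_ennreal] locally_integrable_measurable fundamental_locally_integrable)
  define N where "N w = ennreal (newton w)" for w :: "real ^ 'n"
  define J where "J x y = (\<integral>\<^sup>+z. g x z * (\<integral>\<^sup>+w. N (z - w) * g y w \<partial>lebesgue) \<partial>lebesgue)" for x y
  define S where "S x y = (\<integral>\<^sup>+z. g x z * ennreal (?m * G z y) \<partial>lebesgue)" for x y
  have Nm: "(\<lambda>z. N (x - z)) \<in> borel_measurable lebesgue" "(\<lambda>z. N (z - x)) \<in> borel_measurable lebesgue" for x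
    unfolding N_def by (rule measurable_lebesgue; measurable)+
  have rep: "ennreal (?m * G x y) + (\<integral>\<^sup>+z. N (x - z) * g y z \<partial>lebesgue) = N (x - y)" if "x \<noteq> y" for x y
    using fundamental_representation_nn[OF that] by (simp add: N_def g_def)
  have Gm: "(\<lambda>z. ennreal (?m * G z y)) \<in> borel_measurable lebesgue" for y
    by (intro measurable_compose[OF _ measurable_ennreal] borel_measurable_times borel_measurable_const
        locally_integrable_measurable fundamental_locally_integrable)
  have "N \<in> borel_measurable borel" unfolding N_def by measurable
  note Nw = measurable_difference[OF this]
  have F: "(\<lambda>(z, w). g x z * (N (z - w) * g y w)) \<in> borel_measurable (lebesgue \<Otimes>\<^sub>M lebesgue)" for x y
    using Nw unfolding split_beta'
    by (intro borel_measurable_times_ennreal measurable_compose[OF measurable_fst gm] measurable_compose[OF measurable_snd gm])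
  have gNm: "(\<lambda>w. N (z - w) * g y w) \<in> borel_measurable lebesgue" for y z
    by (intro borel_measurable_times_ennreal Nm gm)
  have J1: "J x y = (\<integral>\<^sup>+z. (\<integral>\<^sup>+w. g x z * (N (z - w) * g y w) \<partial>lebesgue) \<partial>lebesgue)" for x y
    unfolding J_def by (subst nn_integral_cmult[OF gNm]) (rule refl)
  have Jsym: "J x y = J y x" for x y
  proof -
    have "J x y = (\<integral>\<^sup>+w. (\<integral>\<^sup>+z. g x z * (N (z - w) * g y w) \<partial>lebesgue) \<partial>lebesgue)"
      unfolding J1 using lebesgue_pair.Fubini[OF F[of x y]] by simp
    also have "\<dots> = J y x"
      unfolding J1 N_def even_kernels(1)[of _ w for w] by (simp only: mult.commute mult.left_commute)
    finally show ?thesis .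
  qed
  have Ssym: "S x y = S y x" for x y
    unfolding S_def
  proof (rule nn_integral_cong_AE)
    show "AE z in lebesgue. g x z * ennreal (?m * G z y) = g y z * ennreal (?m * G z x)"
      using V AE_lebesgue_neq[of x] AE_lebesgue_neq[of y]
    proof eventually_elim
      fix z assume "0 \<le> V z" "z \<noteq> x" "z \<noteq> y"
      then show "g x z * ennreal (?m * G z y) = g y z * ennreal (?m * G z x)"
        using m fundamental_nonneg[of z x] fundamental_nonneg[of z y]
        by (simp add: g_def mult_ac flip: ennreal_mult)
    qed
  qed
  have split: "(\<integral>\<^sup>+z. N (y - z) * g x z \<partial>lebesgue) = S x y + J x y" for x y
  proof -
    have "(\<integral>\<^sup>+z. N (y - z) * g x z \<partial>lebesgue)
        = (\<integral>\<^sup>+z. g x z * ennreal (?m * G z y) + g x z * (\<integral>\<^sup>+w. N (z - w) * g y w \<partial>lebesgue) \<partial>lebesgue)"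
    proof (rule nn_integral_cong_AE)
      show "AE z in lebesgue. N (y - z) * g x z = g x z * ennreal (?m * G z y) + g x z * (\<integral>\<^sup>+w. N (z - w) * g y w \<partial>lebesgue)"
        using AE_lebesgue_neq[of y]
      proof eventually_elim
        fix z assume "z \<noteq> y"
        have "N (y - z) = N (z - y)" by (simp add: N_def even_kernels(1)[of y z])
        then show "N (y - z) * g x z = g x z * ennreal (?m * G z y) + g x z * (\<integral>\<^sup>+w. N (z - w) * g y w \<partial>lebesgue)"
          unfolding \<open>N (y - z) = N (z - y)\<close> rep[OF \<open>z \<noteq> y\<close>, symmetric]
          by (simp only: mult.commute[of _ "g x z"] distrib_left)
      qed
    qed
    also have "\<dots> = S x y + J x y"
      unfolding S_def J_def
    proof (rule nn_integral_add)
      show "(\<lambda>z. g x z * ennreal (?m * G z y)) \<in> borel_measurable lebesgue"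
        by (intro borel_measurable_times_ennreal gm Gm)
      have "(\<lambda>z. \<integral>\<^sup>+w. g x z * (N (z - w) * g y w) \<partial>lebesgue) \<in> borel_measurable lebesgue"
        using lebesgue.borel_measurable_nn_integral_fst[OF F[of x y]] by simp
      then show "(\<lambda>z. g x z * (\<integral>\<^sup>+w. N (z - w) * g y w \<partial>lebesgue)) \<in> borel_measurable lebesgue"
        by (simp add: nn_integral_cmult[OF gNm])
    qed
    finally show ?thesis .
  qed
  have "ennreal (?m * G x y) + (S x y + J x y) = N (x - y)"
    using rep[OF xy] split[of x y] Ssym[of x y] Jsym[of x y] by simp
  moreover have "ennreal (?m * G y x) + (S x y + J x y) = N (x - y)"
    using rep[of y x] xy split[of y x] by (simp add: N_def even_kernels(1)[of y x])
  \<comment> \<open>Cancellation in \<open>ennreal\<close> needs a finite summand; finiteness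
    follows because the sum is bounded by the real number N(x - y).\<close>
  moreover have "S x y + J x y \<noteq> top"
    using rep[of y x] xy split[of y x] by (auto simp: N_def)
  then obtain s where s: "0 \<le> s" "S x y + J x y = ennreal s" by (cases "S x y + J x y") auto
  ultimately have "ennreal (?m * G x y) + ennreal s = ennreal (?m * G y x) + ennreal s" by simp
  moreover have "0 \<le> ?m * G x y" "0 \<le> ?m * G y x"
    using m xy by (simp_all add: fundamental_nonneg)
  ultimately have "?m * G x y + s = ?m * G y x + s"
    using s(1) by (simp flip: ennreal_plus)
  then show ?thesis using m by simp
qed

end

end

lemma fundamental_solution_laplace:
  fixes G0 :: "real ^ 'n \<Rightarrow> real ^ 'n \<Rightarrow> real"
  assumes "3 \<le> CARD('n)" "fundamental_solution (\<lambda>_. 0) G0" "x \<noteq> y"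
  shows "G0 x y = newton (x - y) / kmass TYPE(real ^ 'n)"
  using fundamental_representation(2)[OF assms(1,2) _ assms(3)] kmass_pos[OF assms(1)]
  by (simp add: field_simps)

section \<open>Testing the sign of a function\<close>

lemma smooth_on_sum:
  fixes f :: "'i \<Rightarrow> 'a::real_normed_vector \<Rightarrow> real"
  assumes "finite I" "\<And>i. i \<in> I \<Longrightarrow> smooth_on UNIV (f i)"
  shows "smooth_on UNIV (\<lambda>x. \<Sum>i\<in>I. f i x)"
  using assms by (induction rule: finite_induct) (auto intro: smooth_on_add)

definition ball_bump :: "'a::real_inner \<Rightarrow> real \<Rightarrow> 'a \<Rightarrow> real" where
  "ball_bump c r x = bump (r\<^sup>2 - (x - c) \<bullet> (x - c))"

lemma smooth_ball_bump: "smooth_on UNIV (ball_bump c r)"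
proof -
  have "smooth_on UNIV (\<lambda>s. bump (r\<^sup>2 - s))"
    using smooth_on_compose[OF open_UNIV smooth_on_linear[of "-1" "r\<^sup>2"] smooth_on_bump] by simp
  from smooth_on_radial[OF this, of c] show ?thesis by (simp add: ball_bump_def[abs_def])
qed

lemma ball_bump_pos: "0 < r \<Longrightarrow> x \<in> ball c r \<Longrightarrow> 0 < ball_bump c r x"
  unfolding ball_bump_def
  by (intro bump_pos) (simp add: dist_norm norm_minus_commute dot_square_norm power_strict_mono)

lemma ball_bump_zero: "0 < r \<Longrightarrow> x \<notin> ball c r \<Longrightarrow> ball_bump c r x = 0"
  unfolding ball_bump_def
  by (intro bump_zero) (simp add: dist_norm norm_minus_commute dot_square_norm power_mono)

lemma ball_bump_nonneg: "0 \<le> ball_bump c r x"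
  by (simp add: ball_bump_def bump_nonneg)

text \<open>Lindelof's theorem gives the countable subcover, enumerated by the naturals with
  possible repetitions. The predicate \<open>P\<close> covers both uses: open balls inside an open
  set, and closed balls inside the domain.\<close>

lemma open_eq_UN_balls:
  fixes U :: "'a::euclidean_space set"
  assumes "open U" "U \<noteq> {}" and P: "\<forall>x\<in>U. \<exists>r>0. P x r"
  shows "\<exists>c r. (\<forall>i::nat. 0 < r i \<and> P (c i) (r i)) \<and> U \<subseteq> (\<Union>i. ball (c i) (r i))"
proof -
  let ?F = "{ball c r | c r. 0 < r \<and> P c r}"
  obtain F where F: "F \<subseteq> ?F" "countable F" "\<Union> F = \<Union> ?F"
    using Lindelof[of ?F] by auto
  have sub: "U \<subseteq> \<Union> ?F"
  proof
    fix x assume "x \<in> U"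
    then obtain r where "0 < r" "P x r" using P by blast
    then show "x \<in> \<Union> ?F" by (intro UnionI[of "ball x r"]) auto
  qed
  have "\<Union> F \<noteq> {}" using sub assms(2) unfolding F(3) by (metis subset_empty)
  then have ne: "F \<noteq> {}" by auto
  have "\<exists>c r. from_nat_into F i = ball c r \<and> 0 < r \<and> P c r" for i
    using from_nat_into[OF ne, of i] F(1) by auto
  then obtain c r where cr: "from_nat_into F i = ball (c i) (r i) \<and> 0 < r i \<and> P (c i) (r i)" for i by metis
  have "F = range (from_nat_into F)" using F(2) ne by simp
  then have "\<Union> F = (\<Union>i. ball (c i) (r i))" using cr by (metis (no_types, lifting) SUP_cong)
  then show ?thesis using cr sub F(3) by (intro exI[of _ c] exI[of _ r]) simp
qed

text \<open>The indicator of \<open>U\<close> is the pointwise limit of the test functions 1 -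
  exp(-k g_k), where g_k sums the first k bumps on balls exhausting \<open>U\<close>. They take
  values in [0,1] and vanish off \<open>U\<close>, so |f| on \<open>K\<close> dominates.\<close>

lemma test_nonneg_open:
  fixes f :: "'a::euclidean_space \<Rightarrow> real"
  assumes f: "locally_integrable_on f S"
    and test: "\<And>\<phi>. test_function S \<phi> \<Longrightarrow> (\<And>x. 0 \<le> \<phi> x) \<Longrightarrow> 0 \<le> (LINT x|lebesgue. f x * \<phi> x)"
    and U: "open U" "U \<subseteq> K" and K: "compact K" "K \<subseteq> S"
  shows "0 \<le> (LINT x|lebesgue. f x * indicator U x)"
proof (cases "U = {}")
  case False
  have *: "\<forall>x\<in>U. \<exists>r>0. ball x r \<subseteq> U" using U(1) open_contains_ball by blast
  from open_eq_UN_balls[OF U(1) False, of "\<lambda>x r. ball x r \<subseteq> U", OF *]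
  obtain c r where "\<forall>i::nat. 0 < r i \<and> ball (c i) (r i) \<subseteq> U" and cr2: "U \<subseteq> (\<Union>i. ball (c i) (r i))"
    by (elim exE conjE)
  then have cr: "0 < r i \<and> ball (c i) (r i) \<subseteq> U" for i by (elim allE)
  define g where "g k x = (\<Sum>i<k. ball_bump (c i) (r i) x)" for k x
  define \<phi> where "\<phi> k x = 1 + (-1) * exp ((- real k) * g k x)" for k x
  have g0: "0 \<le> g k x" for k x unfolding g_def by (intro sum_nonneg ball_bump_nonneg)
  have gU: "g k x = 0" if "x \<notin> U" for k x
    unfolding g_def
  proof (intro sum.neutral ballI ball_bump_zero)
    fix i
    show "0 < r i" "x \<notin> ball (c i) (r i)" using cr[of i] that by blast+
  qed
  have sm: "smooth_on UNIV (\<phi> k)" for k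
  proof -
    have "smooth_on UNIV (g k)" unfolding g_def by (intro smooth_on_sum smooth_ball_bump) auto
    then have "smooth_on UNIV (\<lambda>x. (- real k) * g k x)" by (intro smooth_on_mult smooth_on_const) auto
    from smooth_on_compose[OF open_UNIV this smooth_on_exp[of UNIV]]
    have "smooth_on UNIV (\<lambda>x. exp ((- real k) * g k x))" by simp
    then show ?thesis unfolding \<phi>_def by (intro smooth_on_add smooth_on_mult smooth_on_const) auto
  qed
  have \<phi>U: "\<phi> k x = 0" if "x \<notin> U" for k x by (simp add: \<phi>_def gU that)
  have \<phi>01: "0 \<le> \<phi> k x" "\<phi> k x \<le> 1" for k x
    using g0[of k x] by (auto simp: \<phi>_def mult_nonneg_nonneg)
  have tf: "test_function S (\<phi> k)" for k
    unfolding test_function_def using sm[of k] \<phi>U U K by (auto simp: smooth_on_UNIV intro!: exI[of _ K])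
  have fK: "integrable lebesgue (\<lambda>x. indicator K x *\<^sub>R f x)" by (rule locally_integrable_onD[OF f K])
  have eq: "f x * \<phi> k x = (indicator K x *\<^sub>R f x) * \<phi> k x" for k x
    using \<phi>U U(2) by (cases "x \<in> K") auto
  have eqU: "f x * indicator U x = (indicator K x *\<^sub>R f x) * indicator U x" for x
    using U(2) by (auto simp: indicator_def)
  have "(\<lambda>k. LINT x|lebesgue. f x * \<phi> k x) \<longlonglongrightarrow> (LINT x|lebesgue. f x * indicator U x)"
  proof (rule integral_dominated_convergence)
    show "integrable lebesgue (\<lambda>x. \<bar>indicator K x *\<^sub>R f x\<bar>)" using fK by (rule integrable_abs)
    show "AE x in lebesgue. (\<lambda>k. f x * \<phi> k x) \<longlonglongrightarrow> f x * indicator U x"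
    proof (intro AE_I2 tendsto_mult tendsto_const)
      fix x
      show "(\<lambda>k. \<phi> k x) \<longlonglongrightarrow> indicator U x"
      proof (cases "x \<in> U")
        case True
        then obtain i where i: "x \<in> ball (c i) (r i)" using cr2 by blast
        define b where "b = ball_bump (c i) (r i) x"
        have b: "0 < b" using i cr by (simp add: b_def ball_bump_pos)
        have low: "b \<le> g k x" if "i < k" for k
          unfolding g_def b_def using that by (intro member_le_sum ball_bump_nonneg) auto
        have "(\<lambda>k. exp (- (real k * b))) \<longlonglongrightarrow> 0"
        proof -
          have "filterlim (\<lambda>k. real k * b) at_top sequentially"
            by (rule filterlim_at_top_mult_tendsto_pos[OF tendsto_const b filterlim_real_sequentially])
          then show ?thesis
            by (intro filterlim_compose[OF exp_at_bot] filterlim_compose[OF filterlim_uminus_at_bot_at_top])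
        qed
        then have "(\<lambda>k. exp ((- real k) * g k x)) \<longlonglongrightarrow> 0"
        proof (rule Lim_null_comparison[rotated])
          show "\<forall>\<^sub>F k in sequentially. norm (exp ((- real k) * g k x)) \<le> exp (- (real k * b))"
            using eventually_gt_at_top[of i]
          proof eventually_elim
            fix k assume "i < k"
            then have "real k * b \<le> real k * g k x" using low by (intro mult_left_mono) auto
            then show "norm (exp ((- real k) * g k x)) \<le> exp (- (real k * b))" by simp
          qed
        qed
        then have "(\<lambda>k. 1 + (-1) * exp ((- real k) * g k x)) \<longlonglongrightarrow> 1 + (-1) * 0"
          by (intro tendsto_add tendsto_mult tendsto_const)
        then show ?thesis using True by (simp add: \<phi>_def)
      qed (simp add: \<phi>U)
    qed
    show "AE x in lebesgue. norm (f x * \<phi> k x) \<le> \<bar>indicator K x *\<^sub>R f x\<bar>" for k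
    proof (intro AE_I2)
      fix x
      have "\<bar>indicator K x *\<^sub>R f x\<bar> * \<bar>\<phi> k x\<bar> \<le> \<bar>indicator K x *\<^sub>R f x\<bar> * 1"
        using \<phi>01[of k x] by (intro mult_left_mono) auto
      then show "norm (f x * \<phi> k x) \<le> \<bar>indicator K x *\<^sub>R f x\<bar>" unfolding eq by (simp add: abs_mult)
    qed
    show "(\<lambda>x. f x * \<phi> k x) \<in> borel_measurable lebesgue" for k
      unfolding eq using smooth_continuous_on[OF sm[of k], of UNIV "[]"]
      by (intro borel_measurable_times borel_measurable_integrable[OF fK] measurable_lebesgue borel_measurable_continuous_onI) simp
    show "(\<lambda>x. f x * indicator U x) \<in> borel_measurable lebesgue"
      unfolding eqU using U(1)
      by (intro borel_measurable_times borel_measurable_integrable[OF fK] borel_measurable_indicator) auto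
  qed
  then show ?thesis by (rule LIMSEQ_le_const) (use test[OF tf \<phi>01(1)] in auto)
qed simp

text \<open>Outer regularity provides open sets decreasing to \<open>A\<close> up to a null set.
  Intersecting them with \<open>W\<close> keeps them inside the compact set \<open>K\<close>, on
  which \<open>f\<close> is integrable.\<close>

lemma test_nonneg_measurable:
  fixes f :: "'a::euclidean_space \<Rightarrow> real"
  assumes f: "locally_integrable_on f S"
    and test: "\<And>\<phi>. test_function S \<phi> \<Longrightarrow> (\<And>x. 0 \<le> \<phi> x) \<Longrightarrow> 0 \<le> (LINT x|lebesgue. f x * \<phi> x)"
    and A: "A \<in> sets lebesgue" "A \<subseteq> W" and W: "open W" "W \<subseteq> K" and K: "compact K" "K \<subseteq> S"
  shows "0 \<le> (LINT x|lebesgue. f x * indicator A x)"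
proof -
  have "\<exists>T. open T \<and> A \<subseteq> T \<and> T - A \<in> sets lebesgue \<and> emeasure lebesgue (T - A) < ennreal (inverse (real (Suc n)))" for n
  proof -
    have "0 < inverse (real (Suc n))" by simp
    then obtain T where "open T" "A \<subseteq> T" "T - A \<in> lmeasurable" "emeasure lebesgue (T - A) < ennreal (inverse (real (Suc n)))"
      using sets_lebesgue_outer_open[OF A(1)] by metis
    then show ?thesis by (auto simp: fmeasurable_def)
  qed
  then obtain T where T: "\<And>n. open (T n)" "\<And>n. A \<subseteq> T n" "\<And>n. T n - A \<in> sets lebesgue"
    "\<And>n. emeasure lebesgue (T n - A) < ennreal (inverse (real (Suc n)))" by metis
  define D where "D n = W \<inter> (\<Inter>i\<le>n. T i)" for n :: nat
  have D: "open (D n)" "D n \<subseteq> K" for n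
    unfolding D_def using T(1) W by (auto intro!: open_INT)
  have fK: "integrable lebesgue (\<lambda>x. indicator K x *\<^sub>R f x)" by (rule locally_integrable_onD[OF f K])
  have eq: "f x * indicator B x = (indicator K x *\<^sub>R f x) * indicator B x" if "B \<subseteq> K" for x B
    using that by (auto simp: indicator_def)
  have AK: "A \<subseteq> K" using A W by blast
  have null: "(\<Inter>i. T i) - A \<in> null_sets lebesgue"
  proof (rule null_setsI)
    have "(\<Inter>i. T i) - A = (\<Inter>i. T i - A)" by auto
    also have "\<dots> \<in> sets lebesgue" using T(3) by (intro sets.countable_INT) auto
    finally show "(\<Inter>i. T i) - A \<in> sets lebesgue" .
    have "emeasure lebesgue ((\<Inter>i. T i) - A) \<le> ennreal (inverse (real (Suc n)))" for n
    proof -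
      have "emeasure lebesgue ((\<Inter>i. T i) - A) \<le> emeasure lebesgue (T n - A)"
        using T(3) by (intro emeasure_mono) auto
      then show ?thesis using T(4)[of n] by simp
    qed
    moreover have "(\<lambda>n. ennreal (inverse (real (Suc n)))) \<longlonglongrightarrow> ennreal 0"
      by (intro tendsto_ennrealI LIMSEQ_inverse_real_of_nat)
    ultimately have "emeasure lebesgue ((\<Inter>i. T i) - A) \<le> ennreal 0"
      by (intro LIMSEQ_le_const[where X = "\<lambda>n. ennreal (inverse (real (Suc n)))"]) auto
    then show "emeasure lebesgue ((\<Inter>i. T i) - A) = 0" by simp
  qed
  have "(\<lambda>n. LINT x|lebesgue. f x * indicator (D n) x) \<longlonglongrightarrow> (LINT x|lebesgue. f x * indicator A x)"
  proof (rule integral_dominated_convergence)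
    show "integrable lebesgue (\<lambda>x. \<bar>indicator K x *\<^sub>R f x\<bar>)" using fK by (rule integrable_abs)
    show "AE x in lebesgue. (\<lambda>n. f x * indicator (D n) x) \<longlonglongrightarrow> f x * indicator A x"
      using AE_not_in[OF null]
    proof eventually_elim
      fix x assume x: "x \<notin> (\<Inter>i. T i) - A"
      show "(\<lambda>n. f x * indicator (D n) x) \<longlonglongrightarrow> f x * indicator A x"
      proof (cases "x \<in> A")
        case True
        then have "x \<in> D n" for n unfolding D_def using A T(2) by auto
        then show ?thesis using True by simp
      next
        case False
        then obtain m where "x \<notin> T m" using x by blast
        then have "x \<notin> D n" if "m \<le> n" for n unfolding D_def using that by blast
        then have "\<forall>\<^sub>F n in sequentially. f x * indicator (D n) x = f x * indicator A x"
          using False by (intro eventually_mono[OF eventually_ge_at_top[of m]]) simp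
        then show ?thesis by (rule tendsto_eventually)
      qed
    qed
    show "AE x in lebesgue. norm (f x * indicator (D n) x) \<le> \<bar>indicator K x *\<^sub>R f x\<bar>" for n
      using D(2)[of n] by (intro AE_I2) (auto simp: indicator_def)
    show "(\<lambda>x. f x * indicator (D n) x) \<in> borel_measurable lebesgue" for n
      unfolding eq[OF D(2)] using D(1)
      by (intro borel_measurable_times borel_measurable_integrable[OF fK] borel_measurable_indicator) auto
    show "(\<lambda>x. f x * indicator A x) \<in> borel_measurable lebesgue"
      unfolding eq[OF AK]
      by (intro borel_measurable_times borel_measurable_integrable[OF fK] borel_measurable_indicator A)
  qed
  then show ?thesis
    by (rule LIMSEQ_le_const) (use test_nonneg_open[OF f test D K] in auto)
qed

text \<open>On each ball of a countable cover, the integral of \<open>f\<close> over the set where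
  it is negative is both nonnegative and nonpositive.\<close>

lemma test_nonneg_AE:
  fixes f :: "'a::euclidean_space \<Rightarrow> real"
  assumes S: "open S" and f: "locally_integrable_on f S"
    and test: "\<And>\<phi>. test_function S \<phi> \<Longrightarrow> (\<And>x. 0 \<le> \<phi> x) \<Longrightarrow> 0 \<le> (LINT x|lebesgue. f x * \<phi> x)"
  shows "AE x in lebesgue. x \<in> S \<longrightarrow> 0 \<le> f x"
proof (cases "S = {}")
  case False
  have *: "\<forall>x\<in>S. \<exists>r>0. cball x r \<subseteq> S" using S open_contains_cball by blast
  from open_eq_UN_balls[OF S False, of "\<lambda>x r. cball x r \<subseteq> S", OF *]
  obtain c r where "\<forall>i::nat. 0 < r i \<and> cball (c i) (r i) \<subseteq> S" and cr2: "S \<subseteq> (\<Union>i. ball (c i) (r i))"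
    by (elim exE conjE)
  then have cr: "0 < r i \<and> cball (c i) (r i) \<subseteq> S" for i by (elim allE)
  have "AE x in lebesgue. x \<in> ball (c i) (r i) \<longrightarrow> 0 \<le> f x" for i
  proof -
    let ?B = "ball (c i) (r i)" and ?K = "cball (c i) (r i)"
    define A where "A = {x. indicator ?B x * (indicator ?K x *\<^sub>R f x) < 0}"
    have fK: "integrable lebesgue (\<lambda>x. indicator ?K x *\<^sub>R f x)"
      using cr[of i] by (intro locally_integrable_onD[OF f]) auto
    have "(\<lambda>x. indicator ?B x * (indicator ?K x *\<^sub>R f x)) \<in> borel_measurable lebesgue"
      by (intro borel_measurable_times borel_measurable_integrable[OF fK] borel_measurable_indicator) auto
    then have A: "A \<in> sets lebesgue" unfolding A_def by (simp add: borel_measurable_iff_less)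
    have memA: "x \<in> A \<longleftrightarrow> x \<in> ?B \<and> f x < 0" for x
      unfolding A_def by (cases "x \<in> ?B") auto
    have AB: "A \<subseteq> ?B" and Af: "x \<in> A \<Longrightarrow> f x < 0" for x using memA by blast+
    have int: "integrable lebesgue (\<lambda>x. f x * indicator A x)"
    proof (rule Bochner_Integration.integrable_bound[OF fK])
      have eq: "f x * indicator A x = (indicator ?K x *\<^sub>R f x) * indicator A x" for x
        using AB by (auto simp: indicator_def)
      show "(\<lambda>x. f x * indicator A x) \<in> borel_measurable lebesgue"
        unfolding eq
        by (intro borel_measurable_times borel_measurable_integrable[OF fK] borel_measurable_indicator A)
      show "AE x in lebesgue. norm (f x * indicator A x) \<le> norm (indicator ?K x *\<^sub>R f x)"
        using AB by (intro AE_I2) (auto simp: indicator_def)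
    qed
    have "0 \<le> (LINT x|lebesgue. f x * indicator A x)"
      using cr[of i] by (intro test_nonneg_measurable[OF f test A AB open_ball ball_subset_cball compact_cball]) auto
    moreover have "(LINT x|lebesgue. - (f x * indicator A x)) = - (LINT x|lebesgue. f x * indicator A x)"
      by simp
    moreover have nn: "AE x in lebesgue. 0 \<le> - (f x * indicator A x)"
      using Af by (intro AE_I2) (auto simp: indicator_def less_imp_le)
    moreover have "0 \<le> (LINT x|lebesgue. - (f x * indicator A x))" by (rule integral_nonneg_AE[OF nn])
    ultimately have "(LINT x|lebesgue. - (f x * indicator A x)) = 0" by linarith
    then have "AE x in lebesgue. - (f x * indicator A x) = 0"
      using integral_nonneg_eq_0_iff_AE[OF Bochner_Integration.integrable_minus[OF int] nn] by blast
    then show ?thesis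
    proof eventually_elim
      fix x assume x: "- (f x * indicator A x) = 0"
      show "x \<in> ?B \<longrightarrow> 0 \<le> f x"
      proof (rule impI, rule ccontr)
        assume "x \<in> ?B" "\<not> 0 \<le> f x"
        then have "x \<in> A" using memA[of x] by auto
        then show False using x Af[of x] by simp
      qed
    qed
  qed
  then have "AE x in lebesgue. \<forall>i. x \<in> ball (c i) (r i) \<longrightarrow> 0 \<le> f x" by (simp only: AE_all_countable) simp
  then show ?thesis by eventually_elim (use cr2 in blast)
qed simp

section \<open>Reverse Hoelder potentials\<close>

text \<open>Hoelder's inequality for V and the constant 1, from Young's inequality for V/A and 1/B.
  With A and B the two norms, the right side integrates to 1/q + 1/p = 1; vanishing norms are
  treated separately.\<close>

lemma power_mean_inequality:
  fixes V :: "'a::euclidean_space \<Rightarrow> real"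
  assumes V: "AE z in lebesgue. 0 \<le> V z" and q: "1 < q" and E: "E \<in> lmeasurable"
    and i1: "set_integrable lebesgue E V" and iq: "set_integrable lebesgue E (\<lambda>z. V z powr q)"
  shows "(LINT z:E|lebesgue. V z) \<le> measure lebesgue E powr (1 - 1 / q) * (LINT z:E|lebesgue. V z powr q) powr (1 / q)"
proof -
  define b where "b = measure lebesgue E"
  define n where "n = (LINT z:E|lebesgue. V z powr q)"
  have n0: "0 \<le> n" unfolding n_def set_lebesgue_integral_def by (intro integral_nonneg_AE AE_I2) simp
  have b0: "0 \<le> b" by (simp add: b_def)
  have intE: "set_integrable lebesgue E (\<lambda>_. 1 :: real)"
    unfolding set_integrable_def using E by (auto simp: fmeasurable_def intro: integrable_real_indicator)
  show ?thesis
  proof (cases "n = 0 \<or> b = 0")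
    case True
    have "(LINT z:E|lebesgue. V z) = 0"
      using True
    proof
      assume "n = 0"
      moreover have "AE z in lebesgue. 0 \<le> indicator E z *\<^sub>R V z powr q" by (intro AE_I2) simp
      ultimately have "AE z in lebesgue. indicator E z *\<^sub>R V z powr q = 0"
        using integral_nonneg_eq_0_iff_AE[of lebesgue "\<lambda>z. indicator E z *\<^sub>R V z powr q"] iq
        unfolding n_def set_lebesgue_integral_def set_integrable_def by blast
      then have "AE z in lebesgue. indicator E z *\<^sub>R V z = 0" by eventually_elim auto
      then show ?thesis
        unfolding set_lebesgue_integral_def by (rule integral_eq_zero_AE)
    next
      assume "b = 0"
      then have "E \<in> null_sets lebesgue"
        using E by (auto simp: b_def null_sets_def fmeasurable_def measure_def enn2real_eq_0_iff)
      from AE_not_in[OF this] have "AE z in lebesgue. indicator E z *\<^sub>R V z = 0"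
        by eventually_elim simp
      then show ?thesis
        unfolding set_lebesgue_integral_def by (rule integral_eq_zero_AE)
    qed
    then show ?thesis by simp
  next
    case False
    then have nb: "0 < n" "0 < b" using n0 b0 by auto
    define p where "p = q / (q - 1)"
    have p: "1 < p" "1 / q + 1 / p = 1" "1 - 1 / q = 1 / p" using q by (auto simp: p_def field_simps)
    define A B where "A = n powr (1 / q)" and "B = b powr (1 / p)"
    have AB: "0 < A" "0 < B" using nb by (auto simp: A_def B_def)
    have Aq: "A powr q = n" and Bp: "B powr p = b" using nb p q by (auto simp: A_def B_def powr_powr)
    have "(LINT z:E|lebesgue. V z * (1 / (A * B))) \<le> (LINT z:E|lebesgue. (1 / (q * n)) * V z powr q + 1 / (p * b) * 1)"
    proof (rule set_integral_mono_AE)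
      show "set_integrable lebesgue E (\<lambda>z. V z * (1 / (A * B)))" using i1 by (rule set_integrable_mult_left)
      show "set_integrable lebesgue E (\<lambda>z. (1 / (q * n)) * V z powr q + 1 / (p * b) * 1)"
        using iq intE by (intro set_integral_add set_integrable_mult_right)
      show "AE z\<in>E in lebesgue. V z * (1 / (A * B)) \<le> (1 / (q * n)) * V z powr q + 1 / (p * b) * 1"
        using V
      proof eventually_elim
        fix z assume "0 \<le> V z"
        then have "(V z / A) * (1 / B) \<le> (V z / A) powr q / q + (1 / B) powr p / p"
          using AB p q by (intro Youngs_inequality) auto
        also have "(V z / A) powr q = V z powr q / n" using AB \<open>0 \<le> V z\<close> by (simp add: powr_divide Aq)
        also have "(1 / B) powr p = 1 / b" using AB by (simp add: powr_divide Bp)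
        finally show "z \<in> E \<longrightarrow> V z * (1 / (A * B)) \<le> (1 / (q * n)) * V z powr q + 1 / (p * b) * 1"
          by (simp add: field_simps)
      qed
    qed
    also have "\<dots> = (LINT z:E|lebesgue. (1 / (q * n)) * V z powr q) + (LINT z:E|lebesgue. 1 / (p * b) * 1)"
      by (intro set_integral_add set_integrable_mult_right iq intE)
    also have "\<dots> = (1 / (q * n)) * n + 1 / (p * b) * b"
    proof -
      have "(LINT z:E|lebesgue. (1 :: real)) = b"
        by (simp add: set_lebesgue_integral_def b_def)
      then show ?thesis by (simp only: set_integral_mult_right n_def)
    qed
    also have "\<dots> = 1" using nb p by simp
    finally have "(LINT z:E|lebesgue. V z) * (1 / (A * B)) \<le> 1" by simp
    then have "(LINT z:E|lebesgue. V z) \<le> A * B" using AB by (simp add: field_simps)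
    then show ?thesis unfolding A_def B_def n_def b_def p(3) by (simp only: mult.commute)
  qed
qed

lemma set_integral_diff_set:
  fixes f :: "'a \<Rightarrow> real"
  assumes "b \<subseteq> B" "set_integrable M B f" "set_integrable M b f"
  shows "(LINT z:B - b|M. f z) = (LINT z:B|M. f z) - (LINT z:b|M. f z)"
proof -
  have "indicator (B - b) z *\<^sub>R f z = indicator B z *\<^sub>R f z - indicator b z *\<^sub>R f z" for z
    using assms(1) by (auto simp: indicator_def)
  then show ?thesis
    using assms(2,3) by (simp add: set_lebesgue_integral_def set_integrable_def)
qed

text \<open>\<open>d\<close>, \<open>\<omega>\<close> and \<open>\<alpha>\<close> are parameters because they depend on the type \<open>'n\<close>, which a definition of a real
  number inside the locale would have to take as an additional argument.\<close>

locale rh_potential =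
  fixes V :: "real ^ 'n::finite \<Rightarrow> real" and q d \<omega> \<alpha> :: real
  assumes d_eq: "d = real CARD('n)" and \<omega>_def: "\<omega> = measure lebesgue (ball (0 :: real ^ 'n) 1)"
    and \<alpha>_def: "\<alpha> = 2 - d / q"
    and dim3: "3 \<le> CARD('n)" and q: "real CARD('n) / 2 < q"
    and V_nonneg: "AE x in lebesgue. 0 \<le> V x"
    and V_nonzero: "\<not> (AE x in lebesgue. V x = 0)"
    and RH: "reverse_Hoelder q V"
begin

definition \<mu> :: "(real ^ 'n) set \<Rightarrow> real" where "\<mu> E = (LINT z:E|lebesgue. V z)"
definition \<nu> :: "(real ^ 'n) set \<Rightarrow> real" where "\<nu> E = (LINT z:E|lebesgue. V z powr q)"

lemma d3: "3 \<le> d" using dim3 by (simp add: d_eq)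

lemma q1: "1 < q" using dim3 q by simp

lemma \<alpha>_pos: "0 < \<alpha>" using q q1 by (simp add: \<alpha>_def d_eq field_simps)

lemma \<omega>_pos: "0 < \<omega>"
  using content_ball_pos[of 1 "0 :: real ^ 'n"] by (simp add: \<omega>_def measure_completion)

lemma measure_ball: "0 \<le> r \<Longrightarrow> measure lebesgue (ball (x :: real ^ 'n) r) = \<omega> * r powr d"
  using measure_ball_power[of r x] by (cases "r = 0") (simp_all add: \<omega>_def d_eq powr_realpow mult.commute)

lemma set_integrable_V:
  assumes "bounded E" "E \<in> sets lebesgue"
  shows "set_integrable lebesgue E V" "set_integrable lebesgue E (\<lambda>z. V z powr q)"
proof -
  obtain r where "E \<subseteq> cball 0 r" using assms(1) bounded_subset_ballD ball_subset_cball by (meson order_trans)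
  moreover have "set_integrable lebesgue (cball 0 r) V" "set_integrable lebesgue (cball 0 r) (\<lambda>z. V z powr q)"
    using RH by (auto simp: reverse_Hoelder_def locally_integrable_on_def)
  ultimately show "set_integrable lebesgue E V" "set_integrable lebesgue E (\<lambda>z. V z powr q)"
    using assms(2) by (blast intro: set_integrable_subset)+
qed

lemma V_measurable: "V \<in> borel_measurable lebesgue"
  using RH locally_integrable_measurable by (auto simp: reverse_Hoelder_def)

lemma \<nu>_nonneg: "0 \<le> \<nu> E"
  unfolding \<nu>_def set_lebesgue_integral_def by (intro integral_nonneg_AE AE_I2) simp

lemma \<nu>_mono: "E \<subseteq> F \<Longrightarrow> bounded F \<Longrightarrow> E \<in> sets lebesgue \<Longrightarrow> F \<in> sets lebesgue \<Longrightarrow> \<nu> E \<le> \<nu> F"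
  unfolding \<nu>_def
  using set_integrable_V(2)[of E] set_integrable_V(2)[of F] bounded_subset[of F E]
  unfolding set_lebesgue_integral_def set_integrable_def
  by (intro integral_mono_AE AE_I2) (auto simp: indicator_def)

lemma \<mu>_nonneg: "0 \<le> \<mu> E"
  unfolding \<mu>_def set_lebesgue_integral_def
  by (rule integral_nonneg_AE) (use V_nonneg in eventually_elim, simp)

lemma \<mu>_le: 
  assumes "bounded E" "E \<in> sets lebesgue"
  shows "\<mu> E \<le> measure lebesgue E powr (1 - 1 / q) * \<nu> E powr (1 / q)"
  unfolding \<mu>_def \<nu>_def
  by (rule power_mean_inequality[OF V_nonneg q1 bounded_set_imp_lmeasurable set_integrable_V]) (use assms in auto)

lemma nn_integral_V:
  assumes "bounded E" "E \<in> sets lebesgue"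
  shows "(\<integral>\<^sup>+z. ennreal (V z) * indicator E z \<partial>lebesgue) = ennreal (\<mu> E)"
proof -
  have "(\<integral>\<^sup>+z. ennreal (V z) * indicator E z \<partial>lebesgue) = (\<integral>\<^sup>+z. ennreal (indicator E z *\<^sub>R V z) \<partial>lebesgue)"
    by (intro nn_integral_cong) (simp add: indicator_def)
  also have "\<dots> = ennreal (\<mu> E)"
    unfolding \<mu>_def set_lebesgue_integral_def
    by (rule nn_integral_eq_integral)
      (use set_integrable_V(1)[OF assms] V_nonneg in \<open>auto simp: set_integrable_def indicator_def elim: eventually_mono\<close>)
  finally show ?thesis .
qed

lemma reverse_Hoelder_ball:
  obtains C where "1 \<le> C" "\<And>x r. 0 < r \<Longrightarrow> \<nu> (ball x r) powr (1 / q) \<le> C * measure lebesgue (ball x r) powr (1 / q - 1) * \<mu> (ball x r)"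
proof -
  obtain C0 where C0: "\<And>x r. 0 < r \<Longrightarrow> (1 / measure lebesgue (ball x r) * \<nu> (ball x r)) powr (1 / q)
     \<le> C0 * (1 / measure lebesgue (ball x r) * \<mu> (ball x r))"
    using RH unfolding reverse_Hoelder_def \<mu>_def \<nu>_def by blast
  show ?thesis
  proof (rule that[of "max 1 C0"])
    fix x :: "real ^ 'n" and r :: real assume r: "0 < r"
    define b where "b = measure lebesgue (ball x r)"
    have b: "0 < b" using r \<omega>_pos by (simp add: b_def measure_ball)
    have "(1 / b * \<nu> (ball x r)) powr (1 / q) = \<nu> (ball x r) powr (1 / q) * b powr (- 1 / q)"
      using b \<nu>_nonneg by (simp add: powr_divide powr_minus_divide)
    then have "\<nu> (ball x r) powr (1 / q) * b powr (- 1 / q) \<le> C0 * (1 / b * \<mu> (ball x r))"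
      using C0[OF r, of x] by (simp add: b_def)
    also have "\<dots> \<le> max 1 C0 * (1 / b * \<mu> (ball x r))"
      using b \<mu>_nonneg by (intro mult_right_mono) auto
    finally have "\<nu> (ball x r) powr (1 / q) * b powr (- 1 / q) * b powr (1 / q) \<le> max 1 C0 * (1 / b * \<mu> (ball x r)) * b powr (1 / q)"
      by (rule mult_right_mono) simp
    moreover have "b powr (- 1 / q) * b powr (1 / q) = 1" using b by (simp flip: powr_add)
    then have "\<nu> (ball x r) powr (1 / q) * b powr (- 1 / q) * b powr (1 / q) = \<nu> (ball x r) powr (1 / q)"
      by (simp only: mult.assoc mult_1_right)
    moreover have "1 / b * b powr (1 / q) = b powr (1 / q - 1)" using b by (simp add: powr_diff)
    then have "max 1 C0 * (1 / b * \<mu> (ball x r)) * b powr (1 / q) = max 1 C0 * b powr (1 / q - 1) * \<mu> (ball x r)"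
      by (metis mult.assoc mult.commute)
    ultimately show "\<nu> (ball x r) powr (1 / q) \<le> max 1 C0 * measure lebesgue (ball x r) powr (1 / q - 1) * \<mu> (ball x r)"
      unfolding b_def[symmetric] by (simp only:)
  qed simp
qed

text \<open>One constant fixed for the whole locale makes the later bounds uniform over all
  balls.\<close>

definition RHC :: real where
  "RHC = (SOME C. 1 \<le> C \<and> (\<forall>x r. 0 < r \<longrightarrow> \<nu> (ball x r) powr (1 / q) \<le> C * measure lebesgue (ball x r) powr (1 / q - 1) * \<mu> (ball x r)))"

lemma RHC: "1 \<le> RHC"
  "0 < r \<Longrightarrow> \<nu> (ball x r) powr (1 / q) \<le> RHC * measure lebesgue (ball x r) powr (1 / q - 1) * \<mu> (ball x r)"
proof -
  have "\<exists>C. 1 \<le> C \<and> (\<forall>x r. 0 < r \<longrightarrow> \<nu> (ball x r) powr (1 / q) \<le> C * measure lebesgue (ball x r) powr (1 / q - 1) * \<mu> (ball x r))"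
    using reverse_Hoelder_ball by metis
  from someI_ex[OF this]
  show "1 \<le> RHC" "0 < r \<Longrightarrow> \<nu> (ball x r) powr (1 / q) \<le> RHC * measure lebesgue (ball x r) powr (1 / q - 1) * \<mu> (ball x r)"
    unfolding RHC_def by blast+
qed

text \<open>Hoelder on the small ball, monotonicity of the q-mass, and reverse Hoelder on the large
  ball. The exponent d - d/q equals d - 2 + \<alpha>, so r^(2-d) \<mu>(ball x r) behaves at best
  like r^\<alpha> for small r.\<close>

lemma \<mu>_ball_ratio:
  assumes "0 < s" "s \<le> r"
  shows "\<mu> (ball x s) \<le> RHC * (s / r) powr (d - d / q) * \<mu> (ball x r)"
proof -
  have r: "0 < r" using assms by simp
  define e where "e = 1 - 1 / q"
  have e: "0 < e" using q1 by (simp add: e_def)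
  have "\<mu> (ball x s) \<le> measure lebesgue (ball x s) powr e * \<nu> (ball x s) powr (1 / q)"
    unfolding e_def by (rule \<mu>_le) auto
  also have "\<dots> \<le> measure lebesgue (ball x s) powr e * \<nu> (ball x r) powr (1 / q)"
    using assms q1 \<nu>_nonneg by (intro mult_left_mono powr_mono2 \<nu>_mono) auto
  also have "\<dots> \<le> measure lebesgue (ball x s) powr e * (RHC * measure lebesgue (ball x r) powr (- e) * \<mu> (ball x r))"
    using RHC(2)[OF r, of x] by (intro mult_left_mono) (simp_all add: e_def)
  also have "\<dots> = RHC * (measure lebesgue (ball x s) powr e * measure lebesgue (ball x r) powr (- e)) * \<mu> (ball x r)"
    by (simp add: mult_ac)
  also have "measure lebesgue (ball x s) powr e * measure lebesgue (ball x r) powr (- e) = (s / r) powr (d * e)"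
    unfolding measure_ball[OF less_imp_le[OF assms(1)]] measure_ball[OF less_imp_le[OF r]]
    using assms r \<omega>_pos
    by (simp add: powr_mult powr_powr powr_divide powr_minus field_simps)
  also have "d * e = d - d / q" by (simp add: e_def algebra_simps)
  finally show ?thesis .
qed

text \<open>The central form of Gehring's self-improvement: it gains a power of the radius in the
  borderline case \<open>d = q = 3\<close>, in which Hoelder's inequality alone loses a logarithm.\<close>

lemma \<nu>_decay:
  obtains \<theta> c where "0 < \<theta>" "\<theta> < 1" "0 < c" "c < 1" "\<And>x s. 0 < s \<Longrightarrow> \<nu> (ball x (\<theta> * s)) \<le> c * \<nu> (ball x s)"
proof -
  have C: "1 \<le> RHC" by (rule RHC(1))
  define \<beta> where "\<beta> = d - d / q"
  have \<beta>: "0 < \<beta>" using q1 d3 by (simp add: \<beta>_def field_simps)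
  \<comment> \<open>Chosen so that, by \<open>\<mu>_ball_ratio\<close>, the ball of radius \<theta>
    s carries at most half of the \<mu>-mass of the ball of radius s.\<close>
  define \<theta> where "\<theta> = (1 / (2 * RHC)) powr (1 / \<beta>)"
  have \<theta>\<beta>: "\<theta> powr \<beta> = 1 / (2 * RHC)" using C \<beta> by (simp add: \<theta>_def powr_powr)
  have "(1 / (2 * RHC)) powr (1 / \<beta>) < 1 powr (1 / \<beta>)"
    using C \<beta> by (intro powr_less_mono2) auto
  then have \<theta>: "0 < \<theta>" "\<theta> < 1" using C by (auto simp: \<theta>_def)
  \<comment> \<open>The annulus then carries at least half of the \<mu>-mass, and Hoelder on it
    followed by reverse Hoelder on the ball gives it at least the fraction (2 RHC)^(-q) of the
    \<nu>-mass.\<close>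
  define t where "t = (2 * RHC) powr (- q)"
  have "(2 * RHC) powr (- q) < (2 * RHC) powr 0" using C q1 by (intro powr_less_mono) auto
  then have t: "0 < t" "t < 1" using C by (auto simp: t_def)
  show ?thesis
  proof (rule that[OF \<theta>, of "1 - t"])
    fix x :: "real ^ 'n" and s :: real assume s: "0 < s"
    let ?B = "ball x s" and ?b = "ball x (\<theta> * s)"
    have sub: "?b \<subseteq> ?B" using \<theta> s by (intro subset_ball) (simp add: mult_left_le_one_le)
    have bB: "bounded (?B - ?b)" "?B - ?b \<in> sets lebesgue" using bounded_diff by auto
    define e where "e = 1 - 1 / q"
    define W where "W = measure lebesgue ?B"
    have e: "0 < e" using q1 by (simp add: e_def)
    have W: "0 < W" using s \<omega>_pos by (simp add: W_def measure_ball)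
    have \<mu>diff: "\<mu> (?B - ?b) = \<mu> ?B - \<mu> ?b"
      unfolding \<mu>_def using sub by (intro set_integral_diff_set set_integrable_V) auto
    have \<nu>diff: "\<nu> (?B - ?b) = \<nu> ?B - \<nu> ?b"
      unfolding \<nu>_def using sub by (intro set_integral_diff_set set_integrable_V) auto
    have "\<mu> ?b \<le> RHC * (\<theta> * s / s) powr \<beta> * \<mu> ?B"
      unfolding \<beta>_def using \<theta> s by (intro \<mu>_ball_ratio) (auto simp: mult_left_le_one_le)
    also have "\<dots> = \<mu> ?B / 2" using s C by (simp add: \<theta>\<beta>)
    finally have "\<mu> ?B \<le> 2 * \<mu> (?B - ?b)" by (simp add: \<mu>diff)
    also have "\<mu> (?B - ?b) \<le> measure lebesgue (?B - ?b) powr e * \<nu> (?B - ?b) powr (1 / q)"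
      unfolding e_def by (rule \<mu>_le[OF bB])
    also have "\<dots> \<le> W powr e * \<nu> (?B - ?b) powr (1 / q)"
      using e unfolding W_def
      by (intro mult_right_mono powr_mono2 measure_mono_fmeasurable bounded_set_imp_lmeasurable) auto
    finally have 1: "\<mu> ?B \<le> 2 * (W powr e * \<nu> (?B - ?b) powr (1 / q))" by simp
    have "\<nu> ?B powr (1 / q) \<le> RHC * W powr (- e) * \<mu> ?B"
      using RHC(2)[OF s, of x] by (simp add: W_def e_def)
    also have "\<dots> \<le> RHC * W powr (- e) * (2 * (W powr e * \<nu> (?B - ?b) powr (1 / q)))"
      using C by (intro mult_left_mono 1) auto
    also have "\<dots> = (2 * RHC) * (W powr (- e) * W powr e) * \<nu> (?B - ?b) powr (1 / q)"
      by (simp add: mult_ac)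
    also have "W powr (- e) * W powr e = 1" using W by (simp flip: powr_add)
    finally have "\<nu> ?B powr (1 / q) \<le> (2 * RHC) * \<nu> (?B - ?b) powr (1 / q)" by simp
    then have "(\<nu> ?B powr (1 / q)) powr q \<le> ((2 * RHC) * \<nu> (?B - ?b) powr (1 / q)) powr q"
      using q1 by (intro powr_mono2) auto
    then have "\<nu> ?B \<le> (2 * RHC) powr q * \<nu> (?B - ?b)"
      using q1 C \<nu>_nonneg by (simp add: powr_mult powr_powr)
    then have "t * \<nu> ?B \<le> t * ((2 * RHC) powr q * \<nu> (?B - ?b))"
      using t by (intro mult_left_mono) auto
    also have "\<dots> = \<nu> (?B - ?b)"
      using C by (simp add: t_def powr_minus field_simps)
    finally show "\<nu> ?b \<le> (1 - t) * \<nu> ?B" by (simp add: \<nu>diff algebra_simps)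
  qed (use t in auto)
qed

subsection \<open>The critical radius\<close>

definition crit_set :: "real ^ 'n \<Rightarrow> real set" where
  "crit_set x = {r. 0 < r \<and> 1 / r ^ (CARD('n) - 2) * \<mu> (ball x r) \<le> 1}"

lemma crit_radius_eq: "crit_radius V x = Sup (crit_set x)"
  by (simp add: crit_radius_def crit_set_def \<mu>_def)

lemma crit_set_iff: "r \<in> crit_set x \<longleftrightarrow> 0 < r \<and> \<mu> (ball x r) \<le> r powr (d - 2)"
proof (cases "0 < r")
  case True
  have "r ^ (CARD('n) - 2) = r powr (d - 2)"
    using True dim3 powr_realpow[of r "CARD('n) - 2"] by (simp add: d_eq of_nat_diff)
  then show ?thesis using True by (simp add: crit_set_def field_simps)
qed (simp add: crit_set_def)

lemma \<mu>_ball_pos_ex: "\<exists>s>0. 0 < \<mu> (ball x s)"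
proof (rule ccontr)
  assume "\<not> ?thesis"
  then have 0: "\<mu> (ball x s) = 0" if "0 < s" for s
    using that \<mu>_nonneg[of "ball x s"] by force
  have "AE z in lebesgue. indicator (ball x (real (Suc n))) z *\<^sub>R V z = 0" for n
  proof -
    have "AE z in lebesgue. 0 \<le> indicator (ball x (real (Suc n))) z *\<^sub>R V z"
      using V_nonneg by eventually_elim simp
    then show ?thesis
      using integral_nonneg_eq_0_iff_AE[of lebesgue "\<lambda>z. indicator (ball x (real (Suc n))) z *\<^sub>R V z"]
        0[of "real (Suc n)"] set_integrable_V(1)[of "ball x (real (Suc n))"]
      unfolding \<mu>_def set_lebesgue_integral_def set_integrable_def by auto
  qed
  then have "AE z in lebesgue. \<forall>n. indicator (ball x (real (Suc n))) z *\<^sub>R V z = 0"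
    by (simp only: AE_all_countable) simp
  then have "AE z in lebesgue. V z = 0"
  proof eventually_elim
    fix z assume z: "\<forall>n. indicator (ball x (real (Suc n))) z *\<^sub>R V z = 0"
    obtain n where "dist x z < real n" using reals_Archimedean2 by blast
    then have "z \<in> ball x (real (Suc n))" by simp
    then show "V z = 0" using z[rule_format, of n] by simp
  qed
  then show False using V_nonzero by simp
qed

text \<open>Some ball of radius s around x has positive mass. For r \<ge> s in the set,
  \<open>\<mu>_ball_ratio\<close> bounds that mass by a multiple of r^(-\<alpha>), so r cannot be
  large. This boundedness gives the real supremum its meaning.\<close>

lemma bdd_above_crit_set: "bdd_above (crit_set x)"
proof -
  obtain s where s: "0 < s" "0 < \<mu> (ball x s)" using \<mu>_ball_pos_ex by blast
  define D where "D = RHC * s powr (d - d / q) / \<mu> (ball x s)"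
  have "r \<le> max s (D powr (1 / \<alpha>))" if "r \<in> crit_set x" for r
  proof (cases "s \<le> r")
    case True
    have r: "0 < r" "\<mu> (ball x r) \<le> r powr (d - 2)" using that by (auto simp: crit_set_iff)
    have "\<mu> (ball x s) \<le> RHC * (s / r) powr (d - d / q) * \<mu> (ball x r)"
      by (rule \<mu>_ball_ratio[OF s(1) True])
    also have "\<dots> \<le> RHC * (s / r) powr (d - d / q) * r powr (d - 2)"
      using r RHC(1) by (intro mult_left_mono) auto
    also have "\<dots> = RHC * s powr (d - d / q) * r powr (- \<alpha>)"
      using r s by (simp add: powr_divide \<alpha>_def powr_diff field_simps powr_minus flip: powr_add)
    finally have "r powr \<alpha> * \<mu> (ball x s) \<le> r powr \<alpha> * (RHC * s powr (d - d / q) * r powr (- \<alpha>))"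
      by (intro mult_left_mono) auto
    also have "\<dots> = RHC * s powr (d - d / q)" using r by (simp add: powr_minus)
    finally have "r powr \<alpha> \<le> D" using s by (simp add: D_def field_simps)
    then have "(r powr \<alpha>) powr (1 / \<alpha>) \<le> D powr (1 / \<alpha>)"
      using \<alpha>_pos by (intro powr_mono2) auto
    then have "r \<le> D powr (1 / \<alpha>)" using r \<alpha>_pos by (simp add: powr_powr)
    then show ?thesis by simp
  qed simp
  then show ?thesis by (rule bdd_aboveI)
qed

text \<open>By \<open>\<mu>_ball_ratio\<close> the normalised mass r^(2-d) \<mu>(ball x r) is at
  most r^\<alpha> RHC \<mu>(ball x 1) for r \<le> 1; the radius chosen has r^\<alpha> = 1/D, with D
  larger than that product.\<close>

lemma crit_set_nonempty: "crit_set x \<noteq> {}"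
proof -
  define D where "D = RHC * \<mu> (ball x 1) + 1"
  have D: "1 \<le> D" using RHC(1) \<mu>_nonneg by (simp add: D_def)
  define r where "r = D powr (- 1 / \<alpha>)"
  have "D powr (- 1 / \<alpha>) \<le> D powr 0" using D \<alpha>_pos by (intro powr_mono) auto
  then have r: "0 < r" "r \<le> 1" using D by (auto simp: r_def)
  have "r powr \<alpha> = D powr (- 1 / \<alpha> * \<alpha>)" unfolding r_def by (rule powr_powr)
  also have "- 1 / \<alpha> * \<alpha> = - 1" using \<alpha>_pos by simp
  finally have r\<alpha>: "r powr \<alpha> = 1 / D" using D by (simp add: powr_minus_divide)
  have "\<mu> (ball x r) \<le> RHC * (r / 1) powr (d - d / q) * \<mu> (ball x 1)" by (rule \<mu>_ball_ratio[OF r])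
  also have "\<dots> = r powr (d - 2 + \<alpha>) * (RHC * \<mu> (ball x 1))" by (simp add: \<alpha>_def)
  also have "\<dots> = r powr (d - 2) * (RHC * \<mu> (ball x 1) / D)" using r by (simp add: powr_add r\<alpha>)
  also have "\<dots> \<le> r powr (d - 2) * 1" using D by (intro mult_left_mono) (auto simp: D_def)
  finally have "r \<in> crit_set x" using r by (simp add: crit_set_iff)
  then show ?thesis by blast
qed

lemma crit_radius_pos: "0 < crit_radius V x"
proof -
  obtain r where "r \<in> crit_set x" using crit_set_nonempty by blast
  then show ?thesis unfolding crit_radius_eq
    using cSup_upper[OF _ bdd_above_crit_set, of r x] by (auto simp: crit_set_iff)
qed

text \<open>The inequality defining the critical radius survives at the supremum: open balls whose
  radii increase to \<rho> exhaust the ball of radius \<rho>, and dominated convergence passes to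
  the limit.\<close>

lemma \<mu>_crit_ball: "\<mu> (ball x (crit_radius V x)) \<le> crit_radius V x powr (d - 2)"
proof -
  let ?\<rho> = "crit_radius V x"
  have "\<exists>r\<in>crit_set x. ?\<rho> - inverse (real (Suc n)) < r" for n
    unfolding crit_radius_eq
    by (rule less_cSup_iff[OF crit_set_nonempty bdd_above_crit_set, THEN iffD1]) simp
  then obtain r where r: "\<And>n. r n \<in> crit_set x" "\<And>n. ?\<rho> - inverse (real (Suc n)) < r n" by metis
  have r\<rho>: "r n \<le> ?\<rho>" for n unfolding crit_radius_eq by (rule cSup_upper[OF r(1) bdd_above_crit_set])
  have rlim: "r \<longlonglongrightarrow> ?\<rho>"
  proof (rule tendsto_sandwich)
    show "\<forall>\<^sub>F n in sequentially. ?\<rho> - inverse (real (Suc n)) \<le> r n" using r(2) by (simp add: less_imp_le)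
    show "\<forall>\<^sub>F n in sequentially. r n \<le> ?\<rho>" using r\<rho> by simp
    show "(\<lambda>n. ?\<rho> - inverse (real (Suc n))) \<longlonglongrightarrow> ?\<rho>"
      using tendsto_diff[OF tendsto_const LIMSEQ_inverse_real_of_nat, of ?\<rho>] by simp
  qed simp
  have "(\<lambda>n. LINT z|lebesgue. indicator (ball x (r n)) z *\<^sub>R V z) \<longlonglongrightarrow> (LINT z|lebesgue. indicator (ball x ?\<rho>) z *\<^sub>R V z)"
  proof (rule integral_dominated_convergence)
    have i: "integrable lebesgue (\<lambda>z. indicator (ball x s) z *\<^sub>R V z)" for s
      using set_integrable_V(1)[of "ball x s"] by (simp add: set_integrable_def)
    show "integrable lebesgue (\<lambda>z. \<bar>indicator (ball x ?\<rho>) z *\<^sub>R V z\<bar>)" using i by (rule integrable_abs)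
    show "(\<lambda>z. indicator (ball x ?\<rho>) z *\<^sub>R V z) \<in> borel_measurable lebesgue"
      "\<And>n. (\<lambda>z. indicator (ball x (r n)) z *\<^sub>R V z) \<in> borel_measurable lebesgue"
      by (rule borel_measurable_integrable[OF i])+
    show "AE z in lebesgue. norm (indicator (ball x (r n)) z *\<^sub>R V z) \<le> \<bar>indicator (ball x ?\<rho>) z *\<^sub>R V z\<bar>" for n
      using r\<rho>[of n] by (intro AE_I2) (auto simp: indicator_def)
    show "AE z in lebesgue. (\<lambda>n. indicator (ball x (r n)) z *\<^sub>R V z) \<longlonglongrightarrow> indicator (ball x ?\<rho>) z *\<^sub>R V z"
    proof (intro AE_I2 tendsto_eventually)
      fix z
      show "\<forall>\<^sub>F n in sequentially. indicator (ball x (r n)) z *\<^sub>R V z = indicator (ball x ?\<rho>) z *\<^sub>R V z"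
      proof (cases "dist x z < ?\<rho>")
        case True
        from order_tendstoD(1)[OF rlim True] show ?thesis
          by eventually_elim (use True in simp)
      next
        case False
        then have "\<not> dist x z < r n" for n using r\<rho>[of n] by simp
        then show ?thesis using False by simp
      qed
    qed
  qed
  then have "(\<lambda>n. \<mu> (ball x (r n))) \<longlonglongrightarrow> \<mu> (ball x ?\<rho>)" by (simp add: \<mu>_def set_lebesgue_integral_def)
  then show ?thesis
  proof (rule LIMSEQ_le_const2, intro exI allI impI)
    fix n
    have "\<mu> (ball x (r n)) \<le> r n powr (d - 2)" using r(1)[of n] by (simp add: crit_set_iff)
    also have "\<dots> \<le> ?\<rho> powr (d - 2)"
      using r(1)[of n] r\<rho>[of n] d3 by (intro powr_mono2) (auto simp: crit_set_iff)
    finally show "\<mu> (ball x (r n)) \<le> ?\<rho> powr (d - 2)" .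
  qed
qed

lemma \<nu>_crit_ball: "\<nu> (ball x (crit_radius V x)) powr (1 / q) \<le> RHC * \<omega> powr (1 / q - 1) * crit_radius V x powr (- \<alpha>)"
proof -
  let ?\<rho> = "crit_radius V x"
  have \<rho>: "0 < ?\<rho>" by (rule crit_radius_pos)
  have "\<nu> (ball x ?\<rho>) powr (1 / q) \<le> RHC * measure lebesgue (ball x ?\<rho>) powr (1 / q - 1) * \<mu> (ball x ?\<rho>)"
    by (rule RHC(2)[OF \<rho>])
  also have "\<dots> \<le> RHC * measure lebesgue (ball x ?\<rho>) powr (1 / q - 1) * ?\<rho> powr (d - 2)"
    using RHC(1) by (intro mult_left_mono \<mu>_crit_ball) auto
  also have "\<dots> = RHC * \<omega> powr (1 / q - 1) * (?\<rho> powr (d * (1 / q - 1)) * ?\<rho> powr (d - 2))"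
    unfolding measure_ball[OF less_imp_le[OF \<rho>]]
    using \<rho> \<omega>_pos by (simp add: powr_mult powr_powr mult_ac)
  also have "?\<rho> powr (d * (1 / q - 1)) * ?\<rho> powr (d - 2) = ?\<rho> powr (- \<alpha>)"
    by (simp add: \<alpha>_def algebra_simps flip: powr_add)
  finally show ?thesis .
qed

end

section \<open>Weighted integrals of the potential at the critical scale\<close>

context rh_potential
begin

definition \<delta> :: real where "\<delta> = min 1 \<alpha>"

lemma \<delta>: "0 < \<delta>" "\<delta> \<le> 1" "\<delta> \<le> \<alpha>"
  using \<alpha>_pos by (auto simp: \<delta>_def)

text \<open>Keeping \<open>E\<close> apart from the balls around \<open>a\<close> serves both the
  case where the critical ball is concentric with the weight and the case where it is not.\<close>

lemma V_weighted_bound: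
  assumes E: "bounded E" "E \<in> sets lebesgue" and \<theta>: "0 < \<theta>" "\<theta> < 1" and r: "0 < r"
    and p: "0 \<le> p" and K: "0 \<le> K" and g: "0 \<le> g" "g < 1"
    and bound: "\<And>j. \<mu> (E \<inter> ball a (\<theta> ^ j * r)) \<le> K * (\<theta> ^ j * r) powr p * g ^ j"
  shows "(\<integral>\<^sup>+z. ennreal (norm (z - a) powr (- p)) * (ennreal (V z) * indicator E z * indicator (ball a r) z) \<partial>lebesgue)
    \<le> ennreal (K * \<theta> powr (- p) / (1 - g))"
proof (rule nn_integral_theta_adic[OF _ \<theta> r p K g])
  show "(\<lambda>z. ennreal (V z) * indicator E z) \<in> borel_measurable lebesgue"
    by (intro borel_measurable_times_ennreal borel_measurable_indicator E measurable_compose[OF V_measurable measurable_ennreal])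
  fix j
  have "(\<integral>\<^sup>+z. ennreal (V z) * indicator E z * indicator (ball a (\<theta> ^ j * r)) z \<partial>lebesgue)
      = (\<integral>\<^sup>+z. ennreal (V z) * indicator (E \<inter> ball a (\<theta> ^ j * r)) z \<partial>lebesgue)"
    by (simp only: mult.assoc indicator_inter_arith[symmetric])
  also have "\<dots> = ennreal (\<mu> (E \<inter> ball a (\<theta> ^ j * r)))"
    using E by (intro nn_integral_V bounded_Int sets.Int) auto
  also have "\<dots> \<le> ennreal (K * (\<theta> ^ j * r) powr p * g ^ j)" by (intro ennreal_leI bound)
  finally show "(\<integral>\<^sup>+z. ennreal (V z) * indicator E z * indicator (ball a (\<theta> ^ j * r)) z \<partial>lebesgue)
    \<le> ennreal (K * (\<theta> ^ j * r) powr p * g ^ j)" .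
qed

lemma measure_ball_powr:
  "0 < s \<Longrightarrow> measure lebesgue (ball (a :: real ^ 'n) s) powr (1 - 1 / q) = \<omega> powr (1 - 1 / q) * s powr (d - 2 + \<alpha>)"
  using \<omega>_pos unfolding measure_ball[OF less_imp_le, of s a]
  by (simp add: powr_mult powr_powr \<alpha>_def algebra_simps)

text \<open>If q \<le> d then \<delta> = \<alpha>, and Hoelder alone would bound all shells by the
  same amount. Iterating \<open>\<nu>_decay\<close> supplies the ratio g = c^(1/q) < 1 that makes
  the series converge. If \<alpha> > \<delta>, the surplus power of the radius is bounded by its
  value at \<rho>.\<close>

lemma central_weight_bound:
  "\<exists>K\<ge>0. \<forall>x. ((\<integral>\<^sup>+z. ennreal (norm (z - x) powr (- (d - 2 + \<delta>))) * (ennreal (V z) * indicator (ball x (crit_radius V x)) z) \<partial>lebesgue)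
      \<le> ennreal (K * crit_radius V x powr (- \<delta>)))"
proof -
  obtain \<theta> c where \<theta>: "0 < \<theta>" "\<theta> < 1" and c: "0 < c" "c < 1"
    and decay: "\<And>x s. 0 < s \<Longrightarrow> \<nu> (ball x (\<theta> * s)) \<le> c * \<nu> (ball x s)" using \<nu>_decay by metis
  define g where "g = c powr (1 / q)"
  have "c powr (1 / q) < 1 powr (1 / q)" using c q1 by (intro powr_less_mono2) auto
  then have g: "0 \<le> g" "g < 1" using c by (auto simp: g_def)
  define L where "L = \<omega> powr (1 - 1 / q) * (RHC * \<omega> powr (1 / q - 1))"
  have L: "0 \<le> L" using RHC(1) by (simp add: L_def)
  define K where "K = L * \<theta> powr (- (d - 2 + \<delta>)) / (1 - g)"
  show ?thesis
  proof (intro exI[of _ K] conjI allI)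
    show "0 \<le> K" using L g by (simp add: K_def)
    fix x
    let ?\<rho> = "crit_radius V x"
    have \<rho>: "0 < ?\<rho>" by (rule crit_radius_pos)
    have it: "\<nu> (ball x (\<theta> ^ j * ?\<rho>)) \<le> c ^ j * \<nu> (ball x ?\<rho>)" for j
    proof (induction j)
      case (Suc j)
      have "\<nu> (ball x (\<theta> * (\<theta> ^ j * ?\<rho>))) \<le> c * \<nu> (ball x (\<theta> ^ j * ?\<rho>))"
        using \<theta> \<rho> by (intro decay) simp
      also have "\<dots> \<le> c * (c ^ j * \<nu> (ball x ?\<rho>))" using c Suc by (intro mult_left_mono) auto
      finally show ?case by (simp add: mult.assoc)
    qed simp
    have "(\<integral>\<^sup>+z. ennreal (norm (z - x) powr (- (d - 2 + \<delta>))) * (ennreal (V z) * indicator (ball x ?\<rho>) z * indicator (ball x ?\<rho>) z) \<partial>lebesgue)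
      \<le> ennreal ((L * ?\<rho> powr (- \<delta>)) * \<theta> powr (- (d - 2 + \<delta>)) / (1 - g))"
    proof (rule V_weighted_bound[OF _ _ \<theta> \<rho> _ _ g])
      show "0 \<le> d - 2 + \<delta>" using d3 \<delta> by simp
      show "0 \<le> L * ?\<rho> powr (- \<delta>)" using L by simp
      fix j
      define s where "s = \<theta> ^ j * ?\<rho>"
      have "\<theta> ^ j \<le> 1" using \<theta> by (intro power_le_one) auto
      then have s: "0 < s" "s \<le> ?\<rho>" using \<theta> \<rho> by (auto simp: s_def)
      have "ball x ?\<rho> \<inter> ball x s = ball x s" using s subset_ball[of s ?\<rho> x] by blast
      then have "\<mu> (ball x ?\<rho> \<inter> ball x s) \<le> measure lebesgue (ball x s) powr (1 - 1 / q) * \<nu> (ball x s) powr (1 / q)"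
        using \<mu>_le[of "ball x s"] by simp
      also have "\<dots> \<le> measure lebesgue (ball x s) powr (1 - 1 / q) * (c ^ j * \<nu> (ball x ?\<rho>)) powr (1 / q)"
        using it[of j] q1 \<nu>_nonneg by (intro mult_left_mono powr_mono2) (auto simp: s_def)
      also have "(c ^ j * \<nu> (ball x ?\<rho>)) powr (1 / q) = g ^ j * \<nu> (ball x ?\<rho>) powr (1 / q)"
        using c \<nu>_nonneg by (simp add: powr_mult g_def powr_powr mult.commute flip: powr_realpow)
      also have "measure lebesgue (ball x s) powr (1 - 1 / q) * (g ^ j * \<nu> (ball x ?\<rho>) powr (1 / q))
          \<le> measure lebesgue (ball x s) powr (1 - 1 / q) * (g ^ j * (RHC * \<omega> powr (1 / q - 1) * ?\<rho> powr (- \<alpha>)))"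
        using g by (intro mult_left_mono \<nu>_crit_ball) auto
      also have "\<dots> = L * ?\<rho> powr (- \<alpha>) * g ^ j * s powr (d - 2 + \<alpha>)"
        by (simp only: measure_ball_powr[OF s(1)] L_def mult_ac)
      also have "s powr (d - 2 + \<alpha>) = s powr (d - 2 + \<delta>) * s powr (\<alpha> - \<delta>)"
        by (simp add: algebra_simps flip: powr_add)
      also have "L * ?\<rho> powr (- \<alpha>) * g ^ j * (s powr (d - 2 + \<delta>) * s powr (\<alpha> - \<delta>))
          \<le> L * ?\<rho> powr (- \<alpha>) * g ^ j * (s powr (d - 2 + \<delta>) * ?\<rho> powr (\<alpha> - \<delta>))"
        using L g s \<delta> by (intro mult_left_mono powr_mono2) auto
      also have "\<dots> = L * (?\<rho> powr (- \<alpha>) * ?\<rho> powr (\<alpha> - \<delta>)) * s powr (d - 2 + \<delta>) * g ^ j"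
        by (simp only: mult_ac)
      also have "?\<rho> powr (- \<alpha>) * ?\<rho> powr (\<alpha> - \<delta>) = ?\<rho> powr (- \<delta>)"
        by (simp add: algebra_simps flip: powr_add)
      finally show "\<mu> (ball x ?\<rho> \<inter> ball x (\<theta> ^ j * ?\<rho>)) \<le> L * ?\<rho> powr (- \<delta>) * (\<theta> ^ j * ?\<rho>) powr (d - 2 + \<delta>) * g ^ j"
        by (simp only: s_def)
    qed auto
    also have "(L * ?\<rho> powr (- \<delta>)) * \<theta> powr (- (d - 2 + \<delta>)) / (1 - g) = K * ?\<rho> powr (- \<delta>)"
      by (simp add: K_def)
    finally show "(\<integral>\<^sup>+z. ennreal (norm (z - x) powr (- (d - 2 + \<delta>))) * (ennreal (V z) * indicator (ball x ?\<rho>) z) \<partial>lebesgue)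
      \<le> ennreal (K * ?\<rho> powr (- \<delta>))"
      by (simp only: mult.assoc indicator_inter_arith[symmetric] Int_absorb)
  qed
qed

text \<open>For a centre y unrelated to x, the q-mass in \<open>ball y s\<close> is bounded by that
  of the whole critical ball. The weight has only exponent d - 2, so a factor s^\<alpha> remains and
  yields the geometric ratio 2^(-\<alpha>).\<close>

lemma offcentre_weight_bound:
  "\<exists>K\<ge>0. \<forall>x y r. 0 < r \<longrightarrow> ((\<integral>\<^sup>+z. ennreal (norm (z - y) powr (- (d - 2))) * (ennreal (V z) * indicator (ball x (crit_radius V x)) z * indicator (ball y r) z) \<partial>lebesgue)
      \<le> ennreal (K * (r / crit_radius V x) powr \<alpha>))"
proof -
  define g where "g = (1 / 2 :: real) powr \<alpha>"
  have "(1 / 2 :: real) powr \<alpha> < 1 powr \<alpha>" using \<alpha>_pos by (intro powr_less_mono2) auto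
  then have g: "0 \<le> g" "g < 1" by (auto simp: g_def)
  define L where "L = \<omega> powr (1 - 1 / q) * (RHC * \<omega> powr (1 / q - 1))"
  have L: "0 \<le> L" using RHC(1) by (simp add: L_def)
  define K where "K = L * (1 / 2) powr (- (d - 2)) / (1 - g)"
  show ?thesis
  proof (intro exI[of _ K] conjI allI impI)
    show "0 \<le> K" using L g by (simp add: K_def)
    fix x y and r :: real assume r: "0 < r"
    let ?\<rho> = "crit_radius V x"
    have \<rho>: "0 < ?\<rho>" by (rule crit_radius_pos)
    have "(\<integral>\<^sup>+z. ennreal (norm (z - y) powr (- (d - 2))) * (ennreal (V z) * indicator (ball x ?\<rho>) z * indicator (ball y r) z) \<partial>lebesgue)
      \<le> ennreal ((L * (r / ?\<rho>) powr \<alpha>) * (1 / 2) powr (- (d - 2)) / (1 - g))"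
    proof (rule V_weighted_bound[OF _ _ _ _ r _ _ g])
      show "0 \<le> d - 2" using d3 by simp
      show "0 \<le> L * (r / ?\<rho>) powr \<alpha>" using L by simp
      fix j
      define s where "s = (1 / 2) ^ j * r"
      have s: "0 < s" using r by (simp add: s_def)
      have bE: "bounded (ball x ?\<rho> \<inter> ball y s)" "ball x ?\<rho> \<inter> ball y s \<in> sets lebesgue" by (auto intro: bounded_Int)
      have "\<mu> (ball x ?\<rho> \<inter> ball y s) \<le> measure lebesgue (ball x ?\<rho> \<inter> ball y s) powr (1 - 1 / q) * \<nu> (ball x ?\<rho> \<inter> ball y s) powr (1 / q)"
        by (rule \<mu>_le[OF bE])
      also have "\<dots> \<le> measure lebesgue (ball y s) powr (1 - 1 / q) * \<nu> (ball x ?\<rho>) powr (1 / q)"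
      proof (intro mult_mono powr_mono2)
        show "measure lebesgue (ball x ?\<rho> \<inter> ball y s) \<le> measure lebesgue (ball y s)"
          by (intro measure_mono_fmeasurable bounded_set_imp_lmeasurable bE) auto
        show "\<nu> (ball x ?\<rho> \<inter> ball y s) \<le> \<nu> (ball x ?\<rho>)" by (intro \<nu>_mono bE) auto
      qed (use q1 \<nu>_nonneg in auto)
      also have "\<dots> \<le> measure lebesgue (ball y s) powr (1 - 1 / q) * (RHC * \<omega> powr (1 / q - 1) * ?\<rho> powr (- \<alpha>))"
        by (intro mult_left_mono \<nu>_crit_ball) auto
      also have "\<dots> = L * ?\<rho> powr (- \<alpha>) * s powr (d - 2 + \<alpha>)"
        by (simp only: measure_ball_powr[OF s] L_def mult_ac)
      also have "s powr (d - 2 + \<alpha>) = s powr (d - 2) * (r powr \<alpha> * g ^ j)"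
      proof -
        have "s powr \<alpha> = r powr \<alpha> * g ^ j"
          using r by (simp add: s_def powr_mult g_def powr_powr mult.commute flip: powr_realpow)
        then show ?thesis by (simp add: powr_add)
      qed
      also have "L * ?\<rho> powr (- \<alpha>) * (s powr (d - 2) * (r powr \<alpha> * g ^ j)) = L * (r / ?\<rho>) powr \<alpha> * s powr (d - 2) * g ^ j"
        using r \<rho> by (simp add: powr_divide powr_minus field_simps)
      finally show "\<mu> (ball x ?\<rho> \<inter> ball y ((1 / 2) ^ j * r)) \<le> L * (r / ?\<rho>) powr \<alpha> * ((1 / 2) ^ j * r) powr (d - 2) * g ^ j"
        by (simp only: s_def)
    qed auto
    also have "(L * (r / ?\<rho>) powr \<alpha>) * (1 / 2) powr (- (d - 2)) / (1 - g) = K * (r / ?\<rho>) powr \<alpha>"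
      by (simp add: K_def)
    finally show "(\<integral>\<^sup>+z. ennreal (norm (z - y) powr (- (d - 2))) * (ennreal (V z) * indicator (ball x ?\<rho>) z * indicator (ball y r) z) \<partial>lebesgue)
      \<le> ennreal (K * (r / ?\<rho>) powr \<alpha>)" .
  qed
qed

lemma newton_eq: "newton (x :: real ^ 'n) = norm x powr (- (d - 2))"
  by (simp add: newton_norm d_eq)

text \<open>Everything at distance at least \<open>\<rho>\<close> from \<open>x0\<close> is compared with the potential at the point
  \<open>x'\<close> opposite to \<open>y\<close>, so no decay of \<open>u\<close> beyond the critical scale is needed.\<close>

lemma outer_potential_bound:
  assumes c0: "0 \<le> c0"
  shows "\<exists>K\<ge>0. \<forall>x0 y R u. u \<in> borel_measurable lebesgue \<longrightarrow> (\<forall>z. z \<noteq> y \<longrightarrow> u z \<le> c0 * newton (z - y)) \<longrightarrow>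
      (\<forall>x. x \<noteq> y \<longrightarrow> (\<integral>\<^sup>+z. ennreal (newton (x - z)) * ennreal (V z * u z) \<partial>lebesgue) \<le> ennreal (newton (x - y))) \<longrightarrow>
      0 < R \<longrightarrow> R \<le> dist y x0 \<longrightarrow> dist y x0 \<le> crit_radius V x0 \<longrightarrow>
      ((\<integral>\<^sup>+z. ennreal (newton (z - x0)) * ennreal (V z * u z) * indicator (- ball x0 (R / 4)) z \<partial>lebesgue)
        \<le> ennreal (K * R powr (2 - d + \<delta>) * crit_radius V x0 powr (- \<delta>)))"
proof -
  obtain K1 where K1: "0 \<le> K1" and K1': "\<forall>x. ((\<integral>\<^sup>+z. ennreal (norm (z - x) powr (- (d - 2 + \<delta>))) * (ennreal (V z) * indicator (ball x (crit_radius V x)) z) \<partial>lebesgue)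
      \<le> ennreal (K1 * crit_radius V x powr (- \<delta>)))"
    using central_weight_bound by (elim exE conjE)
  obtain K2 where K2: "0 \<le> K2" and K2': "\<forall>x y r. 0 < r \<longrightarrow> ((\<integral>\<^sup>+z. ennreal (norm (z - y) powr (- (d - 2))) * (ennreal (V z) * indicator (ball x (crit_radius V x)) z * indicator (ball y r) z) \<partial>lebesgue)
      \<le> ennreal (K2 * (r / crit_radius V x) powr \<alpha>))"
    using offcentre_weight_bound by (elim exE conjE)
  define A where "A = 2 powr (d - 2)"
  define A4 where "A4 = 4 powr (d - 2 - \<delta>)"
  have A: "0 < A" "0 < A4" by (auto simp: A_def A4_def)
  \<comment> \<open>One summand for each region: the critical ball away from y (\<open>T1\<close>),
    the part of it close to y (\<open>T2\<close>), and the exterior of the critical ball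
    (\<open>T3\<close>).\<close>
  define K where "K = c0 * A * A4 * K1 + c0 * A * K2 + A"
  have half: "(s / 2) powr (- (d - 2)) = A * s powr (- (d - 2))" for s
  proof -
    have "(2 :: real) powr (- (d - 2)) = 1 / A" unfolding A_def by (rule powr_minus_divide)
    then show ?thesis by (simp only: powr_divide) simp
  qed
  \<comment> \<open>Here \<delta> \<le> 1 \<le> d - 2 enters: the power that is pulled out is
    nonincreasing, so it is controlled by its value at the smallest admissible radius.\<close>
  have e: "2 - d + \<delta> \<le> 0" using d3 \<delta> by simp
  show ?thesis
  proof (intro exI[of _ K] conjI allI impI)
    show "0 \<le> K" using c0 A K1 K2 by (simp add: K_def)
    fix x0 y :: "real ^ 'n" and R :: real and u :: "real ^ 'n \<Rightarrow> real"
    assume um: "u \<in> borel_measurable lebesgue" and ub: "\<forall>z. z \<noteq> y \<longrightarrow> u z \<le> c0 * newton (z - y)"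
      and pot: "\<forall>x. x \<noteq> y \<longrightarrow> (\<integral>\<^sup>+z. ennreal (newton (x - z)) * ennreal (V z * u z) \<partial>lebesgue) \<le> ennreal (newton (x - y))"
      and R: "0 < R" and Rr: "R \<le> dist y x0" and r\<rho>: "dist y x0 \<le> crit_radius V x0"
    define \<rho> where "\<rho> = crit_radius V x0"
    define r where "r = dist y x0"
    have r: "0 < r" "R \<le> r" "r \<le> \<rho>" "0 < \<rho>" using R Rr r\<rho> by (auto simp: r_def \<rho>_def)
    \<comment> \<open>On this side |x' - y| = \<rho> + r, so the kernel at y is at most
      \<rho>^(2-d); and every z with |z - x0| \<ge> \<rho> satisfies |x' - z| \<le> 2 |z -
      x0|.\<close>
    define x' where "x' = x0 - (\<rho> / r) *\<^sub>R (y - x0)"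
    have x'0: "norm (x' - x0) = \<rho>" using r by (simp add: x'_def r_def dist_norm)
    have x'y: "norm (x' - y) = \<rho> + r"
    proof -
      have "x' - y = - ((\<rho> / r + 1) *\<^sub>R (y - x0))" by (simp add: x'_def algebra_simps)
      then have "norm (x' - y) = \<bar>\<rho> / r + 1\<bar> * r" by (simp add: r_def dist_norm)
      also have "\<dots> = (\<rho> / r + 1) * r" using r by simp
      also have "\<dots> = \<rho> + r" using r by (simp add: algebra_simps)
      finally show ?thesis .
    qed
    define T1 where "T1 z = ennreal (norm (z - x0) powr (- (d - 2 + \<delta>))) * (ennreal (V z) * indicator (ball x0 \<rho>) z)" for z
    define T2 where "T2 z = ennreal (norm (z - y) powr (- (d - 2))) * (ennreal (V z) * indicator (ball x0 \<rho>) z * indicator (ball y r) z)" for z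
    define T3 where "T3 z = ennreal (newton (x' - z)) * ennreal (V z * u z)" for z
    define a1 where "a1 = c0 * A * (A4 * R powr (2 - d + \<delta>))"
    define a2 where "a2 = c0 * A * r powr (- (d - 2))"
    have a: "0 \<le> a1" "0 \<le> a2" using c0 A by (auto simp: a1_def a2_def)
    have Vm: "(\<lambda>z. ennreal (V z)) \<in> borel_measurable lebesgue"
      by (rule measurable_compose[OF V_measurable measurable_ennreal])
    have nm: "(\<lambda>z. ennreal (norm (z - b) powr s)) \<in> borel_measurable lebesgue" for b :: "real ^ 'n" and s
      by (rule measurable_lebesgue) measurable
    have im: "(indicator (ball b s) :: real ^ 'n \<Rightarrow> ennreal) \<in> borel_measurable lebesgue" for b s
      by (intro borel_measurable_indicator) auto
    have T1m: "T1 \<in> borel_measurable lebesgue" unfolding T1_def by (intro borel_measurable_times_ennreal nm Vm im)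
    have T2m: "T2 \<in> borel_measurable lebesgue" unfolding T2_def by (intro borel_measurable_times_ennreal nm Vm im)
    have T3m: "T3 \<in> borel_measurable lebesgue"
    proof -
      have "(\<lambda>z. ennreal (newton (x' - z))) \<in> borel_measurable lebesgue" by (rule measurable_lebesgue) measurable
      then show ?thesis unfolding T3_def
        by (intro borel_measurable_times_ennreal measurable_compose[OF borel_measurable_times[OF V_measurable um] measurable_ennreal])
    qed
    have pw: "AE z in lebesgue. ennreal (newton (z - x0)) * ennreal (V z * u z) * indicator (- ball x0 (R / 4)) z
        \<le> ennreal a1 * T1 z + ennreal a2 * T2 z + ennreal A * T3 z"
      using V_nonneg AE_lebesgue_neq[of y] AE_lebesgue_neq[of x']
    proof eventually_elim
      fix z assume Vz: "0 \<le> V z" and zy: "z \<noteq> y" and zx: "z \<noteq> x'"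
      let ?L = "ennreal (newton (z - x0)) * ennreal (V z * u z)"
      define t where "t = norm (z - x0)"
      show "?L * indicator (- ball x0 (R / 4)) z \<le> ennreal a1 * T1 z + ennreal a2 * T2 z + ennreal A * T3 z"
      proof (cases "z \<in> ball x0 (R / 4)")
        case False
        then have tR: "R / 4 \<le> t" by (simp add: t_def dist_norm norm_minus_commute)
        then have t: "0 < t" using R by simp
        have "?L \<le> ennreal a1 * T1 z + ennreal a2 * T2 z + ennreal A * T3 z"
        proof (cases "\<rho> \<le> t")
          case True
          have "norm (x' - z) \<le> norm (x' - x0) + norm (z - x0)"
            using norm_triangle_ineq4[of "x' - x0" "z - x0"] by simp
          then have le: "norm (x' - z) \<le> 2 * t" using True x'0 by (simp add: t_def)
          have "(2 * t) powr (- (d - 2)) \<le> norm (x' - z) powr (- (d - 2))"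
            using zx le d3 by (intro powr_mono2') auto
          then have "A * (2 * t) powr (- (d - 2)) \<le> A * norm (x' - z) powr (- (d - 2))"
            using A by (intro mult_left_mono) auto
          moreover have "A * (2 * t) powr (- (d - 2)) = t powr (- (d - 2))"
            using t by (simp add: A_def powr_mult flip: powr_add mult.assoc)
          ultimately have "newton (z - x0) \<le> A * newton (x' - z)" by (simp add: newton_eq t_def)
          then have "?L \<le> ennreal A * T3 z"
            unfolding T3_def mult.assoc[symmetric] ennreal_mult'[OF less_imp_le[OF A(1)], symmetric]
            by (intro mult_right_mono ennreal_leI) auto
          then show ?thesis by (simp add: add_increasing)
        next
          case tr: False
          have zin: "z \<in> ball x0 \<rho>" using tr by (simp add: t_def dist_norm norm_minus_commute)
          have uz: "V z * u z \<le> V z * (c0 * norm (z - y) powr (- (d - 2)))"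
            using ub zy Vz by (intro mult_left_mono) (simp_all add: newton_eq)
          have L: "?L \<le> ennreal (t powr (- (d - 2)) * (V z * (c0 * norm (z - y) powr (- (d - 2)))))"
            unfolding newton_eq t_def ennreal_mult'[OF powr_ge_zero, symmetric]
            by (intro ennreal_leI mult_left_mono[OF uz]) simp
          show ?thesis
          \<comment> \<open>Away from y, its singularity is dominated by the one at x0. If |z - y| <
            t/2, then z lies in \<open>ball y r\<close> and t \<ge> r/2, so the kernel at x0 is at
            most a multiple of r^(2-d).\<close>
          proof (cases "t / 2 \<le> norm (z - y)")
            case True
            have "norm (z - y) powr (- (d - 2)) \<le> (t / 2) powr (- (d - 2))"
              using True t d3 by (intro powr_mono2') auto
            also have "\<dots> = A * t powr (- (d - 2))"
              by (rule half)
            finally have 1: "norm (z - y) powr (- (d - 2)) \<le> A * t powr (- (d - 2))" .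
            have "t powr (2 - d + \<delta>) \<le> (R / 4) powr (2 - d + \<delta>)"
              using tR R e by (intro powr_mono2') auto
            also have "\<dots> = A4 * R powr (2 - d + \<delta>)"
            proof -
              have "(1 / 4 :: real) powr (2 - d + \<delta>) = A4"
                unfolding A4_def by (simp add: powr_divide powr_minus_divide[symmetric] algebra_simps)
              then show ?thesis using R powr_mult[of "1 / 4" R "2 - d + \<delta>"] by simp
            qed
            finally have 2: "t powr (2 - d + \<delta>) \<le> A4 * R powr (2 - d + \<delta>)" .
            have "t powr (- (d - 2)) * (V z * (c0 * norm (z - y) powr (- (d - 2))))
                \<le> t powr (- (d - 2)) * (V z * (c0 * (A * t powr (- (d - 2)))))"
              using Vz c0 1 by (intro mult_left_mono) auto
            also have "\<dots> = c0 * A * V z * (t powr (- (d - 2)) * t powr (- (d - 2)))"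
              by (simp only: mult_ac)
            \<comment> \<open>The power t^(4-2d) is split into a factor controlled at radius R/4 and
              the weight of \<open>central_weight_bound\<close>.\<close>
            also have "t powr (- (d - 2)) * t powr (- (d - 2)) = t powr (2 - d + \<delta>) * t powr (- (d - 2 + \<delta>))"
              by (simp add: algebra_simps flip: powr_add)
            also have "c0 * A * V z * (t powr (2 - d + \<delta>) * t powr (- (d - 2 + \<delta>)))
                \<le> c0 * A * V z * ((A4 * R powr (2 - d + \<delta>)) * t powr (- (d - 2 + \<delta>)))"
              using c0 A Vz by (intro mult_left_mono mult_right_mono 2) auto
            also have "\<dots> = a1 * (t powr (- (d - 2 + \<delta>)) * V z)" by (simp only: a1_def mult_ac)
            finally have "?L \<le> ennreal (a1 * (t powr (- (d - 2 + \<delta>)) * V z))"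
              using L by (blast intro: order_trans ennreal_leI)
            also have "\<dots> = ennreal a1 * T1 z"
              using zin a Vz by (simp add: T1_def t_def ennreal_mult)
            finally show ?thesis by (simp add: add_increasing2 add.assoc)
          next
            case near: False
            have tri: "r \<le> norm (z - y) + t" "t \<le> norm (z - y) + r"
              using norm_triangle_ineq4[of "z - x0" "z - y"] norm_triangle_ineq[of "z - y" "y - x0"]
              by (simp_all add: r_def t_def dist_norm)
            then have zyr: "norm (z - y) < r" "r / 2 \<le> t" using near by linarith+
            then have zin': "z \<in> ball y r" by (simp add: dist_norm norm_minus_commute)
            have "t powr (- (d - 2)) \<le> (r / 2) powr (- (d - 2))"
              using zyr r d3 by (intro powr_mono2') auto
            also have "\<dots> = A * r powr (- (d - 2))"
              by (rule half)
            finally have "t powr (- (d - 2)) * (V z * (c0 * norm (z - y) powr (- (d - 2))))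
                \<le> A * r powr (- (d - 2)) * (V z * (c0 * norm (z - y) powr (- (d - 2))))"
              using Vz c0 by (intro mult_right_mono) auto
            also have "\<dots> = a2 * (norm (z - y) powr (- (d - 2)) * V z)" by (simp only: a2_def mult_ac)
            finally have "?L \<le> ennreal (a2 * (norm (z - y) powr (- (d - 2)) * V z))"
              using L by (blast intro: order_trans ennreal_leI)
            also have "\<dots> = ennreal a2 * T2 z"
              using zin zin' a Vz by (simp add: T2_def ennreal_mult)
            finally show ?thesis by (simp add: add_increasing add_increasing2)
          qed
        qed
        then show ?thesis using False by simp
      qed simp
    qed
    have "(\<integral>\<^sup>+z. ennreal (newton (z - x0)) * ennreal (V z * u z) * indicator (- ball x0 (R / 4)) z \<partial>lebesgue)
        \<le> (\<integral>\<^sup>+z. ennreal a1 * T1 z + ennreal a2 * T2 z + ennreal A * T3 z \<partial>lebesgue)"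
      by (rule nn_integral_mono_AE[OF pw])
    also have "\<dots> = ennreal a1 * (\<integral>\<^sup>+z. T1 z \<partial>lebesgue) + ennreal a2 * (\<integral>\<^sup>+z. T2 z \<partial>lebesgue) + ennreal A * (\<integral>\<^sup>+z. T3 z \<partial>lebesgue)"
      using T1m T2m T3m by (simp add: nn_integral_add nn_integral_cmult)
    also have "\<dots> \<le> ennreal a1 * ennreal (K1 * \<rho> powr (- \<delta>)) + ennreal a2 * ennreal (K2 * (r / \<rho>) powr \<alpha>)
        + ennreal A * ennreal (newton (x' - y))"
    proof (intro add_mono mult_left_mono)
      show "(\<integral>\<^sup>+z. T1 z \<partial>lebesgue) \<le> ennreal (K1 * \<rho> powr (- \<delta>))" unfolding T1_def \<rho>_def by (rule K1'[rule_format])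
      show "(\<integral>\<^sup>+z. T2 z \<partial>lebesgue) \<le> ennreal (K2 * (r / \<rho>) powr \<alpha>)" unfolding T2_def \<rho>_def by (rule K2'[rule_format, OF r(1)])
      have "x' \<noteq> y" using x'y r by auto
      then show "(\<integral>\<^sup>+z. T3 z \<partial>lebesgue) \<le> ennreal (newton (x' - y))" using pot unfolding T3_def by blast
    qed auto
    also have "\<dots> = ennreal (a1 * (K1 * \<rho> powr (- \<delta>)) + a2 * (K2 * (r / \<rho>) powr \<alpha>) + A * newton (x' - y))"
      using a A K1 K2 newton_nonneg[of "x' - y"] by (simp add: ennreal_mult' ennreal_plus)
    also have "\<dots> \<le> ennreal (K * R powr (2 - d + \<delta>) * \<rho> powr (- \<delta>))"
    proof (rule ennreal_leI)
      define X where "X = R powr (2 - d + \<delta>) * \<rho> powr (- \<delta>)"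
      have X: "0 \<le> X" by (simp add: X_def)
      have 1: "a1 * (K1 * \<rho> powr (- \<delta>)) = c0 * A * A4 * K1 * X" by (simp only: a1_def X_def mult_ac)
      have scale: "s powr (2 - d + \<delta>) * \<rho> powr (- \<delta>) \<le> X" if "R \<le> s" for s
        unfolding X_def using that R e by (intro mult_right_mono powr_mono2') auto
      have 2: "a2 * (K2 * (r / \<rho>) powr \<alpha>) \<le> c0 * A * K2 * X"
      proof -
        have "(r / \<rho>) powr \<alpha> \<le> (r / \<rho>) powr \<delta>" using r \<delta> by (intro powr_mono') auto
        then have "r powr (- (d - 2)) * (r / \<rho>) powr \<alpha> \<le> r powr (- (d - 2)) * (r / \<rho>) powr \<delta>"
          by (intro mult_left_mono) auto
        also have "\<dots> = r powr (2 - d + \<delta>) * \<rho> powr (- \<delta>)"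
          using r by (simp add: powr_divide powr_minus powr_add powr_diff field_simps)
        also have "\<dots> \<le> X" by (rule scale[OF r(2)])
        finally have "c0 * A * K2 * (r powr (- (d - 2)) * (r / \<rho>) powr \<alpha>) \<le> c0 * A * K2 * X"
          using c0 A K2 by (intro mult_left_mono) auto
        then show ?thesis by (simp only: a2_def mult_ac)
      qed
      have 3: "A * newton (x' - y) \<le> A * X"
      proof -
        have "newton (x' - y) \<le> \<rho> powr (- (d - 2))"
          unfolding newton_eq x'y using r d3 by (intro powr_mono2') auto
        also have "\<dots> = \<rho> powr (2 - d + \<delta>) * \<rho> powr (- \<delta>)" by (simp add: algebra_simps flip: powr_add)
        also have "\<dots> \<le> X" using r by (intro scale) simp
        finally show ?thesis using A by (intro mult_left_mono) auto
      qed
      have "a1 * (K1 * \<rho> powr (- \<delta>)) + a2 * (K2 * (r / \<rho>) powr \<alpha>) + A * newton (x' - y)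
          \<le> c0 * A * A4 * K1 * X + c0 * A * K2 * X + A * X"
        using 1 2 3 by linarith
      also have "\<dots> = K * X" by (simp add: K_def algebra_simps)
      finally show "a1 * (K1 * \<rho> powr (- \<delta>)) + a2 * (K2 * (r / \<rho>) powr \<alpha>) + A * newton (x' - y)
          \<le> K * R powr (2 - d + \<delta>) * \<rho> powr (- \<delta>)"
        by (simp only: X_def mult.assoc)
    qed
    finally show "(\<integral>\<^sup>+z. ennreal (newton (z - x0)) * ennreal (V z * u z) * indicator (- ball x0 (R / 4)) z \<partial>lebesgue)
        \<le> ennreal (K * R powr (2 - d + \<delta>) * crit_radius V x0 powr (- \<delta>))"
      by (simp only: \<rho>_def)
  qed
qed

end

section \<open>The Hessian of the far part of the potential\<close>

text \<open>From radius \<epsilon> on the cut-off is inactive, and this is the Hessian of |w|^(2-d).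
  With a = d/2 the two terms of the radial formula contribute 4a(a-1) and 2(a-1) times
  |w|^(-d).\<close>

lemma partial2_newton_reg_bound:
  fixes x z :: "real ^ 'n"
  assumes dim3: "3 \<le> CARD('n)" and \<epsilon>: "0 < \<epsilon>" "\<epsilon> \<le> norm (x - z)"
  shows "\<bar>partial2 i j (\<lambda>x. newton_reg \<epsilon> (x - z)) x\<bar>
    \<le> (real CARD('n) / 2 - 1) * (2 * real CARD('n) + 2) * norm (x - z) powr (- real CARD('n))"
proof -
  let ?a = "real CARD('n) / 2"
  define w s where "w = x - z" and "s = w \<bullet> w"
  have a: "1 < ?a" using dim3 by simp
  have s\<epsilon>: "\<epsilon>\<^sup>2 \<le> s" using inner_ge_power2[of \<epsilon> w] \<epsilon> by (simp add: s_def w_def)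
  have s: "0 < s" using s\<epsilon> zero_less_power[OF \<epsilon>(1), of 2] by linarith
  have "1 \<le> s / \<epsilon>\<^sup>2" using s\<epsilon> \<epsilon> by simp
  then have st: "step (s / \<epsilon>\<^sup>2) = 1" "dstep (s / \<epsilon>\<^sup>2) = 0" by (simp_all add: step_one dstep_zero)
  define P where "P = s powr (- ?a)"
  have P0: "0 \<le> P" by (simp add: P_def)
  have d1: "drprofile ?a \<epsilon> s = - (?a - 1) * P" by (simp add: drprofile_def st P_def)
  have d2: "ddrprofile ?a \<epsilon> s = (?a - 1) * ?a * P / s"
    using s by (simp add: ddrprofile_def st P_def powr_diff)
  have "\<bar>w $ i\<bar> * \<bar>w $ j\<bar> \<le> norm w * norm w"
    by (intro mult_mono component_le_norm_cart) auto
  also have "\<dots> = s" by (simp add: s_def dot_square_norm power2_eq_square)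
  finally have wij: "\<bar>w $ i\<bar> * \<bar>w $ j\<bar> \<le> s" .
  have "\<bar>4 * ddrprofile ?a \<epsilon> s * (w $ i) * (w $ j)\<bar> = 4 * ((?a - 1) * ?a * P / s) * (\<bar>w $ i\<bar> * \<bar>w $ j\<bar>)"
    using a s P0 by (simp add: d2 abs_mult)
  also have "\<dots> \<le> 4 * ((?a - 1) * ?a * P / s) * s"
    using a s P0 by (intro mult_left_mono wij) auto
  also have "\<dots> = 4 * ((?a - 1) * ?a * P)" using s by simp
  finally have 1: "\<bar>4 * ddrprofile ?a \<epsilon> s * (w $ i) * (w $ j)\<bar> \<le> 4 * ((?a - 1) * ?a * P)" .
  have 2: "\<bar>if i = j then 2 * drprofile ?a \<epsilon> s else 0\<bar> \<le> 2 * ((?a - 1) * P)"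
    using a P0 by (simp add: d1 abs_mult)
  have "partial2 i j (\<lambda>x. newton_reg \<epsilon> (x - z)) x = 4 * ddrprofile ?a \<epsilon> s * (w $ i) * (w $ j) + (if i = j then 2 * drprofile ?a \<epsilon> s else 0)"
    unfolding newton_reg_def s_def w_def
    by (rule partial2_radial[OF rprofile_has_derivative[OF \<epsilon>(1)] drprofile_has_derivative[OF \<epsilon>(1)]])
  then have "\<bar>partial2 i j (\<lambda>x. newton_reg \<epsilon> (x - z)) x\<bar> \<le> 4 * ((?a - 1) * ?a * P) + 2 * ((?a - 1) * P)"
    using 1 2 by linarith
  also have "\<dots> = (?a - 1) * (2 * real CARD('n) + 2) * P" by (simp add: algebra_simps)
  also have "P = norm w powr (- real CARD('n))"
  proof -
    have "s = norm w powr 2" using s by (simp add: s_def dot_square_norm powr_numeral)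
    then have "P = norm w powr (2 * (- ?a))" unfolding P_def by (simp only: powr_powr)
    then show ?thesis by simp
  qed
  finally show ?thesis by (simp only: w_def)
qed

text \<open>The first two factors come from \<open>partial2_newton_reg_bound\<close>, 2^d from |x -
  z| \<ge> |z - x0|/2, and 16 from |z - x0| \<ge> R/4, which trades |z - x0|^(-2) for
  16/R^2.\<close>

definition far_const :: "(real ^ 'n::finite) itself \<Rightarrow> real" where
  "far_const _ = (real CARD('n) / 2 - 1) * (2 * real CARD('n) + 2) * 2 powr real CARD('n) * 16"

text \<open>On the support of \<phi> the distance to z is at least R/8, so the kernel may be
  replaced by its smooth version at that scale. Both derivatives then move onto a function that is
  smooth everywhere.\<close>

lemma newton_test_integral_bound:
  fixes x0 z :: "real ^ 'n"
  assumes dim3: "3 \<le> CARD('n)" and R: "0 < R" and \<phi>: "test_function (ball x0 (R / 8)) \<phi>"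
    and z: "z \<notin> ball x0 (R / 4)"
  shows "\<bar>LINT x|lebesgue. partial2 i j \<phi> x * newton (x - z)\<bar>
    \<le> far_const TYPE(real ^ 'n) / R\<^sup>2 * newton (z - x0) * (LINT x|lebesgue. \<bar>\<phi> x\<bar>)"
proof -
  let ?N = "real CARD('n)" and ?h = "\<lambda>x. newton_reg (R / 8) (x - z)"
  define B where "B = far_const TYPE(real ^ 'n) / R\<^sup>2 * newton (z - x0)"
  have R8: "0 < R / 8" using R by simp
  note s\<phi> = test_function_smooth[OF \<phi>]
  obtain K where K: "compact K" "K \<subseteq> ball x0 (R / 8)" "\<And>x. x \<notin> K \<Longrightarrow> \<phi> x = 0" "\<And>i j x. x \<notin> K \<Longrightarrow> partial2 i j \<phi> x = 0"
    using test_function_laplacian_support[OF \<phi>] by metis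
  have sh: "smooth_on UNIV ?h"
    unfolding newton_reg_def by (rule smooth_on_radial[OF smooth_rprofile])
  have far: "R / 8 \<le> norm (x - z)" "norm (z - x0) / 2 \<le> norm (x - z)" if "x \<in> ball x0 (R / 8)" for x
  proof -
    have "norm (z - x0) \<le> norm (x - z) + norm (x - x0)"
      using norm_triangle_ineq4[of "x - x0" "x - z"] by simp
    moreover have "norm (x - x0) < R / 8" "R / 4 \<le> norm (z - x0)"
      using that z by (simp_all add: dist_norm norm_minus_commute)
    ultimately show "R / 8 \<le> norm (x - z)" "norm (z - x0) / 2 \<le> norm (x - z)" by linarith+
  qed
  have zx: "R / 4 \<le> norm (z - x0)" "0 < norm (z - x0)" using z R by (auto simp: dist_norm norm_minus_commute)
  have c\<phi>: "continuous_on UNIV \<phi>" using smooth_continuous_on[OF s\<phi>, of UNIV "[]"] by simp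
  have bound: "\<bar>partial2 j i ?h x\<bar> \<le> B" if x: "x \<in> ball x0 (R / 8)" for x
  proof -
    have c: "0 \<le> (?N / 2 - 1) * (2 * ?N + 2)" using dim3 by simp
    have "\<bar>partial2 j i ?h x\<bar> \<le> (?N / 2 - 1) * (2 * ?N + 2) * norm (x - z) powr (- ?N)"
      by (rule partial2_newton_reg_bound[OF dim3 R8 far(1)[OF x]])
    also have "\<dots> \<le> (?N / 2 - 1) * (2 * ?N + 2) * (norm (z - x0) / 2) powr (- ?N)"
      using far(2)[OF x] zx c by (intro mult_left_mono powr_mono2') auto
    also have "(norm (z - x0) / 2) powr (- ?N) = 2 powr ?N * norm (z - x0) powr (- ?N)"
    proof -
      have "(2 :: real) powr (- ?N) = 1 / 2 powr ?N" by (rule powr_minus_divide)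
      then show ?thesis by (simp only: powr_divide) simp
    qed
    also have "norm (z - x0) powr (- ?N) \<le> 16 / R\<^sup>2 * newton (z - x0)"
    proof -
      have "norm (z - x0) powr (- ?N) = norm (z - x0) powr (- 2) * newton (z - x0)"
        unfolding newton_norm by (simp flip: powr_add)
      also have "norm (z - x0) powr (- 2) \<le> (R / 4) powr (- 2)"
        using zx R by (intro powr_mono2') auto
      also have "(R / 4) powr (- 2) = 16 / R\<^sup>2"
        using R by (simp add: powr_minus_divide power_divide)
      finally show ?thesis by (simp add: newton_nonneg mult_right_mono)
    qed
    finally have "\<bar>partial2 j i ?h x\<bar> \<le> (?N / 2 - 1) * (2 * ?N + 2) * (2 powr ?N * (16 / R\<^sup>2 * newton (z - x0)))"
      using c by (simp add: mult_left_mono)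
    also have "\<dots> = B" by (simp add: B_def far_const_def)
    finally show ?thesis .
  qed
  have "(LINT x|lebesgue. partial2 i j \<phi> x * newton (x - z)) = (LINT x|lebesgue. ?h x * partial2 i j \<phi> x)"
  proof (rule Bochner_Integration.integral_cong)
    fix x
    show "partial2 i j \<phi> x * newton (x - z) = ?h x * partial2 i j \<phi> x"
    proof (cases "x \<in> K")
      case True
      then have "R / 8 \<le> norm (x - z)" using far(1) K(2) by blast
      then show ?thesis using R8 by (simp add: newton_reg_outer)
    qed (simp add: K(4))
  qed simp
  also have "\<dots> = (LINT x|lebesgue. partial2 j i ?h x * \<phi> x)"
    by (rule integral_by_parts2[OF sh \<phi>])
  also have "\<bar>\<dots>\<bar> \<le> (LINT x|lebesgue. \<bar>partial2 j i ?h x * \<phi> x\<bar>)"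
    using integral_abs_bound by blast
  also have "\<dots> \<le> (LINT x|lebesgue. B * \<bar>\<phi> x\<bar>)"
  proof (rule Bochner_Integration.integral_mono)
    show "integrable lebesgue (\<lambda>x. \<bar>partial2 j i ?h x * \<phi> x\<bar>)"
      by (rule integrable_abs, rule continuous_support_integrable[OF _ _ K(1)])
         (intro continuous_on_mult continuous_on_partial2 sh c\<phi>, simp add: K(3))
    show "integrable lebesgue (\<lambda>x. B * \<bar>\<phi> x\<bar>)"
      by (rule integrable_mult_right, rule integrable_abs, rule continuous_support_integrable[OF c\<phi> K(3,1)])
    show "\<bar>partial2 j i ?h x * \<phi> x\<bar> \<le> B * \<bar>\<phi> x\<bar>" for x
      using bound K by (cases "x \<in> K") (auto simp: abs_mult intro!: mult_right_mono)
  qed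
  also have "\<dots> = B * (LINT x|lebesgue. \<bar>\<phi> x\<bar>)" by simp
  finally show ?thesis by (simp only: B_def)
qed

text \<open>Only the pairing of the potential with second derivatives of \<phi> is estimated: Fubini
  brings the \<open>x\<close>-integral inside, where \<open>newton_test_integral_bound\<close> holds
  for each z in the exterior, and \<open>Eb\<close> controls the remaining integral.\<close>

lemma far_potential_hessian:
  fixes x0 y :: "real ^ 'n" and V :: "real ^ 'n \<Rightarrow> real"
  assumes dim3: "3 \<le> CARD('n)" and G: "fundamental_solution V G" and V: "AE x in lebesgue. 0 \<le> V x"
    and R: "0 < R" "R \<le> dist y x0" and \<phi>: "test_function (ball x0 (R / 8)) \<phi>"
    and Eb: "0 \<le> Eb" "(\<integral>\<^sup>+z. ennreal (newton (z - x0)) * ennreal (V z * G z y) * indicator (- ball x0 (R / 4)) z \<partial>lebesgue) \<le> ennreal Eb"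
  shows "\<bar>LINT x|lebesgue. partial2 i j \<phi> x * (LINT z|lebesgue. newton (x - z) * (V z * G z y) * indicator (- ball x0 (R / 4)) z)\<bar>
      \<le> far_const TYPE(real ^ 'n) / R\<^sup>2 * Eb * (LINT x|lebesgue. \<bar>\<phi> x\<bar>)"
proof -
  let ?B = "- ball x0 (R / 4)"
  define g where "g z = V z * G z y * indicator ?B z" for z
  define D where "D x = partial2 i j \<phi> x" for x
  define C where "C = far_const TYPE(real ^ 'n) / R\<^sup>2"
  define I where "I = (LINT x|lebesgue. \<bar>\<phi> x\<bar>)"
  have I0: "0 \<le> I" unfolding I_def by (rule Bochner_Integration.integral_nonneg) simp
  have C0: "0 \<le> C" using dim3 by (simp add: C_def far_const_def)
  note s\<phi> = test_function_smooth[OF \<phi>]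
  obtain K where K: "compact K" "K \<subseteq> ball x0 (R / 8)" "\<And>x. x \<notin> K \<Longrightarrow> D x = 0"
    unfolding D_def using test_function_laplacian_support[OF \<phi>] by metis
  have cD: "continuous_on UNIV D" unfolding D_def using continuous_on_partial2[OF s\<phi>, of UNIV i j] by simp
  have Di: "integrable lebesgue D" by (rule continuous_support_integrable[OF cD K(3,1)])
  note loc = fundamental_locally_integrable[OF dim3 G, of y]
  have gm: "g \<in> borel_measurable lebesgue"
    unfolding g_def by (intro borel_measurable_times locally_integrable_measurable[OF loc(2)] borel_measurable_indicator) auto
  have gle: "AE z in lebesgue. \<bar>g z\<bar> \<le> V z * G z y"
    using fundamental_potential_nonneg[OF dim3 G V, of y] by eventually_elim (simp add: g_def indicator_def)
  have xy: "R / 2 \<le> norm (x - y)" if "x \<in> K" for x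
  proof -
    have "norm (y - x0) \<le> norm (x - y) + norm (x - x0)"
      using norm_triangle_ineq4[of "x - x0" "x - y"] by simp
    moreover have "norm (x - x0) < R / 8" using that K(2) by (auto simp: dist_norm norm_minus_commute)
    ultimately show ?thesis using R by (simp add: dist_norm)
  qed
  note Nm = measurable_difference[OF newton_measurable]
  have Fm: "(\<lambda>(x, z). D x * (newton (x - z) * g z)) \<in> borel_measurable (lebesgue \<Otimes>\<^sub>M lebesgue)"
    unfolding split_beta'
    by (intro borel_measurable_times Nm measurable_compose[OF measurable_fst borel_measurable_integrable[OF Di]]
        measurable_compose[OF measurable_snd gm])
  have Fi: "integrable (lebesgue \<Otimes>\<^sub>M lebesgue) (\<lambda>(x, z). D x * (newton (x - z) * g z))"
  proof (rule integrableI_bounded[OF Fm])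
    \<comment> \<open>A bound for the kernel at x - y, as the support of \<open>D\<close> stays at
      distance R/2 from y; by the integral equation it also bounds the inner integral, which
      justifies Fubini.\<close>
    define c where "c = (R / 2) powr (2 - real CARD('n))"
    have "(\<integral>\<^sup>+p. ennreal (norm (case p of (x, z) \<Rightarrow> D x * (newton (x - z) * g z))) \<partial>(lebesgue \<Otimes>\<^sub>M lebesgue))
        = (\<integral>\<^sup>+x. (\<integral>\<^sup>+z. ennreal \<bar>D x * (newton (x - z) * g z)\<bar> \<partial>lebesgue) \<partial>lebesgue)"
      using Fm by (subst lebesgue.nn_integral_fst [symmetric]) auto
    also have "\<dots> \<le> (\<integral>\<^sup>+x. ennreal (c * \<bar>D x\<bar>) \<partial>lebesgue)"
    proof (rule nn_integral_mono)
      fix x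
      show "(\<integral>\<^sup>+z. ennreal \<bar>D x * (newton (x - z) * g z)\<bar> \<partial>lebesgue) \<le> ennreal (c * \<bar>D x\<bar>)"
      proof (cases "x \<in> K")
        case True
        then have nxy: "R / 2 \<le> norm (x - y)" "x \<noteq> y" using xy R by force+
        have "(\<integral>\<^sup>+z. ennreal \<bar>D x * (newton (x - z) * g z)\<bar> \<partial>lebesgue)
            \<le> (\<integral>\<^sup>+z. ennreal \<bar>D x\<bar> * (ennreal (newton (x - z)) * ennreal (V z * G z y)) \<partial>lebesgue)"
        proof (rule nn_integral_mono_AE)
          show "AE z in lebesgue. ennreal \<bar>D x * (newton (x - z) * g z)\<bar>
              \<le> ennreal \<bar>D x\<bar> * (ennreal (newton (x - z)) * ennreal (V z * G z y))"
            using gle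
          proof eventually_elim
            fix z assume "\<bar>g z\<bar> \<le> V z * G z y"
            then have "\<bar>D x\<bar> * (newton (x - z) * \<bar>g z\<bar>) \<le> \<bar>D x\<bar> * (newton (x - z) * (V z * G z y))"
              by (intro mult_left_mono newton_nonneg) auto
            then show "ennreal \<bar>D x * (newton (x - z) * g z)\<bar>
              \<le> ennreal \<bar>D x\<bar> * (ennreal (newton (x - z)) * ennreal (V z * G z y))"
              by (simp only: ennreal_mult'[OF newton_nonneg, symmetric] ennreal_mult'[OF abs_ge_zero, symmetric]
                  abs_mult abs_of_nonneg[OF newton_nonneg] ennreal_leI)
          qed
        qed
        also have "\<dots> = ennreal \<bar>D x\<bar> * (\<integral>\<^sup>+z. ennreal (newton (x - z)) * ennreal (V z * G z y) \<partial>lebesgue)"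
        proof (rule nn_integral_cmult)
          have "(\<lambda>z. ennreal (newton (x - z))) \<in> borel_measurable lebesgue" by (rule measurable_lebesgue) measurable
          then show "(\<lambda>z. ennreal (newton (x - z)) * ennreal (V z * G z y)) \<in> borel_measurable lebesgue"
            by (intro borel_measurable_times_ennreal measurable_compose[OF locally_integrable_measurable[OF loc(2)] measurable_ennreal])
        qed
        also have "\<dots> \<le> ennreal \<bar>D x\<bar> * ennreal (newton (x - y))"
          unfolding fundamental_representation_nn[OF dim3 G V nxy(2), symmetric]
          by (intro mult_left_mono) (simp_all add: add_increasing)
        also have "\<dots> \<le> ennreal \<bar>D x\<bar> * ennreal c"
          using nxy R dim3 unfolding newton_norm c_def by (intro mult_left_mono ennreal_leI powr_mono2') auto
        also have "\<dots> = ennreal (c * \<bar>D x\<bar>)" by (simp add: c_def mult.commute flip: ennreal_mult')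
        finally show ?thesis .
      qed (simp add: K(3))
    qed
    also have "\<dots> < \<infinity>"
    proof -
      have "integrable lebesgue (\<lambda>x. c * \<bar>D x\<bar>)" by (intro integrable_mult_right integrable_abs Di)
      then show ?thesis by (subst nn_integral_eq_integral) (auto simp: c_def)
    qed
    finally show "(\<integral>\<^sup>+p. ennreal (norm (case p of (x, z) \<Rightarrow> D x * (newton (x - z) * g z))) \<partial>(lebesgue \<Otimes>\<^sub>M lebesgue)) < \<infinity>" .
  qed
  have e2: "(LINT x|lebesgue. D x * (newton (x - z) * g z)) = (LINT x|lebesgue. D x * newton (x - z)) * g z" for z
    by (simp only: mult.assoc[symmetric] integral_mult_left_zero)
  have "(LINT x|lebesgue. D x * (LINT z|lebesgue. newton (x - z) * g z))
      = (LINT z|lebesgue. (LINT x|lebesgue. D x * newton (x - z)) * g z)"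
    using lebesgue_pair.Fubini_integral[OF Fi] unfolding e2 integral_mult_right_zero by (rule sym)
  also have "\<bar>\<dots>\<bar> \<le> C * Eb * I"
  proof -
    have int2: "integrable lebesgue (\<lambda>z. (LINT x|lebesgue. D x * newton (x - z)) * g z)"
      using lebesgue_pair.integrable_snd[OF Fi] unfolding e2 .
    have "ennreal \<bar>LINT z|lebesgue. (LINT x|lebesgue. D x * newton (x - z)) * g z\<bar>
        \<le> (\<integral>\<^sup>+z. ennreal \<bar>(LINT x|lebesgue. D x * newton (x - z)) * g z\<bar> \<partial>lebesgue)"
      using integral_norm_bound_ennreal[OF int2] by simp
    also have "\<dots> \<le> (\<integral>\<^sup>+z. ennreal (C * I) * (ennreal (newton (z - x0)) * ennreal (V z * G z y) * indicator ?B z) \<partial>lebesgue)"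
    proof (rule nn_integral_mono_AE)
      show "AE z in lebesgue. ennreal \<bar>(LINT x|lebesgue. D x * newton (x - z)) * g z\<bar>
          \<le> ennreal (C * I) * (ennreal (newton (z - x0)) * ennreal (V z * G z y) * indicator ?B z)"
        using fundamental_potential_nonneg[OF dim3 G V, of y]
      proof eventually_elim
        fix z assume VG: "0 \<le> V z * G z y"
        show "ennreal \<bar>(LINT x|lebesgue. D x * newton (x - z)) * g z\<bar>
          \<le> ennreal (C * I) * (ennreal (newton (z - x0)) * ennreal (V z * G z y) * indicator ?B z)"
        proof (cases "z \<in> ball x0 (R / 4)")
          case False
          have "\<bar>LINT x|lebesgue. D x * newton (x - z)\<bar> \<le> C * newton (z - x0) * I"
            unfolding D_def C_def I_def by (rule newton_test_integral_bound[OF dim3 R(1) \<phi> False])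
          then have "\<bar>LINT x|lebesgue. D x * newton (x - z)\<bar> * (V z * G z y) \<le> C * newton (z - x0) * I * (V z * G z y)"
            by (rule mult_right_mono[OF _ VG])
          moreover have "g z = V z * G z y" using False by (simp add: g_def)
          ultimately have "\<bar>(LINT x|lebesgue. D x * newton (x - z)) * g z\<bar> \<le> (C * I) * (newton (z - x0) * (V z * G z y))"
            unfolding abs_mult[of "LINT x|lebesgue. D x * newton (x - z)" "g z"] using VG by (simp add: mult_ac)
          then have "ennreal \<bar>(LINT x|lebesgue. D x * newton (x - z)) * g z\<bar> \<le> ennreal ((C * I) * (newton (z - x0) * (V z * G z y)))"
            by (rule ennreal_leI)
          also have "\<dots> = ennreal (C * I) * (ennreal (newton (z - x0)) * ennreal (V z * G z y))"
            using C0 I0 by (simp add: ennreal_mult' newton_nonneg)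
          finally show ?thesis using False by simp
        qed (simp add: g_def)
      qed
    qed
    also have "\<dots> = ennreal (C * I) * (\<integral>\<^sup>+z. ennreal (newton (z - x0)) * ennreal (V z * G z y) * indicator ?B z \<partial>lebesgue)"
    proof (rule nn_integral_cmult)
      have "(\<lambda>z. ennreal (newton (z - x0))) \<in> borel_measurable lebesgue" by (rule measurable_lebesgue) measurable
      then show "(\<lambda>z. ennreal (newton (z - x0)) * ennreal (V z * G z y) * indicator ?B z) \<in> borel_measurable lebesgue"
        by (intro borel_measurable_times_ennreal borel_measurable_indicator
            measurable_compose[OF locally_integrable_measurable[OF loc(2)] measurable_ennreal]) auto
    qed
    also have "\<dots> \<le> ennreal (C * I) * ennreal Eb" by (intro mult_left_mono Eb) simp
    also have "\<dots> = ennreal (C * Eb * I)" using C0 I0 Eb by (simp add: mult_ac flip: ennreal_mult')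
    finally show ?thesis using C0 I0 Eb by simp
  qed
  finally show ?thesis unfolding D_def g_def C_def I_def by (simp only: mult.assoc)
qed

section \<open>Weak Hessians\<close>

lemma locally_integrable_bounded_linear:
  assumes "bounded_linear T" "locally_integrable_on f S"
  shows "locally_integrable_on (\<lambda>x. T (f x)) S"
  unfolding locally_integrable_on_def set_integrable_def
proof (intro allI impI)
  fix K assume "compact K \<and> K \<subseteq> S"
  then have "integrable lebesgue (\<lambda>x. indicator K x *\<^sub>R f x)" using locally_integrable_onD[OF assms(2)] by blast
  from integrable_bounded_linear[OF assms(1) this]
  show "integrable lebesgue (\<lambda>x. indicator K x *\<^sub>R T (f x))"
    by (simp add: bounded_linear.linear[OF assms(1)] linear_scale)
qed

lemma locally_integrable_subset: "locally_integrable_on f S \<Longrightarrow> T \<subseteq> S \<Longrightarrow> locally_integrable_on f T"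
  by (auto simp: locally_integrable_on_def)

lemma locally_integrable_add:
  "locally_integrable_on f S \<Longrightarrow> locally_integrable_on g S \<Longrightarrow> locally_integrable_on (\<lambda>x. f x + g x) S"
  by (auto simp: locally_integrable_on_def intro: set_integral_add)

lemma locally_integrable_const: "locally_integrable_on (\<lambda>_. c :: real) S" for S :: "'a::euclidean_space set"
  using continuous_locally_integrable[of "\<lambda>_. c"] by (auto intro: locally_integrable_subset)

lemma test_function_mono: "test_function S \<phi> \<Longrightarrow> S \<subseteq> T \<Longrightarrow> test_function T \<phi>"
  by (auto simp: test_function_def)

lemma weak_hessian_mono: "weak_hessian S u H \<Longrightarrow> T \<subseteq> S \<Longrightarrow> weak_hessian T u H"
  by (auto simp: weak_hessian_def intro: locally_integrable_subset test_function_mono)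

lemma test_function_integrable_mult:
  fixes f :: "real ^ 'n \<Rightarrow> real"
  assumes f: "locally_integrable_on f S" and \<phi>: "test_function S \<phi>"
  shows "integrable lebesgue (\<lambda>x. f x * \<phi> x)" "integrable lebesgue (\<lambda>x. f x * partial2 i j \<phi> x)"
proof -
  obtain K where K: "compact K" "K \<subseteq> S" "\<And>x. x \<notin> K \<Longrightarrow> \<phi> x = 0" "\<And>i j x. x \<notin> K \<Longrightarrow> partial2 i j \<phi> x = 0"
    using test_function_laplacian_support[OF \<phi>] by metis
  have c: "continuous_on UNIV \<phi>" "continuous_on UNIV (partial2 i j \<phi>)"
    using smooth_continuous_on[OF test_function_smooth[OF \<phi>], of UNIV "[]"]
      continuous_on_partial2[OF test_function_smooth[OF \<phi>]] by simp_all
  have m: "h \<in> borel_measurable lebesgue" if "continuous_on UNIV h" for h :: "real ^ 'n \<Rightarrow> real"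
    using that by (intro measurable_lebesgue borel_measurable_continuous_onI)
  obtain B where B: "\<And>x. \<bar>\<phi> x\<bar> \<le> B" using continuous_support_bounded[OF c(1) K(3,1)] by metis
  show "integrable lebesgue (\<lambda>x. f x * \<phi> x)" by (rule locally_integrable_mult[OF f m[OF c(1)] B K(3,1,2)])
  obtain B' where B': "\<And>x. \<bar>partial2 i j \<phi> x\<bar> \<le> B'" using continuous_support_bounded[OF c(2) K(4,1)] by metis
  show "integrable lebesgue (\<lambda>x. f x * partial2 i j \<phi> x)" by (rule locally_integrable_mult[OF f m[OF c(2)] B' K(4,1,2)])
qed

lemma weak_hessian_add_scale:
  fixes u v :: "real ^ 'n \<Rightarrow> real" and c :: real
  assumes u: "weak_hessian S u H" and v: "weak_hessian S v K"
  shows "weak_hessian S (\<lambda>x. u x + c * v x) (\<lambda>x. H x + c *\<^sub>R K x)"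
proof -
  have lu: "locally_integrable_on u S" "locally_integrable_on H S" and lv: "locally_integrable_on v S" "locally_integrable_on K S"
    using u v by (auto simp: weak_hessian_def)
  have comp: "bounded_linear (\<lambda>A :: real ^ 'n ^ 'n. A $ i $ j)" for i j
    by (rule bounded_linear_compose[OF bounded_linear_vec_nth bounded_linear_vec_nth])
  have l2: "locally_integrable_on (\<lambda>x. u x + c * v x) S" "locally_integrable_on (\<lambda>x. H x + c *\<^sub>R K x) S"
    by (intro locally_integrable_add lu locally_integrable_bounded_linear[OF bounded_linear_mult_right lv(1)]
        locally_integrable_bounded_linear[OF bounded_linear_scaleR_right lv(2)])+
  have "(LINT x|lebesgue. (u x + c * v x) * partial2 i j \<phi> x) = (LINT x|lebesgue. (H x + c *\<^sub>R K x) $ i $ j * \<phi> x)"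
    if \<phi>: "test_function S \<phi>" for \<phi> i j
  proof -
    note iu = test_function_integrable_mult(2)[OF lu(1) \<phi>, of i j]
      test_function_integrable_mult(1)[OF locally_integrable_bounded_linear[OF comp lu(2)] \<phi>, of i j]
    note iv = test_function_integrable_mult(2)[OF lv(1) \<phi>, of i j]
      test_function_integrable_mult(1)[OF locally_integrable_bounded_linear[OF comp lv(2)] \<phi>, of i j]
    have "(LINT x|lebesgue. (u x + c * v x) * partial2 i j \<phi> x) = (LINT x|lebesgue. u x * partial2 i j \<phi> x + c * (v x * partial2 i j \<phi> x))"
      by (simp add: algebra_simps)
    also have "\<dots> = (LINT x|lebesgue. u x * partial2 i j \<phi> x) + c * (LINT x|lebesgue. v x * partial2 i j \<phi> x)"
      using iu iv by simp
    also have "\<dots> = (LINT x|lebesgue. H x $ i $ j * \<phi> x) + c * (LINT x|lebesgue. K x $ i $ j * \<phi> x)"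
      using u v \<phi> by (simp add: weak_hessian_def)
    also have "\<dots> = (LINT x|lebesgue. H x $ i $ j * \<phi> x + c * (K x $ i $ j * \<phi> x))"
      using iu iv by simp
    also have "\<dots> = (LINT x|lebesgue. (H x + c *\<^sub>R K x) $ i $ j * \<phi> x)"
      by (simp add: algebra_simps)
    finally show ?thesis .
  qed
  with l2 show ?thesis by (simp add: weak_hessian_def)
qed

text \<open>Duality of L^1 and L^\<infinity> for test functions: the hypothesis says that b + H_ij
  and b - H_ij have nonnegative pairings with nonnegative test functions, hence are nonnegative
  almost everywhere. Summing over all entries gives the factor d^2.\<close>

lemma weak_hessian_bound_AE:
  fixes u :: "real ^ 'n \<Rightarrow> real"
  assumes S: "open S" and H: "weak_hessian S u H"
    and bound: "\<And>\<phi> i j. test_function S \<phi> \<Longrightarrow> \<bar>LINT x|lebesgue. u x * partial2 i j \<phi> x\<bar> \<le> b * (LINT x|lebesgue. \<bar>\<phi> x\<bar>)"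
  shows "AE x in lebesgue. x \<in> S \<longrightarrow> norm (H x) \<le> (real CARD('n))\<^sup>2 * b"
proof -
  have comp: "bounded_linear (\<lambda>A :: real ^ 'n ^ 'n. A $ i $ j)" for i j
    by (rule bounded_linear_compose[OF bounded_linear_vec_nth bounded_linear_vec_nth])
  have lH: "locally_integrable_on (\<lambda>x. H x $ i $ j) S" for i j
    using locally_integrable_bounded_linear[OF comp, of H S i j] H by (simp add: weak_hessian_def)
  have sgn: "AE x in lebesgue. x \<in> S \<longrightarrow> 0 \<le> b + s * (H x $ i $ j)" if s: "\<bar>s\<bar> = 1" for i j and s :: real
  proof (rule test_nonneg_AE[OF S])
    show l: "locally_integrable_on (\<lambda>x. b + s * (H x $ i $ j)) S"
      by (intro locally_integrable_add locally_integrable_const locally_integrable_bounded_linear[OF bounded_linear_mult_right lH])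
    fix \<phi> :: "real ^ 'n \<Rightarrow> real" assume \<phi>: "test_function S \<phi>" and \<phi>0: "\<And>x. 0 \<le> \<phi> x"
    have i: "integrable lebesgue (\<lambda>x. H x $ i $ j * \<phi> x)" "integrable lebesgue \<phi>"
      using test_function_integrable_mult(1)[OF lH \<phi>] test_function_integrable_mult(1)[OF locally_integrable_const[of 1] \<phi>] by simp_all
    have "(LINT x|lebesgue. (b + s * (H x $ i $ j)) * \<phi> x) = (LINT x|lebesgue. b * \<phi> x + s * (H x $ i $ j * \<phi> x))"
      by (simp add: algebra_simps)
    also have "\<dots> = b * (LINT x|lebesgue. \<phi> x) + s * (LINT x|lebesgue. H x $ i $ j * \<phi> x)"
      using i by simp
    also have "(LINT x|lebesgue. H x $ i $ j * \<phi> x) = (LINT x|lebesgue. u x * partial2 i j \<phi> x)"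
      using H \<phi> by (simp add: weak_hessian_def)
    finally have eq: "(LINT x|lebesgue. (b + s * (H x $ i $ j)) * \<phi> x)
        = b * (LINT x|lebesgue. \<phi> x) + s * (LINT x|lebesgue. u x * partial2 i j \<phi> x)" .
    have "\<bar>s * (LINT x|lebesgue. u x * partial2 i j \<phi> x)\<bar> \<le> b * (LINT x|lebesgue. \<phi> x)"
      using bound[OF \<phi>, of i j] \<phi>0 s by (simp add: abs_mult)
    then show "0 \<le> (LINT x|lebesgue. (b + s * (H x $ i $ j)) * \<phi> x)" unfolding eq by linarith
  qed
  have "AE x in lebesgue. x \<in> S \<longrightarrow> \<bar>H x $ i $ j\<bar> \<le> b" for i j
  proof -
    have 1: "\<bar>1 :: real\<bar> = 1" "\<bar>- 1 :: real\<bar> = 1" by simp_all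
    show ?thesis
      using sgn[OF 1(1), of i j] sgn[OF 1(2), of i j] by eventually_elim auto
  qed
  then have "AE x in lebesgue. \<forall>i\<in>UNIV. \<forall>j\<in>UNIV. x \<in> S \<longrightarrow> \<bar>H x $ i $ j\<bar> \<le> b"
    by (intro AE_finite_allI finite)
  then show ?thesis
  proof eventually_elim
    fix x assume *: "\<forall>i\<in>UNIV. \<forall>j\<in>UNIV. x \<in> S \<longrightarrow> \<bar>H x $ i $ j\<bar> \<le> b"
    show "x \<in> S \<longrightarrow> norm (H x) \<le> (real CARD('n))\<^sup>2 * b"
    proof
      assume "x \<in> S"
      have "norm (H x) \<le> (\<Sum>i\<in>UNIV. norm (H x $ i))" by (simp add: norm_vec_def L2_set_le_sum)
      also have "\<dots> \<le> (\<Sum>i\<in>(UNIV :: 'n set). \<Sum>j\<in>(UNIV :: 'n set). b)"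
      proof (rule sum_mono)
        fix i
        have "norm (H x $ i) \<le> (\<Sum>j\<in>UNIV. \<bar>H x $ i $ j\<bar>)" by (rule norm_le_l1_cart)
        also have "\<dots> \<le> (\<Sum>j\<in>(UNIV :: 'n set). b)" using * \<open>x \<in> S\<close> by (intro sum_mono) auto
        finally show "norm (H x $ i) \<le> (\<Sum>j\<in>(UNIV :: 'n set). b)" .
      qed
      also have "\<dots> = (real CARD('n))\<^sup>2 * b" by (simp add: power2_eq_square)
      finally show "norm (H x) \<le> (real CARD('n))\<^sup>2 * b" .
    qed
  qed
qed

text \<open>The ball stays away from the pole, so G is bounded on it and the product inherits local
  q-integrability from V. This makes it an admissible argument of the Riesz transform; symmetry
  turns G y z into the controlled G z y.\<close>

lemma compactly_supported_Lq_near: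
  fixes x0 y :: "real ^ 'n" and V :: "real ^ 'n \<Rightarrow> real"
  assumes dim3: "3 \<le> CARD('n)" and G: "fundamental_solution V G" and V: "AE x in lebesgue. 0 \<le> V x"
    and q: "0 < q" and Vq: "locally_integrable_on (\<lambda>x. V x powr q) UNIV"
    and s: "0 < s" "s < dist y x0"
  shows "compactly_supported_Lq q (\<lambda>z. V z * G y z * indicator (ball x0 s) z)"
proof -
  define h where "h z = V z * G y z * indicator (ball x0 s) z" for z
  define c where "c = (dist y x0 - s) powr (2 - real CARD('n)) / kmass TYPE(real ^ 'n)"
  have m: "0 < kmass TYPE(real ^ 'n)" by (rule kmass_pos[OF dim3])
  have ball: "z \<noteq> y" "dist y x0 - s \<le> norm (z - y)" if "z \<in> ball x0 s" for z
    using that s dist_triangle[of y x0 z] by (auto simp: dist_commute dist_norm norm_minus_commute)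
  have heq: "h z = (V z * G z y) * indicator (ball x0 s) z" for z
    using fundamental_symmetric[OF dim3 G V, of y z] ball(1)[of z] by (cases "z \<in> ball x0 s") (auto simp: h_def)
  have hm: "h \<in> borel_measurable lebesgue"
    unfolding heq
    by (intro borel_measurable_times locally_integrable_measurable[OF fundamental_locally_integrable(2)[OF dim3 G]]
        borel_measurable_indicator) auto
  have hb: "AE z in lebesgue. \<bar>h z\<bar> powr q \<le> c powr q * (indicator (cball x0 s) z *\<^sub>R V z powr q)"
    using V
  proof eventually_elim
    fix z assume Vz: "0 \<le> V z"
    show "\<bar>h z\<bar> powr q \<le> c powr q * (indicator (cball x0 s) z *\<^sub>R V z powr q)"
    proof (cases "z \<in> ball x0 s")
      case True
      have "newton (z - y) \<le> (dist y x0 - s) powr (2 - real CARD('n))"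
        unfolding newton_norm using ball(2)[OF True] s dim3 by (intro powr_mono2') auto
      then have "kmass TYPE(real ^ 'n) * G z y \<le> kmass TYPE(real ^ 'n) * c"
        using fundamental_le[OF dim3 G V ball(1)[OF True]] m by (simp add: c_def)
      then have "G z y \<le> c" using m by simp
      moreover have G0: "0 \<le> G z y" by (rule fundamental_nonneg[OF dim3 G V ball(1)[OF True]])
      ultimately have "V z * G z y \<le> c * V z" 
        using mult_left_mono[OF \<open>G z y \<le> c\<close> Vz] by (simp only: mult.commute)
      then have "\<bar>h z\<bar> \<le> c * V z" using True Vz G0 by (simp add: heq)
      then have "\<bar>h z\<bar> powr q \<le> (c * V z) powr q" using q by (intro powr_mono2) auto
      moreover have "z \<in> cball x0 s" using True by simp
      ultimately show ?thesis by (simp add: powr_mult)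
    qed (simp add: h_def)
  qed
  have "integrable lebesgue (\<lambda>z. \<bar>h z\<bar> powr q)"
  proof (rule Bochner_Integration.integrable_bound)
    show "integrable lebesgue (\<lambda>z. c powr q * (indicator (cball x0 s) z *\<^sub>R V z powr q))"
      by (intro integrable_mult_right locally_integrable_onD[OF Vq]) auto
    show "(\<lambda>z. \<bar>h z\<bar> powr q) \<in> borel_measurable lebesgue" using hm by measurable
    show "AE z in lebesgue. norm (\<bar>h z\<bar> powr q) \<le> norm (c powr q * (indicator (cball x0 s) z *\<^sub>R V z powr q))"
      using hb by eventually_elim simp
  qed
  moreover have "h z = 0" if "z \<notin> cball x0 s" for z using that by (auto simp: h_def)
  ultimately show ?thesis
    using hm unfolding compactly_supported_Lq_def h_def by (blast intro: compact_cball)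
qed

theorem lemma6:
  fixes V :: "real ^ 'n \<Rightarrow> real" and q :: real
    and \<Gamma> \<Gamma>0 :: "real ^ 'n \<Rightarrow> real ^ 'n \<Rightarrow> real"
    and K2 K02 :: "real ^ 'n \<Rightarrow> real ^ 'n \<Rightarrow> real ^ 'n ^ 'n"
    and R2 :: "(real ^ 'n \<Rightarrow> real) \<Rightarrow> real ^ 'n \<Rightarrow> real ^ 'n ^ 'n"
  assumes "3 \<le> CARD('n)"
    and "real CARD('n) / 2 < q"
    and "AE x in lebesgue. 0 \<le> V x"
    and "\<not> (AE x in lebesgue. V x = 0)"
    and "reverse_Hoelder q V"
    and "fundamental_solution V \<Gamma>"
    and "fundamental_solution (\<lambda>_. 0) \<Gamma>0"
    and "hessian_kernel \<Gamma> K2"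
    and "hessian_kernel \<Gamma>0 K02"
    and "second_order_Riesz q \<Gamma>0 R2"
  shows "\<exists>C. \<forall>x0 y R. 0 < R \<and> R \<le> dist y x0 \<and> dist y x0 \<le> crit_radius V x0 \<longrightarrow>
     (AE x in lebesgue. x \<in> ball x0 (R / 8) \<longrightarrow>
        norm (K2 x y - K02 x y)
          \<le> C * norm (R2 (\<lambda>z. V z * \<Gamma> y z * indicator (ball x0 (R / 4)) z) x)
            + C / R ^ CARD('n) * (R / crit_radius V x0) powr min 1 (2 - real CARD('n) / q))"
proof -
  note dim3 = assms(1) and V = assms(3) and G = assms(6) and G0 = assms(7)
  interpret rh_potential V q "real CARD('n)" "measure lebesgue (ball (0 :: real ^ 'n) 1)" "2 - real CARD('n) / q"
    by unfold_locales (use assms in auto)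
  define m where "m = kmass TYPE(real ^ 'n)"
  have m: "0 < m" unfolding m_def by (rule kmass_pos[OF dim3])
  have "0 \<le> 1 / m" using m by simp
  from outer_potential_bound[OF this] obtain K where K: "0 \<le> K" and K': "\<forall>x0 y R u. u \<in> borel_measurable lebesgue \<longrightarrow>
      (\<forall>z. z \<noteq> y \<longrightarrow> u z \<le> 1 / m * newton (z - y)) \<longrightarrow>
      (\<forall>x. x \<noteq> y \<longrightarrow> (\<integral>\<^sup>+z. ennreal (newton (x - z)) * ennreal (V z * u z) \<partial>lebesgue) \<le> ennreal (newton (x - y))) \<longrightarrow>
      0 < R \<longrightarrow> R \<le> dist y x0 \<longrightarrow> dist y x0 \<le> crit_radius V x0 \<longrightarrow>
      ((\<integral>\<^sup>+z. ennreal (newton (z - x0)) * ennreal (V z * u z) * indicator (- ball x0 (R / 4)) z \<partial>lebesgue)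
        \<le> ennreal (K * R powr (2 - real CARD('n) + \<delta>) * crit_radius V x0 powr (- \<delta>)))"
    by (elim exE conjE)
  define F where "F = far_const TYPE(real ^ 'n)"
  have F: "0 \<le> F" using dim3 by (simp add: F_def far_const_def)
  \<comment> \<open>The factor d^2 passes from matrix entries to the norm, \<open>F\<close> comes
    from differentiating the kernel, \<open>K\<close> from the far potential, and 1/m from the
    normalisation of the Newtonian kernel.\<close>
  define C1 where "C1 = (real CARD('n))\<^sup>2 * (F * K / m)"
  have C1: "0 \<le> C1" using F K m by (simp add: C1_def)
  show ?thesis
  \<comment> \<open>The triangle inequality puts the coefficient 1 on the Riesz term, so the common
    constant must be at least 1.\<close>
  proof (intro exI[of _ "max 1 C1"] allI impI)
    fix x0 y :: "real ^ 'n" and R :: real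
    assume "0 < R \<and> R \<le> dist y x0 \<and> dist y x0 \<le> crit_radius V x0"
    then have R: "0 < R" "R \<le> dist y x0" "dist y x0 \<le> crit_radius V x0" by auto
    define \<rho> where "\<rho> = crit_radius V x0"
    have \<rho>: "0 < \<rho>" using R by (simp add: \<rho>_def)
    define B S where "B = ball x0 (R / 4)" and "S = ball x0 (R / 8)"
    define f where "f = (\<lambda>z. V z * \<Gamma> y z * indicator B z)"
    have yS: "S \<subseteq> - {y}" using R by (auto simp: S_def dist_commute)
    have yB: "y \<notin> B" using R by (auto simp: B_def dist_commute)
    note loc = fundamental_locally_integrable[OF dim3 G, of y]
    define Eb where "Eb = K * R powr (2 - real CARD('n) + \<delta>) * \<rho> powr (- \<delta>)"
    have Eb0: "0 \<le> Eb" using K by (simp add: Eb_def)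
    have Eb: "(\<integral>\<^sup>+z. ennreal (newton (z - x0)) * ennreal (V z * \<Gamma> z y) * indicator (- ball x0 (R / 4)) z \<partial>lebesgue) \<le> ennreal Eb"
      unfolding Eb_def \<rho>_def
    proof (rule K'[rule_format, OF _ _ _ R])
      show "(\<lambda>z. \<Gamma> z y) \<in> borel_measurable lebesgue" by (rule locally_integrable_measurable[OF loc(1)])
      show "\<Gamma> z y \<le> 1 / m * newton (z - y)" if "z \<noteq> y" for z
        using fundamental_le[OF dim3 G V that] m by (simp add: m_def field_simps)
      show "(\<integral>\<^sup>+z. ennreal (newton (x - z)) * ennreal (V z * \<Gamma> z y) \<partial>lebesgue) \<le> ennreal (newton (x - y))" if "x \<noteq> y" for x
        unfolding fundamental_representation_nn[OF dim3 G V that, symmetric] by (simp add: add_increasing)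
    qed
    have "compactly_supported_Lq q f"
      unfolding f_def B_def
      by (rule compactly_supported_Lq_near[OF dim3 G V])
         (use R q1 assms(5) in \<open>auto simp: reverse_Hoelder_def\<close>)
    then have hU: "weak_hessian UNIV (\<lambda>x. LINT z|lebesgue. \<Gamma>0 x z * f z) (R2 f)"
      using assms(10) by (simp add: second_order_Riesz_def)
    \<comment> \<open>The factors -1 and 1 give the sum the form required by
      \<open>weak_hessian_add_scale\<close>. On \<open>S\<close> the integral equation cancels the
      near part of the potential and leaves -1/m times the far part.\<close>
    define w where "w x = \<Gamma> x y + (-1) * \<Gamma>0 x y + 1 * (LINT z|lebesgue. \<Gamma>0 x z * f z)" for x
    define H where "H x = K2 x y + (-1) *\<^sub>R K02 x y + 1 *\<^sub>R R2 f x" for x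
    have hw: "weak_hessian S w H"
      unfolding w_def H_def
    proof (intro weak_hessian_add_scale)
      show "weak_hessian S (\<lambda>x. \<Gamma> x y) (\<lambda>x. K2 x y)" "weak_hessian S (\<lambda>x. \<Gamma>0 x y) (\<lambda>x. K02 x y)"
        using assms(8,9) yS unfolding hessian_kernel_def by (blast intro: weak_hessian_mono)+
      show "weak_hessian S (\<lambda>x. LINT z|lebesgue. \<Gamma>0 x z * f z) (R2 f)"
        by (rule weak_hessian_mono[OF hU subset_UNIV])
    qed
    define W where "W x = (LINT z|lebesgue. newton (x - z) * (V z * \<Gamma> z y) * indicator (- ball x0 (R / 4)) z)" for x
    have wW: "w x = - (1 / m) * W x" if "x \<in> S" for x
    proof -
      have xy: "x \<noteq> y" using that yS by blast
      note rep = fundamental_representation[OF dim3 G V xy]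
      have feq: "f z = (V z * \<Gamma> z y) * indicator B z" for z
        using fundamental_symmetric[OF dim3 G V, of y z] yB by (cases "z \<in> B") (auto simp: f_def)
      have "(LINT z|lebesgue. \<Gamma>0 x z * f z) = (LINT z|lebesgue. (1 / m) * (newton (x - z) * (V z * \<Gamma> z y) * indicator B z))"
      proof (rule integral_cong_AE)
        have split: "(\<lambda>z. (1 / m) * (newton (x - z) * (V z * \<Gamma> z y) * indicator B z)) \<in> borel_measurable lebesgue"
          by (intro borel_measurable_times borel_measurable_const borel_measurable_integrable[OF rep(1)] borel_measurable_indicator)
             (simp add: B_def)
        then show "(\<lambda>z. (1 / m) * (newton (x - z) * (V z * \<Gamma> z y) * indicator B z)) \<in> borel_measurable lebesgue" .
        show AE: "AE z in lebesgue. \<Gamma>0 x z * f z = (1 / m) * (newton (x - z) * (V z * \<Gamma> z y) * indicator B z)"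
          using AE_lebesgue_neq[of x]
          by eventually_elim (simp add: fundamental_solution_laplace[OF dim3 G0] feq m_def)
        \<comment> \<open>Measurability in the second variable is read off from the explicit formula
          for \<open>\<Gamma>0\<close>, which holds off the diagonal; the arbitrary value at z = x
          is patched in as a single point.\<close>
        show "(\<lambda>z. \<Gamma>0 x z * f z) \<in> borel_measurable lebesgue"
        proof -
          have "(\<lambda>z. if z = x then \<Gamma>0 x x * f x else (1 / m) * (newton (x - z) * (V z * \<Gamma> z y) * indicator B z)) \<in> borel_measurable lebesgue"
            by (rule measurable_If[OF _ split]) auto
          moreover have "(if z = x then \<Gamma>0 x x * f x else (1 / m) * (newton (x - z) * (V z * \<Gamma> z y) * indicator B z)) = \<Gamma>0 x z * f z" for z
            using fundamental_solution_laplace[OF dim3 G0, of x z] by (auto simp: feq m_def)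
          ultimately show ?thesis by simp
        qed
      qed
      then have U: "(LINT z|lebesgue. \<Gamma>0 x z * f z) = (1 / m) * (LINT z|lebesgue. newton (x - z) * (V z * \<Gamma> z y) * indicator B z)"
        by simp
      have ind: "integrable lebesgue (\<lambda>z. newton (x - z) * (V z * \<Gamma> z y) * indicator E z)" if "E \<in> sets lebesgue" for E
        using integrable_mult_indicator[OF that rep(1)] by (simp add: mult_ac)
      have "(LINT z|lebesgue. newton (x - z) * (V z * \<Gamma> z y) * indicator B z) + W x
          = (LINT z|lebesgue. newton (x - z) * (V z * \<Gamma> z y) * indicator B z + newton (x - z) * (V z * \<Gamma> z y) * indicator (- B) z)"
        unfolding W_def B_def[symmetric]
        by (rule Bochner_Integration.integral_add[symmetric]; rule ind) (auto simp: B_def)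
      also have "\<dots> = (LINT z|lebesgue. newton (x - z) * (V z * \<Gamma> z y))"
        by (intro Bochner_Integration.integral_cong) (auto simp: indicator_def)
      also have "\<dots> = newton (x - y) - m * \<Gamma> x y" using rep(2) by (simp add: m_def)
      finally have sum: "(LINT z|lebesgue. newton (x - z) * (V z * \<Gamma> z y) * indicator B z) = newton (x - y) - m * \<Gamma> x y - W x"
        by linarith
      have "\<Gamma>0 x y = newton (x - y) / m" unfolding m_def by (rule fundamental_solution_laplace[OF dim3 G0 xy])
      then show ?thesis using m unfolding w_def U sum by (simp add: field_simps)
    qed
    define b where "b = F * Eb / (m * R\<^sup>2)"
    have bound: "\<bar>LINT x|lebesgue. w x * partial2 i j \<phi> x\<bar> \<le> b * (LINT x|lebesgue. \<bar>\<phi> x\<bar>)"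
      if \<phi>: "test_function S \<phi>" for \<phi> i j
    proof -
      have "w x * partial2 i j \<phi> x = - (1 / m) * (partial2 i j \<phi> x * W x)" for x
      proof (cases "x \<in> S")
        case False
        then have "partial2 i j \<phi> x = 0" using test_function_laplacian_support[OF \<phi>] by (metis subsetD)
        then show ?thesis by simp
      qed (simp add: wW)
      then have "\<bar>LINT x|lebesgue. w x * partial2 i j \<phi> x\<bar> = (1 / m) * \<bar>LINT x|lebesgue. partial2 i j \<phi> x * W x\<bar>"
        using m by (simp add: abs_mult)
      also have "\<dots> \<le> (1 / m) * (F / R\<^sup>2 * Eb * (LINT x|lebesgue. \<bar>\<phi> x\<bar>))"
        unfolding W_def F_def using m
        by (intro mult_left_mono far_potential_hessian[OF dim3 G V R(1,2) \<phi>[unfolded S_def] Eb0 Eb]) auto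
      also have "\<dots> = b * (LINT x|lebesgue. \<bar>\<phi> x\<bar>)" by (simp add: b_def)
      finally show ?thesis .
    qed
    have "open S" by (simp add: S_def)
    \<comment> \<open>Two derivatives cost R^(-2), which lowers the Newtonian exponent 2 - d in
      \<open>Eb\<close> to -d and leaves the factor (R/\<rho>)^\<delta>.\<close>
    have rhs: "(real CARD('n))\<^sup>2 * b = C1 / R ^ CARD('n) * (R / \<rho>) powr \<delta>"
    proof -
      have "R powr (2 - real CARD('n) + \<delta>) = R\<^sup>2 / R ^ CARD('n) * R powr \<delta>"
        using R(1) by (simp add: powr_add powr_diff powr_realpow powr_numeral)
      then have "Eb = K * (R\<^sup>2 / R ^ CARD('n)) * (R / \<rho>) powr \<delta>"
        using R(1) \<rho> by (simp add: Eb_def powr_divide powr_minus field_simps)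
      then show ?thesis using R(1) by (simp add: b_def C1_def mult_ac)
    qed
    have "AE x in lebesgue. x \<in> S \<longrightarrow> norm (H x) \<le> (real CARD('n))\<^sup>2 * b"
      by (rule weak_hessian_bound_AE[OF \<open>open S\<close> hw bound])
    then have "AE x in lebesgue. x \<in> S \<longrightarrow> norm (K2 x y - K02 x y)
        \<le> max 1 C1 * norm (R2 f x) + max 1 C1 / R ^ CARD('n) * (R / \<rho>) powr \<delta>"
    proof eventually_elim
      fix x assume x: "x \<in> S \<longrightarrow> norm (H x) \<le> (real CARD('n))\<^sup>2 * b"
      show "x \<in> S \<longrightarrow> norm (K2 x y - K02 x y)
        \<le> max 1 C1 * norm (R2 f x) + max 1 C1 / R ^ CARD('n) * (R / \<rho>) powr \<delta>"
      proof
        assume "x \<in> S"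
        have "norm (K2 x y - K02 x y) = norm (H x - R2 f x)" by (simp add: H_def)
        also have "\<dots> \<le> norm (H x) + norm (R2 f x)" by (rule norm_triangle_ineq4)
        also have "norm (H x) \<le> C1 / R ^ CARD('n) * (R / \<rho>) powr \<delta>" using x \<open>x \<in> S\<close> rhs by simp
        also have "\<dots> \<le> max 1 C1 / R ^ CARD('n) * (R / \<rho>) powr \<delta>"
          using R(1) by (intro mult_right_mono divide_right_mono) auto
        also have "norm (R2 f x) \<le> max 1 C1 * norm (R2 f x)"
          using mult_right_mono[of 1 "max 1 C1" "norm (R2 f x)"] by simp
        finally show "norm (K2 x y - K02 x y)
          \<le> max 1 C1 * norm (R2 f x) + max 1 C1 / R ^ CARD('n) * (R / \<rho>) powr \<delta>" by simp
      qed
    qed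
    then show "AE x in lebesgue. x \<in> ball x0 (R / 8) \<longrightarrow> norm (K2 x y - K02 x y)
        \<le> max 1 C1 * norm (R2 (\<lambda>z. V z * \<Gamma> y z * indicator (ball x0 (R / 4)) z) x)
          + max 1 C1 / R ^ CARD('n) * (R / crit_radius V x0) powr min 1 (2 - real CARD('n) / q)"
      unfolding S_def f_def B_def \<rho>_def \<delta>_def .
  qed
qed

end
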